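(* The category $\mathbf{OS}$ is locally countably presentable.
   Context: An (abstract) operator space is a complex vector space $X$ with a family of norms $\|\cdot\|_n$ on the spaces $\mathbb M_n(X)$ of $n\times n$ matrices with entries in $X$ ($n\in\mathbb N$) such that $(\mathbb M_1(X),\|\cdot\|_1)$ is a Banach space, $\|x\oplus y\|_{m+n}=\max\{\|x\|_m,\|y\|_n\}$ (with $x\oplus y$ the block-diagonal matrix), and $\|\alpha x\beta\|_m\le\|\alpha\|\|x\|_m\|\beta\|$ for all scalar matrices $\alpha,\beta\in M_m$ (with operator norm). For a linear map $u\colon X\to Y$, $u_n\colon\mathbb M_n(X)\to\mathbb M_n(Y)$ applies $u$ entrywise; $u$ is a complete contraction if every $u_n$ is a contraction. $\mathbf{OS}$ is the category of operator spaces with linear complete contractions as morphisms. For a regular cardinal $\alpha$, a poset is $\alpha$-directed if every subset of cardinality $<\alpha$ has an upper bound; an $\alpha$-directed colimit is a colimit of a functor from an $\alpha$-directed poset. An object $A$ is $\alpha$-presentable if $\mathrm{Hom}(A,-)$ preserves $\alpha$-directed colimits; "countably presentable" means $\aleph_1$-presentable. A set $\mathcal S$ of objects is a generating set if for distinct parallel $f,g\colon A\to B$ there are $S\in\mathcal S$ and $s\colon S\to A$ with $fs\ne gs$; it is strong if moreover for every monomorphism $m\colon A\to B$ that is not an isomorphism there exist $S\in\mathcal S$ and $f\colon S\to B$ not factorising through $m$. A category is locally $\alpha$-presentable if it is cocomplete and has a strong generating set consisting of $\alpha$-presentable objects; locally countably presentable means locally $\aleph_1$-presentable. *)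

theory Defs
  imports
    "Jordan_Normal_Form.VS_Connect"
    "HOL-Analysis.L2_Norm"
    "HOL-Library.FuncSet"
    "HOL-Library.Nat_Bijection"
begin

unbundle cardinal_syntax

section \<open>Categories\<close>

record ('o, 'm) cat =
  Obj :: "'o set"
  Arr :: "'m set"
  Dom :: "'m \<Rightarrow> 'o"
  Cod :: "'m \<Rightarrow> 'o"
  Idn :: "'o \<Rightarrow> 'm"
  Cmp :: "'m \<Rightarrow> 'm \<Rightarrow> 'm"  (infixr \<open>\<cdot>\<index>\<close> 75)

text \<open>\<open>g \<cdot>\<^bsub>C\<^esub> f\<close> means first \<open>f\<close>, then \<open>g\<close>.\<close>

definition Hom :: "('o, 'm) cat \<Rightarrow> 'o \<Rightarrow> 'o \<Rightarrow> 'm set" where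
  "Hom C A B = {f \<in> Arr C. Dom C f = A \<and> Cod C f = B}"

locale category =
  fixes C :: "('o, 'm) cat" (structure)
  assumes dom_obj: "f \<in> Arr C \<Longrightarrow> Dom C f \<in> Obj C"
    and cod_obj: "f \<in> Arr C \<Longrightarrow> Cod C f \<in> Obj C"
    and id_hom: "A \<in> Obj C \<Longrightarrow> Idn C A \<in> Hom C A A"
    and comp_hom: "\<lbrakk>f \<in> Hom C A B; g \<in> Hom C B D\<rbrakk> \<Longrightarrow> g \<cdot> f \<in> Hom C A D"
    and comp_id_left: "f \<in> Hom C A B \<Longrightarrow> Idn C B \<cdot> f = f"
    and comp_id_right: "f \<in> Hom C A B \<Longrightarrow> f \<cdot> Idn C A = f"
    and comp_assoc:
      "\<lbrakk>f \<in> Hom C A B; g \<in> Hom C B D; h \<in> Hom C D E\<rbrakk> \<Longrightarrow> h \<cdot> (g \<cdot> f) = (h \<cdot> g) \<cdot> f"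

definition monomorphism :: "('o, 'm) cat \<Rightarrow> 'm \<Rightarrow> bool" where
  "monomorphism C m \<longleftrightarrow> m \<in> Arr C \<and>
     (\<forall>A. \<forall>f \<in> Hom C A (Dom C m). \<forall>g \<in> Hom C A (Dom C m). m \<cdot>\<^bsub>C\<^esub> f = m \<cdot>\<^bsub>C\<^esub> g \<longrightarrow> f = g)"

definition isomorphism :: "('o, 'm) cat \<Rightarrow> 'm \<Rightarrow> bool" where
  "isomorphism C f \<longleftrightarrow> f \<in> Arr C \<and>
     (\<exists>g \<in> Hom C (Cod C f) (Dom C f).
        g \<cdot>\<^bsub>C\<^esub> f = Idn C (Dom C f) \<and> f \<cdot>\<^bsub>C\<^esub> g = Idn C (Cod C f))"

text \<open>A functor is given by its object map \<open>F\<close> and its arrow map \<open>Fm\<close>.\<close>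

definition is_functor ::
    "('j, 'k) cat \<Rightarrow> ('o, 'm) cat \<Rightarrow> ('j \<Rightarrow> 'o) \<Rightarrow> ('k \<Rightarrow> 'm) \<Rightarrow> bool" where
  "is_functor J C F Fm \<longleftrightarrow> category J \<and> category C \<and>
     (\<forall>j \<in> Obj J. F j \<in> Obj C) \<and>
     (\<forall>f \<in> Arr J. Fm f \<in> Hom C (F (Dom J f)) (F (Cod J f))) \<and>
     (\<forall>j \<in> Obj J. Fm (Idn J j) = Idn C (F j)) \<and>
     (\<forall>f \<in> Arr J. \<forall>g \<in> Arr J. Cod J f = Dom J g \<longrightarrow> Fm (g \<cdot>\<^bsub>J\<^esub> f) = Fm g \<cdot>\<^bsub>C\<^esub> Fm f)"

definition cocone ::
    "('j, 'k) cat \<Rightarrow> ('o, 'm) cat \<Rightarrow> ('j \<Rightarrow> 'o) \<Rightarrow> ('k \<Rightarrow> 'm) \<Rightarrow> 'o \<Rightarrow> ('j \<Rightarrow> 'm) \<Rightarrow> bool" where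
  "cocone J C F Fm L \<psi> \<longleftrightarrow> L \<in> Obj C \<and>
     (\<forall>j \<in> Obj J. \<psi> j \<in> Hom C (F j) L) \<and>
     (\<forall>f \<in> Arr J. \<psi> (Cod J f) \<cdot>\<^bsub>C\<^esub> Fm f = \<psi> (Dom J f))"

definition colimit ::
    "('j, 'k) cat \<Rightarrow> ('o, 'm) cat \<Rightarrow> ('j \<Rightarrow> 'o) \<Rightarrow> ('k \<Rightarrow> 'm) \<Rightarrow> 'o \<Rightarrow> ('j \<Rightarrow> 'm) \<Rightarrow> bool" where
  "colimit J C F Fm L \<psi> \<longleftrightarrow> cocone J C F Fm L \<psi> \<and>
     (\<forall>M \<phi>. cocone J C F Fm M \<phi> \<longrightarrow>
        (\<exists>!h. h \<in> Hom C L M \<and> (\<forall>j \<in> Obj J. h \<cdot>\<^bsub>C\<^esub> \<psi> j = \<phi> j)))"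

text \<open>
  The category of all sets of elements of type \<open>'a\<close>. Its arrows carry domain and codomain; the
  underlying function is undefined outside its domain.
\<close>

definition set_cat :: "('a set, 'a set \<times> ('a \<Rightarrow> 'a) \<times> 'a set) cat" where
  "set_cat = \<lparr>
     Obj = UNIV,
     Arr = {(A, f, B). f \<in> A \<rightarrow>\<^sub>E B},
     Dom = (\<lambda>(A, f, B). A),
     Cod = (\<lambda>(A, f, B). B),
     Idn = (\<lambda>A. (A, \<lambda>x\<in>A. x, A)),
     Cmp = (\<lambda>(_, g, D) (A, f, _). (A, compose A g f, D))\<rparr>"

text \<open>The arrow map of the functor \<open>Hom(A,-)\<close>; its object map is \<^term>\<open>Hom C A\<close>.\<close>

definition hom_map ::
    "('o, 'm) cat \<Rightarrow> 'o \<Rightarrow> 'm \<Rightarrow> 'm set \<times> ('m \<Rightarrow> 'm) \<times> 'm set" where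
  "hom_map C A f = (Hom C A (Dom C f), \<lambda>g\<in>Hom C A (Dom C f). f \<cdot>\<^bsub>C\<^esub> g, Hom C A (Cod C f))"

definition poset_cat :: "'p set \<Rightarrow> 'p rel \<Rightarrow> ('p, 'p \<times> 'p) cat" where
  "poset_cat P r = \<lparr>
     Obj = P, Arr = r, Dom = fst, Cod = snd,
     Idn = (\<lambda>p. (p, p)), Cmp = (\<lambda>g f. (fst f, snd g))\<rparr>"


section \<open>Smallness\<close>

text \<open>
  HOL has no class of all sets, so ``small'' is taken relative to a cardinal \<open>\<kappa>\<close> on a type \<open>'u\<close>:
  a set is small if its cardinality is less than \<open>\<kappa>\<close>. Every small set then has a copy inside \<open>'u\<close>,
  so small structures may be taken to have their elements in \<open>'u\<close>.

  Rather than requiring \<open>\<kappa>\<close> to be strongly inaccessible (the size of a Grothendieck universe), only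
  closure under unions of small families (regularity) and under countable powers is demanded. This
  includes the inaccessible cardinals (\<open>universe_inaccessible\<close>) but, unlike these, such cardinals
  provably exist, above any given type (\<open>universe_cardSuc\<close>).
\<close>

definition universe :: "'u rel \<Rightarrow> bool" where
  "universe \<kappa> \<longleftrightarrow> Cinfinite \<kappa> \<and> regularCard \<kappa> \<and>
     (\<forall>A :: 'u set. |A| <o \<kappa> \<longrightarrow> |A| ^c natLeq <o \<kappa>)"

lemma universe_cardSuc: "universe (cardSuc |UNIV :: (nat \<Rightarrow> 'a set) set| )"
proof -
  let ?K = "|UNIV :: (nat \<Rightarrow> 'a set) set|"
  have inf: "infinite (UNIV :: (nat \<Rightarrow> 'a set) set)"
  proof -
    let ?d = "\<lambda>n i :: nat. if i = n then UNIV :: 'a set else {}"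
    have "inj ?d"
    proof (rule injI)
      fix m n assume "?d m = ?d n"
      from fun_cong[OF this, of m] show "m = n" by (simp split: if_splits)
    qed
    then have "infinite (range ?d)" using range_inj_infinite by blast
    then show ?thesis using finite_subset[OF subset_UNIV] by blast
  qed
  then have K: "Cinfinite ?K"
    by (intro conjI card_of_Card_order) (simp only: cinfinite_def Field_card_of not_False_eq_True)
  have pow: "?K ^c natLeq \<le>o ?K"
  proof -
    let ?g = "\<lambda>(f :: nat \<Rightarrow> nat \<Rightarrow> 'a set) n. f (fst (prod_decode n)) (snd (prod_decode n))"
    have "inj ?g"
    proof (rule injI, intro ext)
      fix f h :: "nat \<Rightarrow> nat \<Rightarrow> 'a set" and i j
      assume "?g f = ?g h"
      from fun_cong[OF this, of "prod_encode (i, j)"] show "f i j = h i j"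
        by (simp only: prod_encode_inverse fst_conv snd_conv)
    qed
    then have "inj_on ?g (Func (UNIV :: nat set) UNIV)"
      by (rule inj_on_subset) simp
    then have "|Func (UNIV :: nat set) (UNIV :: (nat \<Rightarrow> 'a set) set)| \<le>o ?K"
      by (intro card_of_ordLeqI) auto
    then show ?thesis by (simp add: cexp_def Field_natLeq Field_card_of)
  qed
  have "|A| ^c natLeq <o cardSuc ?K" if "|A| <o cardSuc ?K" for A :: "(nat \<Rightarrow> 'a set) set set"
  proof -
    have "|A| \<le>o ?K"
      by (rule iffD1[OF cardSuc_ordLeq_ordLess[OF card_of_Card_order card_of_Card_order] that])
    then have "|A| ^c natLeq \<le>o ?K ^c natLeq" by (rule cexp_mono1) (rule natLeq_Card_order)
    then have "|A| ^c natLeq \<le>o ?K" using pow by (rule ordLeq_transitive)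
    then show ?thesis
      by (rule iffD2[OF cardSuc_ordLeq_ordLess[OF card_of_Card_order Card_order_cexp]])
  qed
  then show ?thesis
    unfolding universe_def
    by (intro conjI allI impI Cinfinite_cardSuc[OF K, THEN conjunct1]
        Cinfinite_cardSuc[OF K, THEN conjunct2] regularCard_cardSuc[OF K])
qed

lemma universe_inaccessible:
  fixes \<kappa> :: "'u rel"
  assumes "Card_order \<kappa>" "natLeq <o \<kappa>" "regularCard \<kappa>"
    and strong_limit: "\<And>A :: 'u set. |A| <o \<kappa> \<Longrightarrow> |Pow A| <o \<kappa>"
  shows "universe \<kappa>"
  unfolding universe_def
proof (intro conjI allI impI)
  show cinf: "cinfinite \<kappa>"
    by (rule cinfinite_mono[OF ordLess_imp_ordLeq[OF assms(2)] natLeq_cinfinite])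
  show "Card_order \<kappa>" "regularCard \<kappa>" by fact+
  fix A :: "'u set"
  assume A: "|A| <o \<kappa>"
  have "|\<Union>n \<in> (UNIV :: nat set). {n} \<times> A| <o \<kappa>"
  proof (rule card_of_UNION_ordLess_infinite_Field_regularCard)
    show "|UNIV :: nat set| <o \<kappa>" using assms(2) by (rule ordIso_ordLess_trans[OF card_of_nat])
    have "|{n} \<times> A| \<le>o |A|" for n :: nat
      by (rule card_of_ordLeqI[of snd]) (auto simp: inj_on_def)
    then show "\<forall>n \<in> UNIV. |{n :: nat} \<times> A| <o \<kappa>"
      by (intro ballI) (rule ordLeq_ordLess_trans[OF _ A])
  qed (use assms cinf in auto)
  also have "(\<Union>n \<in> (UNIV :: nat set). {n} \<times> A) = UNIV \<times> A" by auto
  finally have "|UNIV \<times> A :: (nat \<times> 'u) set| <o \<kappa>" .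
  moreover have "\<kappa> \<le>o |UNIV :: 'u set|"
    by (rule ordIso_ordLeq_trans[OF ordIso_symmetric[OF card_of_Field_ordIso[OF assms(1)]]])
      (rule card_of_mono1[OF subset_UNIV])
  ultimately have "|UNIV \<times> A :: (nat \<times> 'u) set| \<le>o |UNIV :: 'u set|"
    by (rule ordLess_imp_ordLeq[OF ordLess_ordLeq_trans])
  then obtain e :: "nat \<times> 'u \<Rightarrow> 'u" where e: "inj_on e (UNIV \<times> A)"
    by (elim iffD2[OF card_of_ordLeq, elim_format] exE conjE)
  let ?B = "e ` (UNIV \<times> A)"
  have "|?B| <o \<kappa>"
    by (rule ordLeq_ordLess_trans[OF card_of_image]) fact
  then have "|Pow ?B| <o \<kappa>" by (rule strong_limit)
  moreover have "|Func (UNIV :: nat set) A| \<le>o |Pow ?B|"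
  proof (rule card_of_ordLeqI)
    show "inj_on (\<lambda>f. range (\<lambda>n. e (n, f n))) (Func (UNIV :: nat set) A)"
    proof (rule inj_onI, rule ext)
      fix f g :: "nat \<Rightarrow> 'u" and n
      assume fg: "f \<in> Func UNIV A" "g \<in> Func UNIV A"
        and eq: "range (\<lambda>n. e (n, f n)) = range (\<lambda>n. e (n, g n))"
      have "e (n, f n) \<in> range (\<lambda>n. e (n, g n))" using eq by blast
      then obtain k where "e (n, f n) = e (k, g k)" by blast
      moreover have "f n \<in> A" "g k \<in> A" using fg by (auto simp: Func_def)
      ultimately have "(n, f n) = (k, g k)" using inj_onD[OF e] by blast
      then show "f n = g n" by (elim Pair_inject) simp
    qed
  qed (auto simp: Func_def)
  ultimately have "|Func (UNIV :: nat set) A| <o \<kappa>"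
    by (rule ordLeq_ordLess_trans[rotated])
  then show "|A| ^c natLeq <o \<kappa>" by (simp add: cexp_def Field_natLeq Field_card_of)
qed


section \<open>Locally presentable categories\<close>

text \<open>
  Below, \<open>\<kappa>\<close> is the cardinal that fixes the meaning of ``small'', and \<open>\<alpha>\<close> is the degree of
  presentability.
\<close>

definition cocomplete :: "'u rel \<Rightarrow> ('o, 'm) cat \<Rightarrow> bool" where
  "cocomplete \<kappa> C \<longleftrightarrow>
     (\<forall>(J :: ('u, 'u) cat) F Fm. |Obj J| <o \<kappa> \<and> |Arr J| <o \<kappa> \<and> is_functor J C F Fm \<longrightarrow>
        (\<exists>L \<psi>. colimit J C F Fm L \<psi>))"

definition directed :: "'a rel \<Rightarrow> 'p set \<Rightarrow> 'p rel \<Rightarrow> bool" where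
  "directed \<alpha> P r \<longleftrightarrow> partial_order_on P r \<and>
     (\<forall>S \<subseteq> P. |S| <o \<alpha> \<longrightarrow> (\<exists>b \<in> P. \<forall>s \<in> S. (s, b) \<in> r))"

text \<open>
  \<open>Hom(A,-)\<close> is regarded as a functor into the category of sets of arrows of \<open>C\<close>. Testing the
  universal property against these sets only is no restriction if there are at least two arrows:
  a map of sets \<open>p\<close> is bijective as soon as composition with \<open>p\<close> is a bijection between the maps
  into a two-element set.
\<close>

definition presentable :: "'u rel \<Rightarrow> 'a rel \<Rightarrow> ('o, 'm) cat \<Rightarrow> 'o \<Rightarrow> bool" where
  "presentable \<kappa> \<alpha> C A \<longleftrightarrow> A \<in> Obj C \<and>
     (\<forall>(P :: 'u set) r F Fm L \<psi>.
        |P| <o \<kappa> \<and> directed \<alpha> P r \<and> is_functor (poset_cat P r) C F Fm \<and>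
        colimit (poset_cat P r) C F Fm L \<psi> \<longrightarrow>
        colimit (poset_cat P r) set_cat
          (\<lambda>p. Hom C A (F p)) (\<lambda>f. hom_map C A (Fm f)) (Hom C A L) (\<lambda>p. hom_map C A (\<psi> p)))"

definition generating :: "('o, 'm) cat \<Rightarrow> 'o set \<Rightarrow> bool" where
  "generating C S \<longleftrightarrow> S \<subseteq> Obj C \<and>
     (\<forall>A B. \<forall>f \<in> Hom C A B. \<forall>g \<in> Hom C A B. f \<noteq> g \<longrightarrow>
        (\<exists>G \<in> S. \<exists>s \<in> Hom C G A. f \<cdot>\<^bsub>C\<^esub> s \<noteq> g \<cdot>\<^bsub>C\<^esub> s))"

definition strongly_generating :: "('o, 'm) cat \<Rightarrow> 'o set \<Rightarrow> bool" where
  "strongly_generating C S \<longleftrightarrow> generating C S \<and>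
     (\<forall>m. monomorphism C m \<and> \<not> isomorphism C m \<longrightarrow>
        (\<exists>G \<in> S. \<exists>f \<in> Hom C G (Cod C m). \<not> (\<exists>h \<in> Hom C G (Dom C m). m \<cdot>\<^bsub>C\<^esub> h = f)))"

definition locally_presentable :: "'u rel \<Rightarrow> 'a rel \<Rightarrow> ('o, 'm) cat \<Rightarrow> bool" where
  "locally_presentable \<kappa> \<alpha> C \<longleftrightarrow> category C \<and> cocomplete \<kappa> C \<and>
     (\<exists>S. |S| <o \<kappa> \<and> strongly_generating C S \<and> (\<forall>G \<in> S. presentable \<kappa> \<alpha> C G))"

text \<open>\<^term>\<open>cardSuc natLeq\<close> is \<open>\<aleph>\<^sub>1\<close>.\<close>

definition locally_countably_presentable :: "'u rel \<Rightarrow> ('o, 'm) cat \<Rightarrow> bool" where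
  "locally_countably_presentable \<kappa> C \<longleftrightarrow> locally_presentable \<kappa> (cardSuc natLeq) C"


section \<open>Operator spaces\<close>

text \<open>
  \<open>mnorm X n\<close> is the norm on the \<open>n \<times> n\<close> matrices over \<open>X\<close>, for \<open>n \<ge> 1\<close>. The fields \<open>mult\<close> and
  \<open>one\<close> inherited from rings are not used.
\<close>

record 'u opspace = "(complex, 'u) module" +
  mnorm :: "nat \<Rightarrow> 'u mat \<Rightarrow> real"

definition mat_space :: "nat \<Rightarrow> (complex, 'u, 'x) module_scheme \<Rightarrow> (complex, 'u mat) module" where
  "mat_space n X = \<lparr>
     carrier = {x \<in> carrier_mat n n. elements_mat x \<subseteq> carrier X},
     mult = undefined,
     one = undefined,
     zero = mat n n (\<lambda>_. \<zero>\<^bsub>X\<^esub>),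
     add = (\<lambda>x y. mat n n (\<lambda>ij. x $$ ij \<oplus>\<^bsub>X\<^esub> y $$ ij)),
     smult = (\<lambda>c. map_mat (\<lambda>a. c \<odot>\<^bsub>X\<^esub> a))\<rparr>"

definition is_norm :: "(complex, 'v, 'x) module_scheme \<Rightarrow> ('v \<Rightarrow> real) \<Rightarrow> bool" where
  "is_norm V N \<longleftrightarrow>
     (\<forall>x \<in> carrier V. 0 \<le> N x \<and> (N x = 0 \<longleftrightarrow> x = \<zero>\<^bsub>V\<^esub>)) \<and>
     (\<forall>c. \<forall>x \<in> carrier V. N (c \<odot>\<^bsub>V\<^esub> x) = cmod c * N x) \<and>
     (\<forall>x \<in> carrier V. \<forall>y \<in> carrier V. N (x \<oplus>\<^bsub>V\<^esub> y) \<le> N x + N y)"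

definition is_banach :: "(complex, 'v, 'x) module_scheme \<Rightarrow> ('v \<Rightarrow> real) \<Rightarrow> bool" where
  "is_banach V N \<longleftrightarrow> vectorspace class_ring V \<and> is_norm V N \<and>
     (\<forall>\<sigma> :: nat \<Rightarrow> 'v. range \<sigma> \<subseteq> carrier V \<and>
        (\<forall>\<epsilon>>0. \<exists>K. \<forall>p\<ge>K. \<forall>q\<ge>K. N (\<sigma> p \<ominus>\<^bsub>V\<^esub> \<sigma> q) < \<epsilon>) \<longrightarrow>
        (\<exists>x \<in> carrier V. (\<lambda>p. N (\<sigma> p \<ominus>\<^bsub>V\<^esub> x)) \<longlonglongrightarrow> 0))"

definition direct_sum_mat ::
    "('a, 'u, 'x) module_scheme \<Rightarrow> nat \<Rightarrow> nat \<Rightarrow> 'u mat \<Rightarrow> 'u mat \<Rightarrow> 'u mat" where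
  "direct_sum_mat X m n x y = four_block_mat x (mat m n (\<lambda>_. \<zero>\<^bsub>X\<^esub>)) (mat n m (\<lambda>_. \<zero>\<^bsub>X\<^esub>)) y"

text \<open>The product \<open>a x b\<close> for \<open>m \<times> m\<close> matrices, \<open>a\<close> and \<open>b\<close> scalar and \<open>x\<close> over \<open>X\<close>.\<close>

definition scalar_mult_mat ::
    "(complex, 'u, 'x) module_scheme \<Rightarrow> nat \<Rightarrow> complex mat \<Rightarrow> 'u mat \<Rightarrow> complex mat \<Rightarrow> 'u mat" where
  "scalar_mult_mat X m a x b = mat m m (\<lambda>(i, j).
     \<Oplus>\<^bsub>X\<^esub>k\<in>{..<m}. \<Oplus>\<^bsub>X\<^esub>l\<in>{..<m}. (a $$ (i, k) * b $$ (l, j)) \<odot>\<^bsub>X\<^esub> x $$ (k, l))"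

definition vec_norm :: "complex vec \<Rightarrow> real" where
  "vec_norm v = L2_set (\<lambda>i. cmod (v $ i)) {..<dim_vec v}"

definition mat_op_norm :: "complex mat \<Rightarrow> real" where
  "mat_op_norm a = (SUP v \<in> {v \<in> carrier_vec (dim_col a). vec_norm v \<le> 1}. vec_norm (a *\<^sub>v v))"

definition operator_space :: "'u opspace \<Rightarrow> bool" where
  "operator_space X \<longleftrightarrow> vectorspace class_ring X \<and>
     (\<forall>n\<ge>1. is_norm (mat_space n X) (mnorm X n)) \<and>
     is_banach (mat_space 1 X) (mnorm X 1) \<and>
     (\<forall>m\<ge>1. \<forall>n\<ge>1. \<forall>x \<in> carrier (mat_space m X). \<forall>y \<in> carrier (mat_space n X).
        mnorm X (m + n) (direct_sum_mat X m n x y) = max (mnorm X m x) (mnorm X n y)) \<and>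
     (\<forall>m\<ge>1. \<forall>a \<in> carrier_mat m m. \<forall>b \<in> carrier_mat m m. \<forall>x \<in> carrier (mat_space m X).
        mnorm X m (scalar_mult_mat X m a x b) \<le> mat_op_norm a * mnorm X m x * mat_op_norm b)"

definition complete_contraction :: "'u opspace \<Rightarrow> 'v opspace \<Rightarrow> ('u \<Rightarrow> 'v) \<Rightarrow> bool" where
  "complete_contraction X Y u \<longleftrightarrow>
     (\<forall>n\<ge>1. \<forall>x \<in> carrier (mat_space n X). mnorm Y n (map_mat u x) \<le> mnorm X n x)"

text \<open>As in \<^const>\<open>set_cat\<close>, arrows carry domain and codomain and are undefined off the domain.\<close>

definition OS ::
    "'u rel \<Rightarrow> ('u opspace, 'u opspace \<times> ('u \<Rightarrow> 'u) \<times> 'u opspace) cat" where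
  "OS \<kappa> = \<lparr>
     Obj = {X. operator_space X \<and> |carrier X| <o \<kappa>},
     Arr = {(X, u, Y). operator_space X \<and> |carrier X| <o \<kappa> \<and>
              operator_space Y \<and> |carrier Y| <o \<kappa> \<and>
              u \<in> extensional (carrier X) \<and> linear_map class_ring X Y u \<and>
              complete_contraction X Y u},
     Dom = (\<lambda>(X, u, Y). X),
     Cod = (\<lambda>(X, u, Y). Y),
     Idn = (\<lambda>X. (X, \<lambda>x\<in>carrier X. x, X)),
     Cmp = (\<lambda>(_, v, Z) (X, u, _). (X, compose (carrier X) v u, Z))\<rparr>"

end

theory Submission
  imports Defs "HOL-Library.Countable_Set"
begin

text \<open>
  For every \<open>n\<close>, the functor sending an operator space \<open>X\<close> to the unit ball of \<open>M\<^sub>n(X)\<close> is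
  representable: the representing object \<open>T\<^sub>n\<close> is the closed span of the tautological \<open>n\<^sup>2\<close> elements
  in the product of all operator spaces with a marked point of this unit ball. The same construction,
  applied to all cocones under a small diagram, gives colimits; it never leaves the small spaces
  because a closed span of a small set is small. The \<open>T\<^sub>n\<close> form a strong generating set: a
  monomorphism through which all maps from the \<open>T\<^sub>n\<close> factor is a bijection mapping the matrix unit balls
  onto each other.

  An \<open>\<aleph>\<^sub>1\<close>-directed colimit can be computed algebraically, with the norm of a matrix being the
  infimum of the norms of its representatives. As the index set is countably directed, this infimum is
  attained, even simultaneously for countably many matrices, so that the norm axioms and completeness
  are inherited from the members of the system. In particular the unit balls of matrices of the
  colimit are the colimit of the unit balls, that is, \<open>T\<^sub>n\<close> is countably presentable.
\<close>


section \<open>Complex vector spaces and matrices over them\<close>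

text \<open>Existence in each universal property is free: every competing target is one of the
  coordinates of the product, and the required morphism is the projection to it. Only uniqueness
  calls for the closed span, in which combinations of the generators are dense. Size is the
  obstacle, since the coordinates range over all small spaces while the object needs a small carrier
  inside \<open>'u\<close>. An element of the closed span is determined by a sequence of
  combinations, so closure of \<kappa> under countable powers keeps it small, and an injection into
  \<open>'u\<close> re-encodes it.

  The space \<open>T 1\<close> alone generates, but it sees only the norms of vectors, and an
  isometric bijection may fail to have a completely contractive inverse; hence one
  \<open>T n\<close> for every matrix size.

  If the norm were only approximated, a matrix in the closed unit ball could lift merely to norms
  below 1 + \<epsilon>, and maps from \<open>T n\<close> would not factor.\<close>

abbreviation cvs :: "(complex, 'u, 'x) module_scheme \<Rightarrow> bool" where
  "cvs X \<equiv> vectorspace class_ring X"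

abbreviation clinear ::
    "(complex, 'u, 'x) module_scheme \<Rightarrow> (complex, 'v, 'y) module_scheme \<Rightarrow> ('u \<Rightarrow> 'v) \<Rightarrow> bool" where
  "clinear X Y f \<equiv> linear_map class_ring X Y f"

text \<open>Additive inverses come from the scalars: (-1)x + x = (-1 + 1)x = 0x, which
  \<open>smult_0\<close> makes zero.\<close>

lemma cvsI:
  fixes X :: "(complex, 'u, 'x) module_scheme"
  assumes zero: "\<zero>\<^bsub>X\<^esub> \<in> carrier X"
    and add: "\<And>x y. x \<in> carrier X \<Longrightarrow> y \<in> carrier X \<Longrightarrow> x \<oplus>\<^bsub>X\<^esub> y \<in> carrier X"
    and smult: "\<And>c x. x \<in> carrier X \<Longrightarrow> c \<odot>\<^bsub>X\<^esub> x \<in> carrier X"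
    and assoc: "\<And>x y z. x \<in> carrier X \<Longrightarrow> y \<in> carrier X \<Longrightarrow> z \<in> carrier X \<Longrightarrow>
      (x \<oplus>\<^bsub>X\<^esub> y) \<oplus>\<^bsub>X\<^esub> z = x \<oplus>\<^bsub>X\<^esub> (y \<oplus>\<^bsub>X\<^esub> z)"
    and comm: "\<And>x y. x \<in> carrier X \<Longrightarrow> y \<in> carrier X \<Longrightarrow> x \<oplus>\<^bsub>X\<^esub> y = y \<oplus>\<^bsub>X\<^esub> x"
    and l_zero: "\<And>x. x \<in> carrier X \<Longrightarrow> \<zero>\<^bsub>X\<^esub> \<oplus>\<^bsub>X\<^esub> x = x"
    and smult_add: "\<And>c x y. x \<in> carrier X \<Longrightarrow> y \<in> carrier X \<Longrightarrow>
      c \<odot>\<^bsub>X\<^esub> (x \<oplus>\<^bsub>X\<^esub> y) = c \<odot>\<^bsub>X\<^esub> x \<oplus>\<^bsub>X\<^esub> c \<odot>\<^bsub>X\<^esub> y"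
    and add_smult: "\<And>c d x. x \<in> carrier X \<Longrightarrow>
      (c + d) \<odot>\<^bsub>X\<^esub> x = c \<odot>\<^bsub>X\<^esub> x \<oplus>\<^bsub>X\<^esub> d \<odot>\<^bsub>X\<^esub> x"
    and smult_smult: "\<And>c d x. x \<in> carrier X \<Longrightarrow> (c * d) \<odot>\<^bsub>X\<^esub> x = c \<odot>\<^bsub>X\<^esub> (d \<odot>\<^bsub>X\<^esub> x)"
    and one: "\<And>x. x \<in> carrier X \<Longrightarrow> 1 \<odot>\<^bsub>X\<^esub> x = x"
    and smult_0: "\<And>x. x \<in> carrier X \<Longrightarrow> 0 \<odot>\<^bsub>X\<^esub> x = \<zero>\<^bsub>X\<^esub>"
  shows "cvs X"
proof -
  have inv: "\<exists>y\<in>carrier X. y \<oplus>\<^bsub>X\<^esub> x = \<zero>\<^bsub>X\<^esub>" if "x \<in> carrier X" for x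
  proof
    have "(-1) \<odot>\<^bsub>X\<^esub> x \<oplus>\<^bsub>X\<^esub> x = (-1) \<odot>\<^bsub>X\<^esub> x \<oplus>\<^bsub>X\<^esub> 1 \<odot>\<^bsub>X\<^esub> x" using that one by simp
    also have "\<dots> = 0 \<odot>\<^bsub>X\<^esub> x" using add_smult[OF that, of "-1" 1] by simp
    finally show "(-1) \<odot>\<^bsub>X\<^esub> x \<oplus>\<^bsub>X\<^esub> x = \<zero>\<^bsub>X\<^esub>" using smult_0 that by simp
  qed (use that smult in auto)
  have "abelian_group X"
    by (rule abelian_groupI) (use assms inv in auto)
  then have "Module.module class_ring X"
    by (intro Module.module.intro module_axioms.intro class_cring.is_cring) (use assms in auto)
  then show ?thesis
    unfolding vectorspace_def using class_field by blast
qed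

context
  fixes X :: "(complex, 'u, 'x) module_scheme"
  assumes X: "cvs X"
begin

interpretation vectorspace class_ring X by (rule X)

lemma cvs_abelian_group: "abelian_group X"
  by (rule M.abelian_group_axioms)

text \<open>The locale facts are restated under the hypothesis \<open>cvs X\<close>, with complex
  arithmetic in place of the operations of \<open>class_ring\<close>, so that several spaces can be
  handled at once by rewriting.\<close>

lemma cvs_zero: "\<zero>\<^bsub>X\<^esub> \<in> carrier X"
  and cvs_add: "x \<in> carrier X \<Longrightarrow> y \<in> carrier X \<Longrightarrow> x \<oplus>\<^bsub>X\<^esub> y \<in> carrier X"
  and cvs_smult: "x \<in> carrier X \<Longrightarrow> c \<odot>\<^bsub>X\<^esub> x \<in> carrier X"
  and cvs_assoc: "x \<in> carrier X \<Longrightarrow> y \<in> carrier X \<Longrightarrow> z \<in> carrier X \<Longrightarrow>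
      (x \<oplus>\<^bsub>X\<^esub> y) \<oplus>\<^bsub>X\<^esub> z = x \<oplus>\<^bsub>X\<^esub> (y \<oplus>\<^bsub>X\<^esub> z)"
  and cvs_comm: "x \<in> carrier X \<Longrightarrow> y \<in> carrier X \<Longrightarrow> x \<oplus>\<^bsub>X\<^esub> y = y \<oplus>\<^bsub>X\<^esub> x"
  and cvs_l_zero: "x \<in> carrier X \<Longrightarrow> \<zero>\<^bsub>X\<^esub> \<oplus>\<^bsub>X\<^esub> x = x"
  and cvs_r_zero: "x \<in> carrier X \<Longrightarrow> x \<oplus>\<^bsub>X\<^esub> \<zero>\<^bsub>X\<^esub> = x"
  and cvs_minus: "x \<in> carrier X \<Longrightarrow> y \<in> carrier X \<Longrightarrow> x \<ominus>\<^bsub>X\<^esub> y \<in> carrier X"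
  by (auto simp: M.add.m_assoc intro: M.add.m_comm)

lemma cvs_smult_add: "x \<in> carrier X \<Longrightarrow> y \<in> carrier X \<Longrightarrow>
      c \<odot>\<^bsub>X\<^esub> (x \<oplus>\<^bsub>X\<^esub> y) = c \<odot>\<^bsub>X\<^esub> x \<oplus>\<^bsub>X\<^esub> c \<odot>\<^bsub>X\<^esub> y"
  using smult_r_distr[of c x y] by simp

lemma cvs_add_smult: "x \<in> carrier X \<Longrightarrow> (c + d) \<odot>\<^bsub>X\<^esub> x = c \<odot>\<^bsub>X\<^esub> x \<oplus>\<^bsub>X\<^esub> d \<odot>\<^bsub>X\<^esub> x"
  using smult_l_distr[of c d x] by simp

lemma cvs_smult_smult: "x \<in> carrier X \<Longrightarrow> (c * d) \<odot>\<^bsub>X\<^esub> x = c \<odot>\<^bsub>X\<^esub> (d \<odot>\<^bsub>X\<^esub> x)"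
  using smult_assoc1[of c d x] by simp

lemma cvs_one: "x \<in> carrier X \<Longrightarrow> 1 \<odot>\<^bsub>X\<^esub> x = x"
  using smult_one[of x] by simp

lemma cvs_smult_0: "x \<in> carrier X \<Longrightarrow> 0 \<odot>\<^bsub>X\<^esub> x = \<zero>\<^bsub>X\<^esub>"
  using lmult_0[of x] by simp

lemma cvs_smult_zero: "c \<odot>\<^bsub>X\<^esub> \<zero>\<^bsub>X\<^esub> = \<zero>\<^bsub>X\<^esub>"
  using rmult_0[of c] by simp

lemma cvs_neg: "x \<in> carrier X \<Longrightarrow> (-1) \<odot>\<^bsub>X\<^esub> x = \<ominus>\<^bsub>X\<^esub> x"
proof -
  assume x: "x \<in> carrier X"
  then have "(-1) \<odot>\<^bsub>X\<^esub> x \<oplus>\<^bsub>X\<^esub> x = (-1 + 1) \<odot>\<^bsub>X\<^esub> x"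
    by (simp only: cvs_add_smult cvs_one)
  then show ?thesis
    using x by (intro M.minus_equality[symmetric]) (simp_all add: cvs_smult_0 cvs_smult)
qed

lemma cvs_minus_eq: "x \<in> carrier X \<Longrightarrow> y \<in> carrier X \<Longrightarrow> x \<ominus>\<^bsub>X\<^esub> y = x \<oplus>\<^bsub>X\<^esub> (-1) \<odot>\<^bsub>X\<^esub> y"
  by (simp add: a_minus_def cvs_neg)

lemma cvs_minus_add_minus:
  assumes "x \<in> carrier X" "y \<in> carrier X" "z \<in> carrier X"
  shows "(x \<ominus>\<^bsub>X\<^esub> y) \<oplus>\<^bsub>X\<^esub> (y \<ominus>\<^bsub>X\<^esub> z) = x \<ominus>\<^bsub>X\<^esub> z"
  using assms by (simp add: a_minus_def M.add.m_assoc M.r_neg2 M.r_neg1)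

lemma cvs_minus_eq_zero: "x \<in> carrier X \<Longrightarrow> y \<in> carrier X \<Longrightarrow> x \<ominus>\<^bsub>X\<^esub> y = \<zero>\<^bsub>X\<^esub> \<longleftrightarrow> x = y"
  using cvs_minus_add_minus[of x y "\<zero>\<^bsub>X\<^esub>"] M.r_neg[of y] by (auto simp: a_minus_def cvs_zero)

lemma cvs_add_minus_add:
  assumes "a \<in> carrier X" "b \<in> carrier X" "c \<in> carrier X" "d \<in> carrier X"
  shows "(a \<oplus>\<^bsub>X\<^esub> b) \<ominus>\<^bsub>X\<^esub> (c \<oplus>\<^bsub>X\<^esub> d) = (a \<ominus>\<^bsub>X\<^esub> c) \<oplus>\<^bsub>X\<^esub> (b \<ominus>\<^bsub>X\<^esub> d)"
  using assms by (simp add: a_minus_def M.minus_add M.add.m_ac)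

lemma cvs_minus_swap: "x \<in> carrier X \<Longrightarrow> y \<in> carrier X \<Longrightarrow> y \<ominus>\<^bsub>X\<^esub> x = (-1) \<odot>\<^bsub>X\<^esub> (x \<ominus>\<^bsub>X\<^esub> y)"
  by (simp add: cvs_neg a_minus_def M.minus_add M.add.m_comm)

lemma cvs_minus_smult: "x \<in> carrier X \<Longrightarrow> y \<in> carrier X \<Longrightarrow>
    c \<odot>\<^bsub>X\<^esub> x \<ominus>\<^bsub>X\<^esub> c \<odot>\<^bsub>X\<^esub> y = c \<odot>\<^bsub>X\<^esub> (x \<ominus>\<^bsub>X\<^esub> y)"
  by (simp add: cvs_minus_eq cvs_smult cvs_smult_add flip: cvs_smult_smult)

end

lemmas cvs_closed = cvs_zero cvs_add cvs_smult cvs_minus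

lemma clinear_iff:
  "clinear X Y f \<longleftrightarrow> cvs X \<and> cvs Y \<and> (\<forall>x\<in>carrier X. f x \<in> carrier Y) \<and>
     (\<forall>x\<in>carrier X. \<forall>y\<in>carrier X. f (x \<oplus>\<^bsub>X\<^esub> y) = f x \<oplus>\<^bsub>Y\<^esub> f y) \<and>
     (\<forall>c. \<forall>x\<in>carrier X. f (c \<odot>\<^bsub>X\<^esub> x) = c \<odot>\<^bsub>Y\<^esub> f x)"
  unfolding linear_map_def mod_hom_def mod_hom_axioms_def LinearCombinations.module_hom_def
  by (auto simp: vectorspace_def)

lemma clinear_cvs: "clinear X Y f \<Longrightarrow> cvs X" "clinear X Y f \<Longrightarrow> cvs Y"
  and clinear_closed: "clinear X Y f \<Longrightarrow> x \<in> carrier X \<Longrightarrow> f x \<in> carrier Y"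
  and clinear_add: "clinear X Y f \<Longrightarrow> x \<in> carrier X \<Longrightarrow> y \<in> carrier X \<Longrightarrow>
      f (x \<oplus>\<^bsub>X\<^esub> y) = f x \<oplus>\<^bsub>Y\<^esub> f y"
  and clinear_smult: "clinear X Y f \<Longrightarrow> x \<in> carrier X \<Longrightarrow> f (c \<odot>\<^bsub>X\<^esub> x) = c \<odot>\<^bsub>Y\<^esub> f x"
  by (auto simp: clinear_iff)

lemma clinear_zero: "clinear X Y f \<Longrightarrow> f \<zero>\<^bsub>X\<^esub> = \<zero>\<^bsub>Y\<^esub>"
  by (rule linear_map.T0_is_0)

lemma clinear_minus: "clinear X Y f \<Longrightarrow> x \<in> carrier X \<Longrightarrow> y \<in> carrier X \<Longrightarrow>
    f (x \<ominus>\<^bsub>X\<^esub> y) = f x \<ominus>\<^bsub>Y\<^esub> f y"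
  by (rule linear_map.T_minus)

text \<open>Linearity is applied summand by summand; over an infinite index set both sums are zero
  by the convention for \<open>finsum\<close>.\<close>

lemma clinear_finsum:
  assumes "clinear X Y f" "\<And>i. i \<in> A \<Longrightarrow> g i \<in> carrier X"
  shows "f (finsum X g A) = finsum Y (\<lambda>i. f (g i)) A"
proof -
  interpret X: abelian_group X using assms by (intro cvs_abelian_group clinear_cvs)
  interpret Y: abelian_group Y using assms by (intro cvs_abelian_group clinear_cvs)
  show ?thesis
    using assms(2)
  proof (induction A rule: infinite_finite_induct)
    case (insert i A)
    then have "finsum X g (insert i A) = g i \<oplus>\<^bsub>X\<^esub> finsum X g A"
      by (intro X.finsum_insert) auto
    moreover have "finsum Y (\<lambda>i. f (g i)) (insert i A) = f (g i) \<oplus>\<^bsub>Y\<^esub> finsum Y (\<lambda>i. f (g i)) A"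
      using insert assms(1) by (intro Y.finsum_insert) (auto simp: clinear_closed)
    moreover have "finsum X g A \<in> carrier X"
      using insert.prems by (intro X.finsum_closed) auto
    ultimately show ?case
      using insert assms(1) by (simp add: clinear_add)
  qed (simp_all add: clinear_zero[OF assms(1)])
qed

lemma clinear_comp: "clinear X Y f \<Longrightarrow> clinear Y Z g \<Longrightarrow> clinear X Z (\<lambda>x. g (f x))"
  by (auto simp: clinear_iff)

lemma clinear_cong: "(\<And>x. x \<in> carrier X \<Longrightarrow> f x = g x) \<Longrightarrow> clinear X Y f = clinear X Y g"
  using cvs_add[of X] cvs_smult[of X] by (auto simp: clinear_iff)

section \<open>Matrices over a complex vector space\<close>

abbreviation Mats :: "nat \<Rightarrow> (complex, 'u, 'x) module_scheme \<Rightarrow> 'u mat set" where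
  "Mats n X \<equiv> carrier (mat_space n X)"

lemma Mats_iff:
  "x \<in> Mats n X \<longleftrightarrow> dim_row x = n \<and> dim_col x = n \<and> (\<forall>i<n. \<forall>j<n. x $$ (i, j) \<in> carrier X)"
  by (auto simp: mat_space_def dest!: elements_matD intro!: elements_matI
      intro: subsetD[OF _ elements_matI[of x n n]])

lemma MatsI: "(\<And>i j. i < n \<Longrightarrow> j < n \<Longrightarrow> f (i, j) \<in> carrier X) \<Longrightarrow> mat n n f \<in> Mats n X"
  by (simp add: Mats_iff)

lemma mat_space_zero: "\<zero>\<^bsub>mat_space n X\<^esub> = mat n n (\<lambda>_. \<zero>\<^bsub>X\<^esub>)"
  and mat_space_add: "x \<oplus>\<^bsub>mat_space n X\<^esub> y = mat n n (\<lambda>ij. x $$ ij \<oplus>\<^bsub>X\<^esub> y $$ ij)"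
  and mat_space_smult: "c \<odot>\<^bsub>mat_space n X\<^esub> x = map_mat (\<lambda>a. c \<odot>\<^bsub>X\<^esub> a) x"
  by (simp_all add: mat_space_def)

lemma cvs_mat_space:
  assumes "cvs X" shows "cvs (mat_space n X)"
  using assms
  by (intro cvsI; (simp add: Mats_iff mat_space_zero mat_space_add mat_space_smult mat_eq_iff cvs_closed
      cvs_assoc cvs_l_zero cvs_smult_add cvs_add_smult cvs_smult_smult cvs_one cvs_smult_0))
    (auto intro: cvs_comm)

lemma mat_space_minus:
  assumes "cvs X" "x \<in> Mats n X" "y \<in> Mats n X"
  shows "x \<ominus>\<^bsub>mat_space n X\<^esub> y = mat n n (\<lambda>ij. x $$ ij \<ominus>\<^bsub>X\<^esub> y $$ ij)"
  using assms
  by (auto simp: cvs_minus_eq cvs_mat_space mat_space_add mat_space_smult Mats_iff mat_eq_iff)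

lemma Mats_map: "clinear X Y f \<Longrightarrow> x \<in> Mats n X \<Longrightarrow> map_mat f x \<in> Mats n Y"
  by (auto simp: Mats_iff clinear_closed)

lemma clinear_map_mat:
  assumes "clinear X Y f" shows "clinear (mat_space n X) (mat_space n Y) (map_mat f)"
proof -
  have "cvs (mat_space n X)" "cvs (mat_space n Y)"
    using assms by (auto intro: cvs_mat_space dest: clinear_cvs)
  then show ?thesis
    using assms unfolding clinear_iff[of "mat_space n X"]
    by (auto simp: Mats_iff mat_space_add mat_space_smult mat_eq_iff clinear_closed clinear_add clinear_smult)
qed

lemma Mats_direct_sum:
  "cvs X \<Longrightarrow> x \<in> Mats m X \<Longrightarrow> y \<in> Mats n X \<Longrightarrow> direct_sum_mat X m n x y \<in> Mats (m + n) X"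
  by (auto simp: Mats_iff direct_sum_mat_def cvs_zero)

lemma map_direct_sum:
  assumes "clinear X Y f" "x \<in> Mats m X" "y \<in> Mats n X"
  shows "map_mat f (direct_sum_mat X m n x y) = direct_sum_mat Y m n (map_mat f x) (map_mat f y)"
  using assms by (auto simp: direct_sum_mat_def Mats_iff mat_eq_iff clinear_zero)

lemma Mats_scalar_mult:
  assumes "cvs X" "x \<in> Mats m X"
  shows "scalar_mult_mat X m a x b \<in> Mats m X"
proof -
  interpret X: abelian_group X using assms by (intro cvs_abelian_group)
  show ?thesis
    unfolding scalar_mult_mat_def using assms
    by (intro MatsI) (auto intro!: X.finsum_closed cvs_smult simp: Mats_iff)
qed

text \<open>Every entry of the product is a double sum of scalar multiples of entries of
  \<open>x\<close>, so \<open>clinear_finsum\<close> is used for the outer and then for the inner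
  sum.\<close>

lemma map_scalar_mult:
  assumes f: "clinear X Y f" and x: "x \<in> Mats m X"
  shows "map_mat f (scalar_mult_mat X m a x b) = scalar_mult_mat Y m a (map_mat f x) b"
proof -
  interpret X: abelian_group X using f by (intro cvs_abelian_group clinear_cvs)
  interpret Y: abelian_group Y using f by (intro cvs_abelian_group clinear_cvs)
  have xc: "c \<odot>\<^bsub>X\<^esub> x $$ (k, l) \<in> carrier X" if "k < m" "l < m" for c k l
    using that x clinear_cvs(1)[OF f] by (auto simp: Mats_iff intro!: cvs_smult)
  show ?thesis
    unfolding scalar_mult_mat_def
  proof (intro eq_matI)
    fix i j
    let ?c = "\<lambda>k l. a $$ (i, k) * b $$ (l, j)"
    assume "i < dim_row (mat m m (\<lambda>(i, j). \<Oplus>\<^bsub>Y\<^esub>k\<in>{..<m}. \<Oplus>\<^bsub>Y\<^esub>l\<in>{..<m}.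
        (a $$ (i, k) * b $$ (l, j)) \<odot>\<^bsub>Y\<^esub> map_mat f x $$ (k, l)))"
      "j < dim_col (mat m m (\<lambda>(i, j). \<Oplus>\<^bsub>Y\<^esub>k\<in>{..<m}. \<Oplus>\<^bsub>Y\<^esub>l\<in>{..<m}.
        (a $$ (i, k) * b $$ (l, j)) \<odot>\<^bsub>Y\<^esub> map_mat f x $$ (k, l)))"
    then have ij: "i < m" "j < m" by auto
    have "f (\<Oplus>\<^bsub>X\<^esub>k\<in>{..<m}. \<Oplus>\<^bsub>X\<^esub>l\<in>{..<m}. ?c k l \<odot>\<^bsub>X\<^esub> x $$ (k, l)) =
      (\<Oplus>\<^bsub>Y\<^esub>k\<in>{..<m}. f (\<Oplus>\<^bsub>X\<^esub>l\<in>{..<m}. ?c k l \<odot>\<^bsub>X\<^esub> x $$ (k, l)))"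
      using xc by (intro clinear_finsum[OF f] X.finsum_closed) auto
    also have "\<dots> = (\<Oplus>\<^bsub>Y\<^esub>k\<in>{..<m}. \<Oplus>\<^bsub>Y\<^esub>l\<in>{..<m}. ?c k l \<odot>\<^bsub>Y\<^esub> map_mat f x $$ (k, l))"
    proof (intro Y.finsum_cong' refl Pi_I)
      fix k assume k: "k \<in> {..<m}"
      have fx: "f (x $$ (k, l)) \<in> carrier Y" if "l < m" for l
        using k that x f by (auto simp: Mats_iff clinear_closed[OF f])
      then have fc: "c \<odot>\<^bsub>Y\<^esub> f (x $$ (k, l)) \<in> carrier Y" if "l < m" for l c
        using that f by (auto intro!: cvs_smult clinear_cvs)
      have dx: "dim_row x = m" "dim_col x = m" using x by (auto simp: Mats_iff)
      show "(\<Oplus>\<^bsub>Y\<^esub>l\<in>{..<m}. ?c k l \<odot>\<^bsub>Y\<^esub> map_mat f x $$ (k, l)) \<in> carrier Y"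
        using k fc dx by (intro Y.finsum_closed) auto
      have "f (\<Oplus>\<^bsub>X\<^esub>l\<in>{..<m}. ?c k l \<odot>\<^bsub>X\<^esub> x $$ (k, l)) =
        (\<Oplus>\<^bsub>Y\<^esub>l\<in>{..<m}. f (?c k l \<odot>\<^bsub>X\<^esub> x $$ (k, l)))"
        using xc k by (intro clinear_finsum[OF f]) auto
      also have "\<dots> = (\<Oplus>\<^bsub>Y\<^esub>l\<in>{..<m}. ?c k l \<odot>\<^bsub>Y\<^esub> map_mat f x $$ (k, l))"
        using k fc dx x by (intro Y.finsum_cong' refl) (auto simp: clinear_smult[OF f] Mats_iff)
      finally show "f (\<Oplus>\<^bsub>X\<^esub>l\<in>{..<m}. ?c k l \<odot>\<^bsub>X\<^esub> x $$ (k, l)) =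
        (\<Oplus>\<^bsub>Y\<^esub>l\<in>{..<m}. ?c k l \<odot>\<^bsub>Y\<^esub> map_mat f x $$ (k, l))" .
    qed
    finally show "map_mat f (mat m m (\<lambda>(i, j). \<Oplus>\<^bsub>X\<^esub>k\<in>{..<m}. \<Oplus>\<^bsub>X\<^esub>l\<in>{..<m}.
        (a $$ (i, k) * b $$ (l, j)) \<odot>\<^bsub>X\<^esub> x $$ (k, l))) $$ (i, j) =
      mat m m (\<lambda>(i, j). \<Oplus>\<^bsub>Y\<^esub>k\<in>{..<m}. \<Oplus>\<^bsub>Y\<^esub>l\<in>{..<m}.
        (a $$ (i, k) * b $$ (l, j)) \<odot>\<^bsub>Y\<^esub> map_mat f x $$ (k, l)) $$ (i, j)"
      using ij by simp
  qed auto
qed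


section \<open>Operator spaces\<close>

definition nrm :: "'u opspace \<Rightarrow> 'u \<Rightarrow> real" where
  "nrm X a = mnorm X 1 (mat 1 1 (\<lambda>_. a))"

lemma os_cvs: "operator_space X \<Longrightarrow> cvs X"
  by (simp add: operator_space_def)

context
  fixes X :: "'u opspace" and n :: nat
  assumes X: "operator_space X" and n: "1 \<le> n"
begin

lemma os_is_norm: "is_norm (mat_space n X) (mnorm X n)"
  using X n by (simp add: operator_space_def)

lemma os_nonneg: "x \<in> Mats n X \<Longrightarrow> 0 \<le> mnorm X n x"
  and os_zero_iff: "x \<in> Mats n X \<Longrightarrow> mnorm X n x = 0 \<longleftrightarrow> x = \<zero>\<^bsub>mat_space n X\<^esub>"
  and os_smult: "x \<in> Mats n X \<Longrightarrow> mnorm X n (c \<odot>\<^bsub>mat_space n X\<^esub> x) = cmod c * mnorm X n x"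
  and os_triangle: "x \<in> Mats n X \<Longrightarrow> y \<in> Mats n X \<Longrightarrow>
    mnorm X n (x \<oplus>\<^bsub>mat_space n X\<^esub> y) \<le> mnorm X n x + mnorm X n y"
  using os_is_norm by (simp_all add: is_norm_def)

lemma os_zero: "mnorm X n \<zero>\<^bsub>mat_space n X\<^esub> = 0"
  using os_zero_iff[of "\<zero>\<^bsub>mat_space n X\<^esub>"] X by (simp add: os_cvs cvs_mat_space cvs_zero)

lemma os_scalar_mult: "x \<in> Mats n X \<Longrightarrow> a \<in> carrier_mat n n \<Longrightarrow> b \<in> carrier_mat n n \<Longrightarrow>
    mnorm X n (scalar_mult_mat X n a x b) \<le> mat_op_norm a * mnorm X n x * mat_op_norm b"
  using X n by (simp add: operator_space_def)

lemma os_direct_sum: "1 \<le> m \<Longrightarrow> x \<in> Mats n X \<Longrightarrow> y \<in> Mats m X \<Longrightarrow>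
    mnorm X (n + m) (direct_sum_mat X n m x y) = max (mnorm X n x) (mnorm X m y)"
  using X n by (simp add: operator_space_def)

end

lemma Mats1_iff: "x \<in> Mats 1 X \<longleftrightarrow> (\<exists>a\<in>carrier X. x = mat 1 1 (\<lambda>_. a))"
proof
  assume "x \<in> Mats 1 X"
  then show "\<exists>a\<in>carrier X. x = mat 1 1 (\<lambda>_. a)"
    by (intro bexI[of _ "x $$ (0, 0)"]) (auto simp: Mats_iff mat_eq_iff)
qed (auto simp: Mats_iff)

lemma single_smult: "c \<odot>\<^bsub>mat_space 1 X\<^esub> mat 1 1 (\<lambda>_. a) = mat 1 1 (\<lambda>_. c \<odot>\<^bsub>X\<^esub> a)"
  and single_add: "mat 1 1 (\<lambda>_. a) \<oplus>\<^bsub>mat_space 1 X\<^esub> mat 1 1 (\<lambda>_. b) = mat 1 1 (\<lambda>_. a \<oplus>\<^bsub>X\<^esub> b)"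
  and single_map: "map_mat f (mat 1 1 (\<lambda>_. a)) = mat 1 1 (\<lambda>_. f a)"
  by (auto simp: mat_space_smult mat_space_add mat_eq_iff)

lemma single_minus: "cvs X \<Longrightarrow> a \<in> carrier X \<Longrightarrow> b \<in> carrier X \<Longrightarrow>
    mat 1 1 (\<lambda>_. a) \<ominus>\<^bsub>mat_space 1 X\<^esub> mat 1 1 (\<lambda>_. b) = mat 1 1 (\<lambda>_. a \<ominus>\<^bsub>X\<^esub> b)"
  by (subst mat_space_minus) (auto simp: Mats_iff mat_eq_iff)

context
  fixes X :: "'u opspace"
  assumes X: "operator_space X"
begin

lemma nrm_nonneg: "a \<in> carrier X \<Longrightarrow> 0 \<le> nrm X a"
  unfolding nrm_def by (intro os_nonneg X) (auto simp: Mats_iff)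

lemma nrm_zero_iff: "a \<in> carrier X \<Longrightarrow> nrm X a = 0 \<longleftrightarrow> a = \<zero>\<^bsub>X\<^esub>"
  unfolding nrm_def using os_zero_iff[OF X order_refl, of "mat 1 1 (\<lambda>_. a)"]
  by (auto simp: Mats_iff mat_space_zero mat_eq_iff)

lemma nrm_zero: "nrm X \<zero>\<^bsub>X\<^esub> = 0"
  using nrm_zero_iff[of "\<zero>\<^bsub>X\<^esub>"] X by (simp add: os_cvs cvs_zero)

lemma nrm_smult: "a \<in> carrier X \<Longrightarrow> nrm X (c \<odot>\<^bsub>X\<^esub> a) = cmod c * nrm X a"
  unfolding nrm_def using os_smult[OF X order_refl, of "mat 1 1 (\<lambda>_. a)" c]
  by (simp add: Mats_iff single_smult del: One_nat_def)

lemma nrm_add: "a \<in> carrier X \<Longrightarrow> b \<in> carrier X \<Longrightarrow> nrm X (a \<oplus>\<^bsub>X\<^esub> b) \<le> nrm X a + nrm X b"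
  unfolding nrm_def using os_triangle[OF X order_refl, of "mat 1 1 (\<lambda>_. a)" "mat 1 1 (\<lambda>_. b)"]
  by (simp add: Mats_iff single_add del: One_nat_def)

lemma nrm_minus_commute: "a \<in> carrier X \<Longrightarrow> b \<in> carrier X \<Longrightarrow> nrm X (a \<ominus>\<^bsub>X\<^esub> b) = nrm X (b \<ominus>\<^bsub>X\<^esub> a)"
  using X by (simp add: cvs_minus_swap[of X b a] nrm_smult os_cvs cvs_minus)

lemma nrm_minus_triangle:
  assumes "a \<in> carrier X" "b \<in> carrier X" "c \<in> carrier X"
  shows "nrm X (a \<ominus>\<^bsub>X\<^esub> c) \<le> nrm X (a \<ominus>\<^bsub>X\<^esub> b) + nrm X (b \<ominus>\<^bsub>X\<^esub> c)"
  using nrm_add[of "a \<ominus>\<^bsub>X\<^esub> b" "b \<ominus>\<^bsub>X\<^esub> c"] assms X by (simp add: cvs_minus_add_minus os_cvs cvs_minus)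

lemma nrm_le_minus: "a \<in> carrier X \<Longrightarrow> b \<in> carrier X \<Longrightarrow> nrm X a \<le> nrm X (a \<ominus>\<^bsub>X\<^esub> b) + nrm X b"
  using nrm_minus_triangle[of a b "\<zero>\<^bsub>X\<^esub>"] X
  by (simp add: os_cvs cvs_zero cvs_minus_eq cvs_smult_zero cvs_r_zero)

lemma os_complete:
  assumes \<sigma>: "range \<sigma> \<subseteq> carrier X"
    and cauchy: "\<And>\<epsilon>. \<epsilon> > 0 \<Longrightarrow> \<exists>K. \<forall>p\<ge>K. \<forall>q\<ge>K. nrm X (\<sigma> p \<ominus>\<^bsub>X\<^esub> \<sigma> q) < \<epsilon>"
  obtains x where "x \<in> carrier X" "(\<lambda>p. nrm X (\<sigma> p \<ominus>\<^bsub>X\<^esub> x)) \<longlonglongrightarrow> 0"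
proof -
  let ?\<tau> = "\<lambda>p. mat 1 1 (\<lambda>_. \<sigma> p)"
  have "\<exists>y\<in>Mats 1 X. (\<lambda>p. mnorm X 1 (?\<tau> p \<ominus>\<^bsub>mat_space 1 X\<^esub> y)) \<longlonglongrightarrow> 0"
  proof -
    have "is_banach (mat_space 1 X) (mnorm X 1)" using X by (simp add: operator_space_def)
    moreover have "range ?\<tau> \<subseteq> Mats 1 X" using \<sigma> by (auto simp: Mats_iff)
    moreover have "\<forall>\<epsilon>>0. \<exists>K. \<forall>p\<ge>K. \<forall>q\<ge>K. mnorm X 1 (?\<tau> p \<ominus>\<^bsub>mat_space 1 X\<^esub> ?\<tau> q) < \<epsilon>"
      using cauchy \<sigma> os_cvs[OF X] by (simp add: single_minus nrm_def subset_eq del: One_nat_def)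
    ultimately show ?thesis unfolding is_banach_def by blast
  qed
  then obtain a where "a \<in> carrier X" "(\<lambda>p. mnorm X 1 (?\<tau> p \<ominus>\<^bsub>mat_space 1 X\<^esub> mat 1 1 (\<lambda>_. a))) \<longlonglongrightarrow> 0"
    by (auto simp: Mats1_iff simp del: One_nat_def)
  with that[of a] \<sigma> os_cvs[OF X] show thesis
    by (simp add: single_minus nrm_def subset_eq del: One_nat_def)
qed

end

text \<open>Three axioms are reduced to what is convenient to check. Homogeneity is only an
  inequality (applying it to \<open>inverse c\<close> gives the converse), a vanishing norm has to
  force zero in one direction only, and completeness is stated on \<open>X\<close> instead of its 1
  by 1 matrices.\<close>

lemma operator_spaceI:
  fixes X :: "'u opspace"
  assumes X: "cvs X"
    and nonneg: "\<And>n x. 1 \<le> n \<Longrightarrow> x \<in> Mats n X \<Longrightarrow> 0 \<le> mnorm X n x"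
    and zero: "\<And>n x. 1 \<le> n \<Longrightarrow> x \<in> Mats n X \<Longrightarrow> mnorm X n x = 0 \<Longrightarrow> x = \<zero>\<^bsub>mat_space n X\<^esub>"
    and smult: "\<And>n x c. 1 \<le> n \<Longrightarrow> x \<in> Mats n X \<Longrightarrow> mnorm X n (c \<odot>\<^bsub>mat_space n X\<^esub> x) \<le> cmod c * mnorm X n x"
    and tri: "\<And>n x y. 1 \<le> n \<Longrightarrow> x \<in> Mats n X \<Longrightarrow> y \<in> Mats n X \<Longrightarrow>
      mnorm X n (x \<oplus>\<^bsub>mat_space n X\<^esub> y) \<le> mnorm X n x + mnorm X n y"
    and dsum: "\<And>m n x y. 1 \<le> m \<Longrightarrow> 1 \<le> n \<Longrightarrow> x \<in> Mats m X \<Longrightarrow> y \<in> Mats n X \<Longrightarrow>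
      mnorm X (m + n) (direct_sum_mat X m n x y) = max (mnorm X m x) (mnorm X n y)"
    and mult: "\<And>n x a b. 1 \<le> n \<Longrightarrow> x \<in> Mats n X \<Longrightarrow> a \<in> carrier_mat n n \<Longrightarrow> b \<in> carrier_mat n n \<Longrightarrow>
      mnorm X n (scalar_mult_mat X n a x b) \<le> mat_op_norm a * mnorm X n x * mat_op_norm b"
    and complete: "\<And>\<sigma>. range \<sigma> \<subseteq> carrier X \<Longrightarrow>
      (\<And>\<epsilon>. \<epsilon> > 0 \<Longrightarrow> \<exists>K. \<forall>p\<ge>K. \<forall>q\<ge>K. nrm X (\<sigma> p \<ominus>\<^bsub>X\<^esub> \<sigma> q) < \<epsilon>) \<Longrightarrow>
      \<exists>x\<in>carrier X. (\<lambda>p. nrm X (\<sigma> p \<ominus>\<^bsub>X\<^esub> x)) \<longlonglongrightarrow> 0"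
  shows "operator_space X"
proof -
  have norm: "is_norm (mat_space n X) (mnorm X n)" if n: "1 \<le> n" for n
  proof -
    let ?M = "mat_space n X"
    have M: "cvs ?M" using X by (rule cvs_mat_space)
    \<comment> \<open>The scalar 0 in the homogeneity bound shows that the zero matrix has norm at
      most 0.\<close>
    have "mnorm X n (0 \<odot>\<^bsub>?M\<^esub> \<zero>\<^bsub>?M\<^esub>) \<le> cmod 0 * mnorm X n \<zero>\<^bsub>?M\<^esub>"
      using n M by (intro smult) (auto simp: cvs_zero)
    then have zero0: "mnorm X n \<zero>\<^bsub>?M\<^esub> = 0"
      using nonneg[OF n, of "\<zero>\<^bsub>?M\<^esub>"] M by (auto simp: cvs_smult_zero cvs_zero)
    have "mnorm X n (c \<odot>\<^bsub>?M\<^esub> x) = cmod c * mnorm X n x" if x: "x \<in> Mats n X" for c x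
    proof (cases "c = 0")
      case True
      then show ?thesis using M x zero0 by (simp add: cvs_smult_0)
    next
      case False
      have "mnorm X n (inverse c \<odot>\<^bsub>?M\<^esub> (c \<odot>\<^bsub>?M\<^esub> x)) \<le> cmod (inverse c) * mnorm X n (c \<odot>\<^bsub>?M\<^esub> x)"
        using M x n by (intro smult cvs_smult)
      moreover have "inverse c \<odot>\<^bsub>?M\<^esub> (c \<odot>\<^bsub>?M\<^esub> x) = x"
        using cvs_smult_smult[OF M x, of "inverse c" c] cvs_one[OF M x] False by simp
      ultimately have "cmod c * mnorm X n x \<le> mnorm X n (c \<odot>\<^bsub>?M\<^esub> x)"
        using False by (simp add: norm_divide field_simps)
      with smult[OF n x] show ?thesis by (intro antisym)
    qed
    then show ?thesis
      unfolding is_norm_def using nonneg[OF n] zero[OF n] tri[OF n] zero0 by blast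
  qed
  have diff: "x \<ominus>\<^bsub>mat_space 1 X\<^esub> y = mat 1 1 (\<lambda>_. x $$ (0, 0) \<ominus>\<^bsub>X\<^esub> y $$ (0, 0))"
    if "x \<in> Mats 1 X" "y \<in> Mats 1 X" for x y
    using that by (subst mat_space_minus[OF X]) (auto simp: Mats_iff mat_eq_iff)
  have "\<exists>y\<in>Mats 1 X. (\<lambda>p. mnorm X 1 (\<sigma> p \<ominus>\<^bsub>mat_space 1 X\<^esub> y)) \<longlonglongrightarrow> 0"
    if \<sigma>: "range \<sigma> \<subseteq> Mats 1 X"
      and c: "\<forall>\<epsilon>>0. \<exists>K. \<forall>p\<ge>K. \<forall>q\<ge>K. mnorm X 1 (\<sigma> p \<ominus>\<^bsub>mat_space 1 X\<^esub> \<sigma> q) < \<epsilon>" for \<sigma>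
  proof -
    let ?\<tau> = "\<lambda>p. \<sigma> p $$ (0, 0)"
    have \<tau>: "range ?\<tau> \<subseteq> carrier X" using \<sigma> by (auto simp: Mats_iff subset_eq)
    moreover have "\<exists>K. \<forall>p\<ge>K. \<forall>q\<ge>K. nrm X (?\<tau> p \<ominus>\<^bsub>X\<^esub> ?\<tau> q) < \<epsilon>" if "\<epsilon> > 0" for \<epsilon>
      using c that \<sigma> by (simp add: diff nrm_def subset_eq del: One_nat_def)
    ultimately obtain x where x: "x \<in> carrier X" "(\<lambda>p. nrm X (?\<tau> p \<ominus>\<^bsub>X\<^esub> x)) \<longlonglongrightarrow> 0"
      using complete by blast
    show ?thesis
    proof
      show xm: "mat 1 1 (\<lambda>_. x) \<in> Mats 1 X" using x by (simp add: Mats_iff)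
      have "mnorm X 1 (\<sigma> p \<ominus>\<^bsub>mat_space 1 X\<^esub> mat 1 1 (\<lambda>_. x)) = nrm X (?\<tau> p \<ominus>\<^bsub>X\<^esub> x)" for p
        using \<sigma> xm by (subst diff) (auto simp: nrm_def simp del: One_nat_def)
      then show "(\<lambda>p. mnorm X 1 (\<sigma> p \<ominus>\<^bsub>mat_space 1 X\<^esub> mat 1 1 (\<lambda>_. x))) \<longlonglongrightarrow> 0"
        using x by simp
    qed
  qed
  then have "is_banach (mat_space 1 X) (mnorm X 1)"
    unfolding is_banach_def using norm[of 1] cvs_mat_space[OF X] by blast
  then show ?thesis
    unfolding operator_space_def using X norm dsum mult by blast
qed

lemma cc_D: "complete_contraction X Y u \<Longrightarrow> 1 \<le> n \<Longrightarrow> x \<in> Mats n X \<Longrightarrow>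
    mnorm Y n (map_mat u x) \<le> mnorm X n x"
  by (simp add: complete_contraction_def)

lemma cc_nrm: "complete_contraction X Y u \<Longrightarrow> a \<in> carrier X \<Longrightarrow> nrm Y (u a) \<le> nrm X a"
  using cc_D[of X Y u 1 "mat 1 1 (\<lambda>_. a)"]
  by (simp add: nrm_def Mats_iff single_map del: One_nat_def)
lemma cc_comp:
  assumes "complete_contraction X Y u" "complete_contraction Y Z v" "clinear X Y u"
  shows "complete_contraction X Z (\<lambda>x. v (u x))"
  unfolding complete_contraction_def
proof safe
  fix n :: nat and x assume n: "1 \<le> n" and x: "x \<in> Mats n X"
  have "map_mat (\<lambda>x. v (u x)) x = map_mat v (map_mat u x)" by auto
  then show "mnorm Z n (map_mat (\<lambda>x. v (u x)) x) \<le> mnorm X n x"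
    using cc_D[OF assms(1) n x] cc_D[OF assms(2) n Mats_map[OF assms(3) x]] by simp
qed

lemma cc_cong:
  assumes "\<And>x. x \<in> carrier X \<Longrightarrow> u x = v x"
  shows "complete_contraction X Y u = complete_contraction X Y v"
proof -
  have "map_mat u x = map_mat v x" if "x \<in> Mats n X" for n x
    using that assms by (auto simp: Mats_iff mat_eq_iff)
  then show ?thesis by (simp add: complete_contraction_def)
qed

section \<open>Scalar matrix units and the comparison of matrix norms with norms of entries\<close>

lemma mat_op_norm_bdd:
  "bdd_above ((\<lambda>v. vec_norm (a *\<^sub>v v)) ` {v \<in> carrier_vec (dim_col a). vec_norm v \<le> 1})"
proof (rule bdd_aboveI2)
  fix v :: "complex vec"
  assume "v \<in> {v \<in> carrier_vec (dim_col a). vec_norm v \<le> 1}"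
  then have v: "dim_vec v = dim_col a" "vec_norm v \<le> 1" by auto
  have vj: "cmod (v $ j) \<le> 1" if "j < dim_vec v" for j
    using member_le_L2_set[of "{..<dim_vec v}" j "\<lambda>i. cmod (v $ i)"] that v by (simp add: vec_norm_def)
  \<comment> \<open>A crude finite bound is enough to make the supremum meaningful: the 2-norm is at
    most the sum of the moduli, and every coordinate of \<open>v\<close> has modulus at most
    1.\<close>
  have "vec_norm (a *\<^sub>v v) \<le> (\<Sum>i<dim_row a. cmod ((a *\<^sub>v v) $ i))"
    unfolding vec_norm_def dim_mult_mat_vec by (rule L2_set_le_sum) simp
  also have "\<dots> \<le> (\<Sum>i<dim_row a. \<Sum>j<dim_col a. cmod (a $$ (i, j)))"
  proof (intro sum_mono)
    fix i assume "i \<in> {..<dim_row a}"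
    then have "cmod ((a *\<^sub>v v) $ i) = cmod (\<Sum>j<dim_col a. a $$ (i, j) * v $ j)"
      using v by (simp add: scalar_prod_def lessThan_atLeast0)
    also have "\<dots> \<le> (\<Sum>j<dim_col a. cmod (a $$ (i, j)))"
      using vj v by (intro sum_norm_le) (auto simp: norm_mult intro!: mult_left_le)
    finally show "cmod ((a *\<^sub>v v) $ i) \<le> (\<Sum>j<dim_col a. cmod (a $$ (i, j)))" .
  qed
  finally show "vec_norm (a *\<^sub>v v) \<le> (\<Sum>i<dim_row a. \<Sum>j<dim_col a. cmod (a $$ (i, j)))" .
qed

lemma mat_op_norm_nonneg: "0 \<le> mat_op_norm a"
proof -
  have "vec_norm (a *\<^sub>v 0\<^sub>v (dim_col a)) \<le> mat_op_norm a"
    unfolding mat_op_norm_def by (rule cSUP_upper[OF _ mat_op_norm_bdd]) (simp add: vec_norm_def L2_set_def)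
  moreover have "0 \<le> vec_norm (a *\<^sub>v 0\<^sub>v (dim_col a))" by (simp add: vec_norm_def L2_set_nonneg)
  ultimately show ?thesis by linarith
qed

definition unit_mat :: "nat \<Rightarrow> 'a \<Rightarrow> nat \<times> nat \<Rightarrow> 'a \<Rightarrow> 'a mat" where
  "unit_mat m z ij a = mat m m (\<lambda>kl. if kl = ij then a else z)"

text \<open>The matrix unit sends \<open>v\<close> to a vector whose only possibly nonzero
  coordinate is \<open>v $ j\<close> in place \<open>i\<close>. Indices outside the matrix give the
  zero matrix, so the norm may be 0.\<close>

lemma mat_op_norm_unit_le: "mat_op_norm (unit_mat m 0 (i, j) 1) \<le> 1"
proof -
  let ?e = "unit_mat m 0 (i, j) 1 :: complex mat"
  have dim_e: "dim_row ?e = m" by (simp add: unit_mat_def)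
  have "vec_norm (?e *\<^sub>v v) \<le> 1" if v: "v \<in> carrier_vec m" "vec_norm v \<le> 1" for v
  proof -
    have e: "(?e *\<^sub>v v) $ k = (if k = i \<and> j < m then v $ j else 0)" if "k < m" for k
    proof -
      have "(?e *\<^sub>v v) $ k = (\<Sum>l<m. if l = j then (if k = i then v $ l else 0) else 0)"
        using that v
        by (simp add: unit_mat_def scalar_prod_def lessThan_atLeast0 if_distrib[where f = "\<lambda>c. c * _"] cong: if_cong)
      then show ?thesis by simp
    qed
    have "vec_norm (?e *\<^sub>v v) \<le> (\<Sum>k<m. cmod ((?e *\<^sub>v v) $ k))"
      unfolding vec_norm_def dim_mult_mat_vec dim_e by (rule L2_set_le_sum) simp
    also have "\<dots> = (\<Sum>k<m. if k = i then (if j < m then cmod (v $ j) else 0) else 0)"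
      by (intro sum.cong) (auto simp: e)
    also have "\<dots> \<le> (if j < m then cmod (v $ j) else 0)" by simp
    also have "\<dots> \<le> 1"
      using member_le_L2_set[of "{..<dim_vec v}" j "\<lambda>i. cmod (v $ i)"] v by (auto simp: vec_norm_def)
    finally show ?thesis .
  qed
  moreover have "{v \<in> carrier_vec m. vec_norm v \<le> 1} \<noteq> {}"
    by (intro ex_in_conv[THEN iffD1] exI[of _ "0\<^sub>v m"]) (simp add: vec_norm_def L2_set_def)
  ultimately show ?thesis
    unfolding mat_op_norm_def by (intro cSUP_least) (auto simp: unit_mat_def)
qed

text \<open>The matrix units pick the entry at \<open>(k, l)\<close> and move it to
  \<open>(i, j)\<close>: all other summands of the double sum vanish.\<close>

lemma scalar_mult_unit:
  assumes X: "cvs X" and x: "x \<in> Mats m X" and kl: "k < m" "l < m"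
  shows "scalar_mult_mat X m (unit_mat m 0 (i, k) 1) x (unit_mat m 0 (l, j) 1) =
    unit_mat m \<zero>\<^bsub>X\<^esub> (i, j) (x $$ (k, l))"
proof -
  interpret X: abelian_group X using X by (rule cvs_abelian_group)
  have xc: "x $$ (k', l') \<in> carrier X" if "k' < m" "l' < m" for k' l'
    using that x by (simp add: Mats_iff)
  have "(\<Oplus>\<^bsub>X\<^esub>k'\<in>{..<m}. \<Oplus>\<^bsub>X\<^esub>l'\<in>{..<m}.
      ((unit_mat m 0 (i, k) 1 $$ (i', k') * unit_mat m 0 (l, j) 1 $$ (l', j')) :: complex) \<odot>\<^bsub>X\<^esub> x $$ (k', l')) =
    (if (i', j') = (i, j) then x $$ (k, l) else \<zero>\<^bsub>X\<^esub>)" (is "?L = ?R") if ij: "i' < m" "j' < m" for i' j'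
  proof -
    have "?L = (\<Oplus>\<^bsub>X\<^esub>k'\<in>{..<m}. \<Oplus>\<^bsub>X\<^esub>l'\<in>{..<m}.
        if l = l' then (if k = k' \<and> (i', j') = (i, j) then x $$ (k', l') else \<zero>\<^bsub>X\<^esub>) else \<zero>\<^bsub>X\<^esub>)"
      using ij xc X
      by (intro X.finsum_cong' refl Pi_I X.finsum_closed) (auto simp: unit_mat_def cvs_one cvs_smult_0)
    also have "\<dots> = (\<Oplus>\<^bsub>X\<^esub>k'\<in>{..<m}.
        if k = k' then (if (i', j') = (i, j) then x $$ (k', l) else \<zero>\<^bsub>X\<^esub>) else \<zero>\<^bsub>X\<^esub>)"
      using kl xc
      by (intro X.finsum_cong' refl Pi_I) (auto simp: X.finsum_singleton)
    also have "\<dots> = ?R"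
      using kl xc by (subst X.finsum_singleton) auto
    finally show ?thesis .
  qed
  then show ?thesis
    unfolding scalar_mult_mat_def by (intro eq_matI) (auto simp: unit_mat_def)
qed

text \<open>Both matrix units have operator norm at most 1, so multiplying by them cannot increase
  the norm.\<close>

lemma os_scalar_mult_unit_le:
  assumes X: "operator_space X" and m: "1 \<le> m" and x: "x \<in> Mats m X" and kl: "k < m" "l < m"
  shows "mnorm X m (unit_mat m \<zero>\<^bsub>X\<^esub> (i, j) (x $$ (k, l))) \<le> mnorm X m x"
proof -
  let ?a = "unit_mat m 0 (i, k) 1 :: complex mat" and ?b = "unit_mat m 0 (l, j) 1 :: complex mat"
  have "mnorm X m (scalar_mult_mat X m ?a x ?b) \<le> mat_op_norm ?a * mnorm X m x * mat_op_norm ?b"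
    by (intro os_scalar_mult X m x) (auto simp: unit_mat_def)
  also have "\<dots> \<le> 1 * mnorm X m x * 1"
    using os_nonneg[OF X m x] by (intro mult_mono mat_op_norm_unit_le) (auto simp: mat_op_norm_nonneg)
  finally show ?thesis using scalar_mult_unit[OF os_cvs[OF X] x kl] by simp
qed

text \<open>In the corner \<open>(0, 0)\<close> the matrix is the direct sum of \<open>a\<close> and
  a zero block. Matrix units carry the corner to \<open>(i, j)\<close> and back without increasing
  the norm, so the position does not matter.\<close>

lemma os_unit:
  assumes X: "operator_space X" and ij: "i < m" "j < m" and a: "a \<in> carrier X"
  shows "mnorm X m (unit_mat m \<zero>\<^bsub>X\<^esub> (i, j) a) = nrm X a"
proof -
  have m: "1 \<le> m" using ij by simp
  let ?u = "\<lambda>ij. unit_mat m \<zero>\<^bsub>X\<^esub> ij a"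
  have z: "\<zero>\<^bsub>X\<^esub> \<in> carrier X" using X by (simp add: os_cvs cvs_zero)
  have u: "?u ij \<in> Mats m X" for ij using a z by (auto simp: unit_mat_def Mats_iff)
  have u00: "mnorm X m (?u (0, 0)) = nrm X a"
  \<comment> \<open>Size 1 is separate because the direct sum axiom asks for two nonempty
    blocks.\<close>
  proof (cases "m = 1")
    case True
    then show ?thesis by (auto simp: nrm_def unit_mat_def intro!: arg_cong2[of _ _ _ _ "mnorm X"])
  next
    case False
    with m have m': "1 \<le> m - 1" "m = 1 + (m - 1)" by auto
    let ?z = "\<zero>\<^bsub>mat_space (m - 1) X\<^esub>" and ?a = "mat 1 1 (\<lambda>_. a)"
    have "mnorm X m (?u (0, 0)) = mnorm X (1 + (m - 1)) (direct_sum_mat X 1 (m - 1) ?a ?z)"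
      using m' by (intro arg_cong2[of _ _ _ _ "mnorm X"])
        (auto simp: unit_mat_def direct_sum_mat_def mat_eq_iff mat_space_zero)
    also have "\<dots> = max (mnorm X 1 ?a) (mnorm X (m - 1) ?z)"
      using m' a X by (intro os_direct_sum) (auto simp: Mats_iff[of "mat 1 1 f" for f] os_cvs simp del: One_nat_def intro!: cvs_zero cvs_mat_space)
    finally show ?thesis
      using os_zero[OF X m'(1)] nrm_nonneg[OF X a] by (simp add: nrm_def)
  qed
  have le: "mnorm X m (?u (i', j')) \<le> mnorm X m (?u (k, l))" if "k < m" "l < m" for i' j' k l
    using os_scalar_mult_unit_le[OF X m u that, of i' j' "(k, l)"] that by (simp add: unit_mat_def)
  from le[of 0 0 i j] le[of i j 0 0] have "mnorm X m (?u (i, j)) = mnorm X m (?u (0, 0))"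
    using ij m by simp
  with u00 show ?thesis by simp
qed

text \<open>Matrix units isolate the entry, and \<open>os_unit\<close> evaluates the result.
  Together with \<open>mnorm_le_sum\<close> this makes every matrix norm equivalent to the norms of
  the entries.\<close>

lemma nrm_entry_le:
  assumes "operator_space X" "x \<in> Mats m X" "i < m" "j < m"
  shows "nrm X (x $$ (i, j)) \<le> mnorm X m x"
  using os_scalar_mult_unit_le[of X m x i j i j] os_unit[of X i m j "x $$ (i, j)"] assms
  by (simp add: Mats_iff)

lemma mnorm_le_sum:
  assumes X: "operator_space X" and m: "1 \<le> m" and x: "x \<in> Mats m X"
  shows "mnorm X m x \<le> (\<Sum>ij\<in>{..<m} \<times> {..<m}. nrm X (x $$ ij))"
proof -
  have z: "\<zero>\<^bsub>X\<^esub> \<in> carrier X" using X by (simp add: os_cvs cvs_zero)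
  \<comment> \<open>The claim is generalised to matrices vanishing outside \<open>A\<close>, so that
    one entry can be split off in each induction step.\<close>
  have "mnorm X m x \<le> (\<Sum>ij\<in>A. nrm X (x $$ ij))"
    if "A \<subseteq> {..<m} \<times> {..<m}" "x \<in> Mats m X" "\<And>i j. i < m \<Longrightarrow> j < m \<Longrightarrow> (i, j) \<notin> A \<Longrightarrow> x $$ (i, j) = \<zero>\<^bsub>X\<^esub>" for A x
  proof -
    have "finite A" using that(1) by (rule finite_subset) simp
    then show ?thesis
      using that
    proof (induction A arbitrary: x)
      case empty
      then have "x = \<zero>\<^bsub>mat_space m X\<^esub>" by (auto simp: Mats_iff mat_eq_iff mat_space_zero)
      then show ?case using os_zero[OF X m] by simp
    next
      case (insert p A)
      obtain i j where p: "p = (i, j)" "i < m" "j < m" using insert.prems by auto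
      let ?y = "mat m m (\<lambda>q. if q = p then \<zero>\<^bsub>X\<^esub> else x $$ q)" and ?u = "unit_mat m \<zero>\<^bsub>X\<^esub> p (x $$ p)"
      have xc: "x $$ (i', j') \<in> carrier X" if "i' < m" "j' < m" for i' j'
        using that insert.prems by (simp add: Mats_iff)
      have y: "?y \<in> Mats m X" and u: "?u \<in> Mats m X"
        using xc z p by (auto simp: Mats_iff unit_mat_def)
      have "x = ?u \<oplus>\<^bsub>mat_space m X\<^esub> ?y"
        using insert.prems xc os_cvs[OF X]
        by (auto simp: mat_eq_iff mat_space_add unit_mat_def Mats_iff cvs_l_zero cvs_r_zero)
      then have "mnorm X m x \<le> mnorm X m ?u + mnorm X m ?y"
        using os_triangle[OF X m u y] by simp
      also have "mnorm X m ?u = nrm X (x $$ p)"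
        using p os_unit[OF X] xc by simp
      also have "mnorm X m ?y \<le> (\<Sum>ij\<in>A. nrm X (?y $$ ij))"
        using insert.prems y by (intro insert.IH) auto
      also have "\<dots> = (\<Sum>ij\<in>A. nrm X (x $$ ij))"
        using insert by (intro sum.cong) auto
      finally show ?case using insert by simp
    qed
  qed
  from this[OF subset_refl x] show ?thesis by auto
qed

section \<open>Vector space and norm axioms transferred along linear maps out of or into a
  space\<close>

lemma cvs_separated:
  fixes Y :: "(complex, 'v, 'y) module_scheme" and X :: "'c \<Rightarrow> (complex, 'u, 'x) module_scheme"
  assumes X: "\<And>c. c \<in> C \<Longrightarrow> cvs (X c)"
    and closed: "\<zero>\<^bsub>Y\<^esub> \<in> carrier Y"
      "\<And>x y. x \<in> carrier Y \<Longrightarrow> y \<in> carrier Y \<Longrightarrow> x \<oplus>\<^bsub>Y\<^esub> y \<in> carrier Y"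
      "\<And>a x. x \<in> carrier Y \<Longrightarrow> a \<odot>\<^bsub>Y\<^esub> x \<in> carrier Y"
    and \<pi>: "\<And>c x. c \<in> C \<Longrightarrow> x \<in> carrier Y \<Longrightarrow> \<pi> c x \<in> carrier (X c)"
      "\<And>c. c \<in> C \<Longrightarrow> \<pi> c \<zero>\<^bsub>Y\<^esub> = \<zero>\<^bsub>X c\<^esub>"
      "\<And>c x y. c \<in> C \<Longrightarrow> x \<in> carrier Y \<Longrightarrow> y \<in> carrier Y \<Longrightarrow> \<pi> c (x \<oplus>\<^bsub>Y\<^esub> y) = \<pi> c x \<oplus>\<^bsub>X c\<^esub> \<pi> c y"
      "\<And>c a x. c \<in> C \<Longrightarrow> x \<in> carrier Y \<Longrightarrow> \<pi> c (a \<odot>\<^bsub>Y\<^esub> x) = a \<odot>\<^bsub>X c\<^esub> \<pi> c x"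
    and sep: "\<And>x y. x \<in> carrier Y \<Longrightarrow> y \<in> carrier Y \<Longrightarrow> (\<And>c. c \<in> C \<Longrightarrow> \<pi> c x = \<pi> c y) \<Longrightarrow> x = y"
  shows "cvs Y"
  \<comment> \<open>\<open>sep\<close> turns each equation in \<open>Y\<close> into equations in the
    spaces \<open>X c\<close>.\<close>
  by (rule cvsI; (rule sep)?)
    (auto simp: closed \<pi> X cvs_closed cvs_assoc cvs_l_zero cvs_smult_add cvs_add_smult cvs_smult_smult cvs_one
      cvs_smult_0 intro: cvs_comm)

text \<open>Each axiom involves at most three elements, so it is inherited from any space in which
  these three have preimages, and different triples may use different spaces. This suits directed
  colimits as \<open>cvs_separated\<close> suits subspaces of products.\<close>

lemma cvs_lift:
  fixes Y :: "(complex, 'v, 'y) module_scheme"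
  assumes lift: "\<And>a b c. a \<in> carrier Y \<Longrightarrow> b \<in> carrier Y \<Longrightarrow> c \<in> carrier Y \<Longrightarrow>
      \<exists>(X :: (complex, 'u, 'x) module_scheme) \<psi>. cvs X \<and>
        (\<forall>x\<in>carrier X. \<psi> x \<in> carrier Y) \<and> \<psi> \<zero>\<^bsub>X\<^esub> = \<zero>\<^bsub>Y\<^esub> \<and>
        (\<forall>x\<in>carrier X. \<forall>y\<in>carrier X. \<psi> (x \<oplus>\<^bsub>X\<^esub> y) = \<psi> x \<oplus>\<^bsub>Y\<^esub> \<psi> y) \<and>
        (\<forall>k. \<forall>x\<in>carrier X. \<psi> (k \<odot>\<^bsub>X\<^esub> x) = k \<odot>\<^bsub>Y\<^esub> \<psi> x) \<and>
        {a, b, c} \<subseteq> \<psi> ` carrier X"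
    and zero: "\<zero>\<^bsub>Y\<^esub> \<in> carrier Y"
  shows "cvs Y"
proof -
  note simps = cvs_closed cvs_l_zero cvs_smult_add cvs_add_smult cvs_smult_smult cvs_one cvs_smult_0
  have *: "x \<oplus>\<^bsub>Y\<^esub> y \<in> carrier Y \<and> k \<odot>\<^bsub>Y\<^esub> x \<in> carrier Y \<and> \<zero>\<^bsub>Y\<^esub> \<oplus>\<^bsub>Y\<^esub> x = x \<and>
      (k + l) \<odot>\<^bsub>Y\<^esub> x = k \<odot>\<^bsub>Y\<^esub> x \<oplus>\<^bsub>Y\<^esub> l \<odot>\<^bsub>Y\<^esub> x \<and> (k * l) \<odot>\<^bsub>Y\<^esub> x = k \<odot>\<^bsub>Y\<^esub> (l \<odot>\<^bsub>Y\<^esub> x) \<and>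
      1 \<odot>\<^bsub>Y\<^esub> x = x \<and> 0 \<odot>\<^bsub>Y\<^esub> x = \<zero>\<^bsub>Y\<^esub> \<and> k \<odot>\<^bsub>Y\<^esub> (x \<oplus>\<^bsub>Y\<^esub> y) = k \<odot>\<^bsub>Y\<^esub> x \<oplus>\<^bsub>Y\<^esub> k \<odot>\<^bsub>Y\<^esub> y \<and>
      x \<oplus>\<^bsub>Y\<^esub> y = y \<oplus>\<^bsub>Y\<^esub> x \<and> (x \<oplus>\<^bsub>Y\<^esub> y) \<oplus>\<^bsub>Y\<^esub> z = x \<oplus>\<^bsub>Y\<^esub> (y \<oplus>\<^bsub>Y\<^esub> z)"
    if x: "x \<in> carrier Y" and y: "y \<in> carrier Y" and z: "z \<in> carrier Y" for x y z k l
  proof -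
    obtain X :: "(complex, 'u, 'x) module_scheme" and \<psi> where X: "cvs X"
      and \<psi>: "\<forall>x\<in>carrier X. \<psi> x \<in> carrier Y" "\<psi> \<zero>\<^bsub>X\<^esub> = \<zero>\<^bsub>Y\<^esub>"
        "\<forall>x\<in>carrier X. \<forall>y\<in>carrier X. \<psi> (x \<oplus>\<^bsub>X\<^esub> y) = \<psi> x \<oplus>\<^bsub>Y\<^esub> \<psi> y"
        "\<forall>k. \<forall>x\<in>carrier X. \<psi> (k \<odot>\<^bsub>X\<^esub> x) = k \<odot>\<^bsub>Y\<^esub> \<psi> x"
      and sub: "{x, y, z} \<subseteq> \<psi> ` carrier X"
      using lift[OF x y z] by (elim exE conjE) (rule that; assumption)
    note \<psi>' = \<psi>(1)[rule_format] \<psi>(2-4)[rule_format, symmetric]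
    interpret X: abelian_group X using X by (rule cvs_abelian_group)
    from sub obtain a b c where "a \<in> carrier X" "b \<in> carrier X" "c \<in> carrier X" "x = \<psi> a" "y = \<psi> b" "z = \<psi> c"
      by auto
    then show ?thesis
      by (simp add: \<psi>' simps X X.a_ac)
  qed
  show ?thesis
  proof (rule cvsI)
    fix x y z k l
    assume x: "x \<in> carrier Y"
    note *[OF x x x, of k l]
    then show "k \<odot>\<^bsub>Y\<^esub> x \<in> carrier Y" "\<zero>\<^bsub>Y\<^esub> \<oplus>\<^bsub>Y\<^esub> x = x" "(k + l) \<odot>\<^bsub>Y\<^esub> x = k \<odot>\<^bsub>Y\<^esub> x \<oplus>\<^bsub>Y\<^esub> l \<odot>\<^bsub>Y\<^esub> x"
      "(k * l) \<odot>\<^bsub>Y\<^esub> x = k \<odot>\<^bsub>Y\<^esub> (l \<odot>\<^bsub>Y\<^esub> x)" "1 \<odot>\<^bsub>Y\<^esub> x = x" "0 \<odot>\<^bsub>Y\<^esub> x = \<zero>\<^bsub>Y\<^esub>"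
      by - (elim conjE, assumption)+
    assume y: "y \<in> carrier Y"
    note *[OF x y y, of k l]
    then show "x \<oplus>\<^bsub>Y\<^esub> y \<in> carrier Y" "k \<odot>\<^bsub>Y\<^esub> (x \<oplus>\<^bsub>Y\<^esub> y) = k \<odot>\<^bsub>Y\<^esub> x \<oplus>\<^bsub>Y\<^esub> k \<odot>\<^bsub>Y\<^esub> y" "x \<oplus>\<^bsub>Y\<^esub> y = y \<oplus>\<^bsub>Y\<^esub> x"
      by - (elim conjE, assumption)+
    assume z: "z \<in> carrier Y"
    note *[OF x y z, of k l]
    then show "(x \<oplus>\<^bsub>Y\<^esub> y) \<oplus>\<^bsub>Y\<^esub> z = x \<oplus>\<^bsub>Y\<^esub> (y \<oplus>\<^bsub>Y\<^esub> z)"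
      by - (elim conjE, assumption)
  qed (rule zero)
qed

text \<open>\<open>upper\<close> and \<open>least\<close> say that the norms of \<open>Y\<close> are
  suprema of the norms of the images, so inequalities valid in all \<open>X c\<close> pass to
  \<open>Y\<close>. The bound \<open>B\<close> is nonnegative to cover an empty \<open>C\<close>.
  Completeness depends on which part of the product \<open>Y\<close> is, and stays a
  premise.\<close>

lemma operator_space_sup:
  fixes Y :: "'v opspace" and X :: "'c \<Rightarrow> 'u opspace"
  assumes Y: "cvs Y"
    and X: "\<And>c. c \<in> C \<Longrightarrow> operator_space (X c)"
    and \<pi>: "\<And>c. c \<in> C \<Longrightarrow> clinear Y (X c) (\<pi> c)"
    and inj: "\<And>y. y \<in> carrier Y \<Longrightarrow> (\<And>c. c \<in> C \<Longrightarrow> \<pi> c y = \<zero>\<^bsub>X c\<^esub>) \<Longrightarrow> y = \<zero>\<^bsub>Y\<^esub>"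
    and nonneg: "\<And>n y. 1 \<le> n \<Longrightarrow> y \<in> Mats n Y \<Longrightarrow> 0 \<le> mnorm Y n y"
    and upper: "\<And>c n y. c \<in> C \<Longrightarrow> 1 \<le> n \<Longrightarrow> y \<in> Mats n Y \<Longrightarrow> mnorm (X c) n (map_mat (\<pi> c) y) \<le> mnorm Y n y"
    and least: "\<And>n y B. 1 \<le> n \<Longrightarrow> y \<in> Mats n Y \<Longrightarrow> 0 \<le> B \<Longrightarrow>
      (\<And>c. c \<in> C \<Longrightarrow> mnorm (X c) n (map_mat (\<pi> c) y) \<le> B) \<Longrightarrow> mnorm Y n y \<le> B"
    and complete: "\<And>\<sigma>. range \<sigma> \<subseteq> carrier Y \<Longrightarrow>
      (\<And>\<epsilon>. \<epsilon> > 0 \<Longrightarrow> \<exists>K. \<forall>p\<ge>K. \<forall>q\<ge>K. nrm Y (\<sigma> p \<ominus>\<^bsub>Y\<^esub> \<sigma> q) < \<epsilon>) \<Longrightarrow>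
      \<exists>x\<in>carrier Y. (\<lambda>p. nrm Y (\<sigma> p \<ominus>\<^bsub>Y\<^esub> x)) \<longlonglongrightarrow> 0"
  shows "operator_space Y"
proof (rule operator_spaceI[OF Y nonneg _ _ _ _ _ complete])
  fix n :: nat and y assume n: "1 \<le> n" and y: "y \<in> Mats n Y"
  note M = cvs_mat_space[OF Y, of n]
  note py = Mats_map[OF \<pi> y]
  show "y = \<zero>\<^bsub>mat_space n Y\<^esub>" if 0: "mnorm Y n y = 0"
  proof -
    have "\<pi> c (y $$ (i, j)) = \<zero>\<^bsub>X c\<^esub>" if c: "c \<in> C" and ij: "i < n" "j < n" for c i j
    proof -
      have "mnorm (X c) n (map_mat (\<pi> c) y) = 0"
        using upper[OF c n y] os_nonneg[OF X[OF c] n py[OF c]] 0 by simp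
      then have "map_mat (\<pi> c) y = \<zero>\<^bsub>mat_space n (X c)\<^esub>"
        using os_zero_iff[OF X[OF c] n py[OF c]] by simp
      then show ?thesis
        using ij y by (auto simp: mat_eq_iff mat_space_zero Mats_iff)
    qed
    then show ?thesis
      using y inj by (auto simp: mat_eq_iff mat_space_zero Mats_iff)
  qed
  show "mnorm Y n (c \<odot>\<^bsub>mat_space n Y\<^esub> y) \<le> cmod c * mnorm Y n y" for c
    using n y M upper[OF _ n y] nonneg[OF n y] py X
    by (intro least) (auto simp: clinear_smult[OF clinear_map_mat[OF \<pi>]] os_smult cvs_smult mult_left_mono)
  show "mnorm Y n (y \<oplus>\<^bsub>mat_space n Y\<^esub> z) \<le> mnorm Y n y + mnorm Y n z" if z: "z \<in> Mats n Y" for z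
  proof (rule least[OF n cvs_add[OF M y z]])
    fix c assume c: "c \<in> C"
    show "mnorm (X c) n (map_mat (\<pi> c) (y \<oplus>\<^bsub>mat_space n Y\<^esub> z)) \<le> mnorm Y n y + mnorm Y n z"
      using os_triangle[OF X[OF c] n py[OF c] Mats_map[OF \<pi>[OF c] z]] upper[OF c n y] upper[OF c n z]
      by (simp add: clinear_add[OF clinear_map_mat[OF \<pi>[OF c]] y z])
  qed (use nonneg n y z in \<open>simp add: add_nonneg_nonneg\<close>)
  show "mnorm Y n (scalar_mult_mat Y n a y b) \<le> mat_op_norm a * mnorm Y n y * mat_op_norm b"
    if ab: "a \<in> carrier_mat n n" "b \<in> carrier_mat n n" for a b
  proof (rule least[OF n Mats_scalar_mult[OF Y y]])
    fix c assume c: "c \<in> C"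
    have "mnorm (X c) n (map_mat (\<pi> c) (scalar_mult_mat Y n a y b)) \<le>
        mat_op_norm a * mnorm (X c) n (map_mat (\<pi> c) y) * mat_op_norm b"
      using os_scalar_mult[OF X[OF c] n py[OF c] ab] by (simp add: map_scalar_mult[OF \<pi>[OF c] y])
    also have "\<dots> \<le> mat_op_norm a * mnorm Y n y * mat_op_norm b"
      using upper[OF c n y] by (intro mult_right_mono mult_left_mono mat_op_norm_nonneg)
    finally show "mnorm (X c) n (map_mat (\<pi> c) (scalar_mult_mat Y n a y b)) \<le>
        mat_op_norm a * mnorm Y n y * mat_op_norm b" .
  qed (intro mult_nonneg_nonneg mat_op_norm_nonneg nonneg n y)
  fix m :: nat and z assume m: "1 \<le> m" and z: "z \<in> Mats m Y"
  have nm: "1 \<le> n + m" using n by simp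
  have ds: "direct_sum_mat Y n m y z \<in> Mats (n + m) Y" by (rule Mats_direct_sum[OF Y y z])
  have eq: "mnorm (X c) (n + m) (map_mat (\<pi> c) (direct_sum_mat Y n m y z)) =
      max (mnorm (X c) n (map_mat (\<pi> c) y)) (mnorm (X c) m (map_mat (\<pi> c) z))" if c: "c \<in> C" for c
    unfolding map_direct_sum[OF \<pi>[OF c] y z]
    by (rule os_direct_sum[OF X[OF c] n m py[OF c] Mats_map[OF \<pi>[OF c] z]])
  show "mnorm Y (n + m) (direct_sum_mat Y n m y z) = max (mnorm Y n y) (mnorm Y m z)"
  proof (rule antisym)
    show "mnorm Y (n + m) (direct_sum_mat Y n m y z) \<le> max (mnorm Y n y) (mnorm Y m z)"
      using upper[OF _ n y] upper[OF _ m z] nonneg[OF n y]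
      by (intro least[OF nm ds]) (auto simp: eq intro: max.coboundedI1 max.coboundedI2)
    have "mnorm Y n y \<le> mnorm Y (n + m) (direct_sum_mat Y n m y z)"
      using upper[OF _ nm ds] nonneg[OF nm ds] by (intro least[OF n y]) (auto simp: eq)
    moreover have "mnorm Y m z \<le> mnorm Y (n + m) (direct_sum_mat Y n m y z)"
      using upper[OF _ nm ds] nonneg[OF nm ds] by (intro least[OF m z]) (auto simp: eq)
    ultimately show "max (mnorm Y n y) (mnorm Y m z) \<le> mnorm Y (n + m) (direct_sum_mat Y n m y z)"
      by simp
  qed
qed

text \<open>The norm axioms involve at most two matrices and completeness a sequence, so only such data have
  to be lifted without change of norm.\<close>

lemma operator_space_lift:
  fixes Y :: "'v opspace"
  assumes Y: "cvs Y"
    and lift: "\<And>m n x y. 1 \<le> m \<Longrightarrow> 1 \<le> n \<Longrightarrow> x \<in> Mats m Y \<Longrightarrow> y \<in> Mats n Y \<Longrightarrow>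
      \<exists>(X :: 'u opspace) \<psi> a b. operator_space X \<and> clinear X Y \<psi> \<and> complete_contraction X Y \<psi> \<and>
        a \<in> Mats m X \<and> b \<in> Mats n X \<and> map_mat \<psi> a = x \<and> map_mat \<psi> b = y \<and>
        mnorm X m a = mnorm Y m x \<and> mnorm X n b = mnorm Y n y \<and>
        mnorm X (m + n) (direct_sum_mat X m n a b) = mnorm Y (m + n) (direct_sum_mat Y m n x y)"
    and lift_seq: "\<And>\<sigma> :: nat \<Rightarrow> 'v. range \<sigma> \<subseteq> carrier Y \<Longrightarrow>
      \<exists>(X :: 'u opspace) \<psi> \<tau>. operator_space X \<and> clinear X Y \<psi> \<and> complete_contraction X Y \<psi> \<and>
        range \<tau> \<subseteq> carrier X \<and> (\<forall>p. \<psi> (\<tau> p) = \<sigma> p) \<and>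
        (\<forall>p q. nrm X (\<tau> p \<ominus>\<^bsub>X\<^esub> \<tau> q) = nrm Y (\<sigma> p \<ominus>\<^bsub>Y\<^esub> \<sigma> q))"
  shows "operator_space Y"
proof -
  \<comment> \<open>Elimination form of \<open>lift\<close>; for axioms about a single matrix it is
    used with \<open>y\<close> equal to \<open>x\<close>.\<close>
  have lift2: thesis
    if "1 \<le> m" "1 \<le> n" "x \<in> Mats m Y" "y \<in> Mats n Y"
      "\<And>(X :: 'u opspace) \<psi> a b. operator_space X \<Longrightarrow> clinear X Y \<psi> \<Longrightarrow> complete_contraction X Y \<psi> \<Longrightarrow>
        a \<in> Mats m X \<Longrightarrow> b \<in> Mats n X \<Longrightarrow> map_mat \<psi> a = x \<Longrightarrow> map_mat \<psi> b = y \<Longrightarrow>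
        mnorm X m a = mnorm Y m x \<Longrightarrow> mnorm X n b = mnorm Y n y \<Longrightarrow>
        mnorm X (m + n) (direct_sum_mat X m n a b) = mnorm Y (m + n) (direct_sum_mat Y m n x y) \<Longrightarrow> thesis"
    for m n x y thesis
    using lift[OF that(1-4)] by (elim exE conjE) (rule that(5))
  show ?thesis
  proof (rule operator_spaceI[OF Y])
    fix n :: nat and x assume n: "1 \<le> n" and x: "x \<in> Mats n Y"
    show "0 \<le> mnorm Y n x"
    proof (rule lift2[OF n n x x])
      fix X :: "'u opspace" and a
      assume "operator_space X" "a \<in> Mats n X" "mnorm X n a = mnorm Y n x"
      then show ?thesis using os_nonneg[of X n a] n by simp
    qed
    show "x = \<zero>\<^bsub>mat_space n Y\<^esub>" if 0: "mnorm Y n x = 0"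
    proof (rule lift2[OF n n x x])
      fix X :: "'u opspace" and \<psi> a
      assume *: "operator_space X" "a \<in> Mats n X" "mnorm X n a = mnorm Y n x" "clinear X Y \<psi>" "map_mat \<psi> a = x"
      then have "a = \<zero>\<^bsub>mat_space n X\<^esub>" using os_zero_iff[of X n a] n 0 by simp
      then show ?thesis using clinear_zero[OF clinear_map_mat[OF *(4)], of n] *(5) by simp
    qed
    show "mnorm Y n (c \<odot>\<^bsub>mat_space n Y\<^esub> x) \<le> cmod c * mnorm Y n x" for c
    proof (rule lift2[OF n n x x])
      fix X :: "'u opspace" and \<psi> a
      assume *: "operator_space X" "clinear X Y \<psi>" "complete_contraction X Y \<psi>" "a \<in> Mats n X"
        "map_mat \<psi> a = x" "mnorm X n a = mnorm Y n x"
      have "c \<odot>\<^bsub>mat_space n X\<^esub> a \<in> Mats n X" using * by (simp add: cvs_smult cvs_mat_space os_cvs)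
      then have "mnorm Y n (map_mat \<psi> (c \<odot>\<^bsub>mat_space n X\<^esub> a)) \<le> mnorm X n (c \<odot>\<^bsub>mat_space n X\<^esub> a)"
        by (rule cc_D[OF *(3) n])
      then show ?thesis
        using * n by (simp add: os_smult clinear_smult[OF clinear_map_mat])
    qed
    show "mnorm Y n (scalar_mult_mat Y n c x d) \<le> mat_op_norm c * mnorm Y n x * mat_op_norm d"
      if cd: "c \<in> carrier_mat n n" "d \<in> carrier_mat n n" for c d
    proof (rule lift2[OF n n x x])
      fix X :: "'u opspace" and \<psi> a
      assume *: "operator_space X" "clinear X Y \<psi>" "complete_contraction X Y \<psi>" "a \<in> Mats n X"
        "map_mat \<psi> a = x" "mnorm X n a = mnorm Y n x"
      have "mnorm Y n (map_mat \<psi> (scalar_mult_mat X n c a d)) \<le> mnorm X n (scalar_mult_mat X n c a d)"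
        using * by (intro cc_D[OF *(3) n] Mats_scalar_mult) (auto simp: os_cvs)
      then show ?thesis
        using os_scalar_mult[OF *(1) n *(4) cd] * by (simp add: map_scalar_mult)
    qed
    show "mnorm Y n (x \<oplus>\<^bsub>mat_space n Y\<^esub> y) \<le> mnorm Y n x + mnorm Y n y" if y: "y \<in> Mats n Y" for y
    proof (rule lift2[OF n n x y])
      fix X :: "'u opspace" and \<psi> a b
      assume *: "operator_space X" "clinear X Y \<psi>" "complete_contraction X Y \<psi>" "a \<in> Mats n X"
        "b \<in> Mats n X" "map_mat \<psi> a = x" "map_mat \<psi> b = y" "mnorm X n a = mnorm Y n x" "mnorm X n b = mnorm Y n y"
      have "mnorm Y n (map_mat \<psi> (a \<oplus>\<^bsub>mat_space n X\<^esub> b)) \<le> mnorm X n (a \<oplus>\<^bsub>mat_space n X\<^esub> b)"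
        using * by (intro cc_D[OF *(3) n] cvs_add cvs_mat_space) (auto simp: os_cvs)
      then show ?thesis
        using os_triangle[OF *(1) n *(4,5)] * by (simp add: clinear_add[OF clinear_map_mat])
    qed
    show "mnorm Y (n + m) (direct_sum_mat Y n m x y) = max (mnorm Y n x) (mnorm Y m y)"
      if m: "1 \<le> m" and y: "y \<in> Mats m Y" for m y
    proof (rule lift2[OF n m x y])
      fix X :: "'u opspace" and a b
      assume "operator_space X" "a \<in> Mats n X" "b \<in> Mats m X" "mnorm X n a = mnorm Y n x" "mnorm X m b = mnorm Y m y"
        "mnorm X (n + m) (direct_sum_mat X n m a b) = mnorm Y (n + m) (direct_sum_mat Y n m x y)"
      then show ?thesis using os_direct_sum[of X n m a b] n m by simp
    qed
  next
    fix \<sigma> :: "nat \<Rightarrow> 'v"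
    assume \<sigma>: "range \<sigma> \<subseteq> carrier Y"
    obtain X :: "'u opspace" and \<psi> \<tau> where "operator_space X \<and> clinear X Y \<psi> \<and>
        complete_contraction X Y \<psi> \<and> range \<tau> \<subseteq> carrier X \<and> (\<forall>p. \<psi> (\<tau> p) = \<sigma> p) \<and>
        (\<forall>p q. nrm X (\<tau> p \<ominus>\<^bsub>X\<^esub> \<tau> q) = nrm Y (\<sigma> p \<ominus>\<^bsub>Y\<^esub> \<sigma> q))"
      using lift_seq[OF \<sigma>] by (elim exE)
    then have *: "operator_space X" "clinear X Y \<psi>" "complete_contraction X Y \<psi>"
        "range \<tau> \<subseteq> carrier X" "\<And>p. \<psi> (\<tau> p) = \<sigma> p"
        "\<And>p q. nrm X (\<tau> p \<ominus>\<^bsub>X\<^esub> \<tau> q) = nrm Y (\<sigma> p \<ominus>\<^bsub>Y\<^esub> \<sigma> q)"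
      by auto
    assume cauchy: "\<And>\<epsilon>. \<epsilon> > 0 \<Longrightarrow> \<exists>K. \<forall>p\<ge>K. \<forall>q\<ge>K. nrm Y (\<sigma> p \<ominus>\<^bsub>Y\<^esub> \<sigma> q) < \<epsilon>"
    obtain x where x: "x \<in> carrier X" "(\<lambda>p. nrm X (\<tau> p \<ominus>\<^bsub>X\<^esub> x)) \<longlonglongrightarrow> 0"
      using os_complete[OF *(1,4), unfolded *(6), OF cauchy] by blast
    have \<tau>: "\<tau> p \<in> carrier X" for p using *(4) by auto
    \<comment> \<open>Since \<open>\<psi>\<close> is a contraction, the image of the limit found in
      \<open>X\<close> is a limit in \<open>Y\<close>.\<close>
    have le: "nrm Y (\<sigma> p \<ominus>\<^bsub>Y\<^esub> \<psi> x) \<le> nrm X (\<tau> p \<ominus>\<^bsub>X\<^esub> x)" for p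
      using cc_nrm[OF *(3), of "\<tau> p \<ominus>\<^bsub>X\<^esub> x"] \<tau> x *(1,2,5)
      by (simp add: cvs_minus os_cvs clinear_minus)
    \<comment> \<open>Nonnegativity provides the lower side of the sandwich below.\<close>
    have "0 \<le> nrm Y y" if "y \<in> carrier Y" for y
      unfolding nrm_def
    proof (rule lift2[of 1 1 "mat 1 1 (\<lambda>_. y)" "mat 1 1 (\<lambda>_. y)"])
      fix X :: "'u opspace" and a
      assume "operator_space X" "a \<in> Mats 1 X" "mnorm X 1 a = mnorm Y 1 (mat 1 1 (\<lambda>_. y))"
      then show "0 \<le> mnorm Y 1 (mat 1 1 (\<lambda>_. y))" using os_nonneg[of X 1 a] by simp
    qed (use that in \<open>simp_all add: Mats_iff\<close>)
    then have "0 \<le> nrm Y (\<sigma> p \<ominus>\<^bsub>Y\<^esub> \<psi> x)" for p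
      using *(2) \<tau> x(1) by (simp add: clinear_closed cvs_minus Y flip: *(5))
    then have "(\<lambda>p. nrm Y (\<sigma> p \<ominus>\<^bsub>Y\<^esub> \<psi> x)) \<longlonglongrightarrow> 0"
      by (intro tendsto_sandwich[OF _ _ tendsto_const x(2)] always_eventually allI le)
    then show "\<exists>y\<in>carrier Y. (\<lambda>p. nrm Y (\<sigma> p \<ominus>\<^bsub>Y\<^esub> y)) \<longlonglongrightarrow> 0"
      using x(1) *(2) by (auto simp: clinear_closed)
  qed
qed


section \<open>Small sets\<close>

context
  fixes \<kappa> :: "'u rel"
  assumes U: "universe \<kappa>"
begin

lemma universe_Cinfinite: "Cinfinite \<kappa>" and universe_regular: "regularCard \<kappa>"
  using U by (auto simp: universe_def)

text \<open>\<open>\<kappa>\<close> has the cardinality of its field, a set of elements of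
  \<open>'u\<close>. This is how objects built from tuples or equivalence classes are brought back
  to the carrier type.\<close>

lemma universe_copy:
  fixes A :: "'v set"
  assumes "|A| <o \<kappa>"
  obtains e :: "'v \<Rightarrow> 'u" where "inj_on e A"
proof -
  have "\<kappa> =o |Field \<kappa>|"
    using card_of_Field_ordIso universe_Cinfinite ordIso_symmetric by blast
  then have "|A| \<le>o |Field \<kappa>|"
    using assms ordLess_ordIso_trans ordLess_imp_ordLeq by blast
  then show thesis using that card_of_ordLeq by metis
qed

lemma small_mono: "|B| \<le>o |A| \<Longrightarrow> |A| <o \<kappa> \<Longrightarrow> |B| <o \<kappa>"
  by (rule ordLeq_ordLess_trans)

lemma small_image: "|A| <o \<kappa> \<Longrightarrow> |f ` A| <o \<kappa>"
  by (rule small_mono[OF card_of_image])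

lemma small_inj: "inj_on f B \<Longrightarrow> f ` B \<subseteq> A \<Longrightarrow> |A| <o \<kappa> \<Longrightarrow> |B| <o \<kappa>"
  by (rule small_mono[OF card_of_ordLeqI]) auto

lemma small_UN: "|I| <o \<kappa> \<Longrightarrow> (\<And>i. i \<in> I \<Longrightarrow> |A i| <o \<kappa>) \<Longrightarrow> |\<Union>i\<in>I. A i| <o \<kappa>"
  using card_of_UNION_ordLess_infinite_Field_regularCard[OF universe_regular universe_Cinfinite] by blast

lemma small_Sigma:
  assumes "|I| <o \<kappa>" "\<And>i. i \<in> I \<Longrightarrow> |A i| <o \<kappa>"
  shows "|Sigma I A| <o \<kappa>"
proof -
  have "Sigma I A = (\<Union>i\<in>I. Pair i ` A i)" by auto
  then show ?thesis using assms by (simp add: small_UN small_image)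
qed

text \<open>The power condition in \<open>universe\<close> speaks of sets in \<open>'u\<close> only,
  so \<open>A\<close> is replaced by a copy there.\<close>

lemma small_sequences:
  fixes A :: "'v set"
  assumes A: "|A| <o \<kappa>"
  shows "|{f :: nat \<Rightarrow> 'v. range f \<subseteq> A}| <o \<kappa>"
proof -
  obtain e :: "'v \<Rightarrow> 'u" where e: "inj_on e A" using A by (rule universe_copy)
  have "|e ` A| ^c natLeq <o \<kappa>"
    using U small_image[OF A, of e] unfolding universe_def by blast
  then have "|Func (UNIV :: nat set) (e ` A)| <o \<kappa>"
    by (simp add: cexp_def Field_natLeq Field_card_of)
  moreover have "inj_on ((\<circ>) e) {f :: nat \<Rightarrow> 'v. range f \<subseteq> A}"
  proof (intro inj_onI ext)
    fix f g :: "nat \<Rightarrow> 'v" and n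
    assume fg: "f \<in> {f. range f \<subseteq> A}" "g \<in> {f. range f \<subseteq> A}" "e \<circ> f = e \<circ> g"
    from fun_cong[OF fg(3), of n] fg(1,2) inj_onD[OF e, of "f n" "g n"] show "f n = g n" by auto
  qed
  ultimately show ?thesis
    by (rule small_inj[rotated 2]) (auto simp: Func_def subset_eq)
qed

lemma small_finite: "finite A \<Longrightarrow> |A| <o \<kappa>"
  using universe_Cinfinite finite_ordLess_infinite[OF card_of_Well_order, of \<kappa> A]
  by (auto simp: cinfinite_def card_order_on_def Field_card_of)

text \<open>Closure under countable powers forces \<kappa> to be uncountable: numbers are encoded by
  the characteristic sequences of their singletons, and there are fewer than \<kappa> Boolean
  sequences.\<close>

lemma small_nat: "|UNIV :: nat set| <o \<kappa>"
proof -
  have "|{True, False}| <o \<kappa>" by (rule small_finite) simp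
  then have "|{f :: nat \<Rightarrow> bool. range f \<subseteq> {True, False}}| <o \<kappa>" by (rule small_sequences)
  moreover have "inj (\<lambda>n i :: nat. i = n)" by (rule injI) metis
  ultimately show ?thesis by (rule small_inj[rotated 2]) auto
qed

lemma small_countable: "countable A \<Longrightarrow> |A| <o \<kappa>"
  using small_inj[OF _ subset_UNIV small_nat] by (auto simp: countable_def)

text \<open>A real number \<open>x\<close> is determined by the integers
  \<open>\<lfloor>real n * x\<rfloor>\<close>, so a complex number is encoded by a sequence of pairs
  of integers.\<close>

lemma small_complex: "|UNIV :: complex set| <o \<kappa>"
proof -
  let ?f = "\<lambda>z n. (\<lfloor>real n * Re z\<rfloor>, \<lfloor>real n * Im z\<rfloor>)"
  have "|UNIV :: (int \<times> int) set| <o \<kappa>" by (rule small_countable) simp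
  then have "|{f :: nat \<Rightarrow> int \<times> int. range f \<subseteq> UNIV}| <o \<kappa>" by (rule small_sequences)
  moreover have "inj ?f"
  proof (rule injI)
    have *: "x = y" if xy: "\<And>n. \<lfloor>real n * x\<rfloor> = \<lfloor>real n * y\<rfloor>" for x y :: real
    proof (rule ccontr)
      assume "x \<noteq> y"
      \<comment> \<open>By the Archimedean property suitable multiples of distinct numbers are more
        than 1 apart, which equal floors forbid.\<close>
      then obtain n where n: "1 < real n * \<bar>x - y\<bar>" using ex_less_of_nat_mult[of "\<bar>x - y\<bar>" 1] by auto
      have "real n * \<bar>x - y\<bar> = \<bar>real n * x - real n * y\<bar>" by (simp add: abs_mult flip: right_diff_distrib)
      also have "\<dots> < 1" using xy[of n] by linarith
      finally show False using n by simp
    qed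
    fix z w assume "?f z = ?f w"
    then have "?f z n = ?f w n" for n by (rule fun_cong)
    then show "z = w" by (intro complex_eqI *) auto
  qed
  ultimately show ?thesis by (rule small_inj[rotated 2]) auto
qed

end


section \<open>Universal operator spaces generated by a bounded family\<close>

text \<open>
  The operator spaces \<open>X c\<close> with families \<open>x c\<close> of elements indexed by \<open>I\<close> stand for all ways to interpret
  given generators. Even if \<open>C\<close> is a large set, the closed linear span of the tuples \<open>\<lambda>c. x c i\<close>
  in the product of the \<open>X c\<close> is small, since each of its elements is the limit of a sequence of linear
  combinations.
\<close>

locale bounded_family =
  fixes C :: "'c set" and X :: "'c \<Rightarrow> 'u opspace" and I :: "'i set" and x :: "'c \<Rightarrow> 'i \<Rightarrow> 'u"
  assumes X: "c \<in> C \<Longrightarrow> operator_space (X c)"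
    and x: "c \<in> C \<Longrightarrow> i \<in> I \<Longrightarrow> x c i \<in> carrier (X c)"
    and bdd: "i \<in> I \<Longrightarrow> \<exists>B. \<forall>c\<in>C. nrm (X c) (x c i) \<le> B"
begin

text \<open>Tuples are kept undefined outside \<open>C\<close>, here and in the next definitions, so
  that equality of tuples is equality of their coordinates in \<open>C\<close>.\<close>

definition fzero :: "'c \<Rightarrow> 'u" where "fzero = (\<lambda>c\<in>C. \<zero>\<^bsub>X c\<^esub>)"

definition fadd :: "('c \<Rightarrow> 'u) \<Rightarrow> ('c \<Rightarrow> 'u) \<Rightarrow> 'c \<Rightarrow> 'u" where "fadd f g = (\<lambda>c\<in>C. f c \<oplus>\<^bsub>X c\<^esub> g c)"

definition fsmult :: "complex \<Rightarrow> ('c \<Rightarrow> 'u) \<Rightarrow> 'c \<Rightarrow> 'u" where "fsmult a f = (\<lambda>c\<in>C. a \<odot>\<^bsub>X c\<^esub> f c)"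

definition gen :: "'i \<Rightarrow> 'c \<Rightarrow> 'u" where "gen i = (\<lambda>c\<in>C. x c i)"

text \<open>Uniform distance, stated coordinatewise because the supremum over all coordinates need
  not exist for arbitrary tuples.\<close>

definition close :: "real \<Rightarrow> ('c \<Rightarrow> 'u) \<Rightarrow> ('c \<Rightarrow> 'u) \<Rightarrow> bool" where
  "close \<epsilon> f g \<longleftrightarrow> (\<forall>c\<in>C. nrm (X c) (f c \<ominus>\<^bsub>X c\<^esub> g c) \<le> \<epsilon>)"

abbreviation tuples :: "('c \<Rightarrow> 'u) set" where "tuples \<equiv> \<Pi>\<^sub>E c\<in>C. carrier (X c)"

text \<open>Sums of \<open>n\<close> scalar multiples of generators, repetitions allowed. The
  recursion exhibits each level as an image of a product, which is how smallness is proved.\<close>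

primrec comb :: "nat \<Rightarrow> ('c \<Rightarrow> 'u) set" where
  "comb 0 = {fzero}"
| "comb (Suc n) = (\<lambda>(f, a, i). fadd f (fsmult a (gen i))) ` (comb n \<times> UNIV \<times> I)"

definition combs :: "('c \<Rightarrow> 'u) set" where "combs = (\<Union>n. comb n)"

definition closed_span :: "('c \<Rightarrow> 'u) set" where
  "closed_span = {f \<in> tuples. \<forall>\<epsilon>>0. \<exists>g\<in>combs. close \<epsilon> f g}"

lemma vs: "c \<in> C \<Longrightarrow> cvs (X c)"
  by (rule os_cvs[OF X])

lemma tuples_closed:
  "fzero \<in> tuples" "f \<in> tuples \<Longrightarrow> g \<in> tuples \<Longrightarrow> fadd f g \<in> tuples" "f \<in> tuples \<Longrightarrow> fsmult a f \<in> tuples"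
  "i \<in> I \<Longrightarrow> gen i \<in> tuples"
  by (auto simp: fzero_def fadd_def fsmult_def gen_def PiE_iff x vs cvs_closed)

lemma combs_zero: "fzero \<in> combs"
  unfolding combs_def by (rule UN_I[of 0]) auto

lemma combs_step: "f \<in> combs \<Longrightarrow> i \<in> I \<Longrightarrow> fadd f (fsmult a (gen i)) \<in> combs"
  unfolding combs_def
proof (elim UN_E)
  fix n assume "f \<in> comb n" "i \<in> I"
  then show "fadd f (fsmult a (gen i)) \<in> (\<Union>n. comb n)"
    by (intro UN_I[of "Suc n"]) (auto intro!: image_eqI[of _ _ "(f, a, i)"])
qed

lemma combs_induct [consumes 1, case_names zero step]:
  assumes "f \<in> combs" "P fzero"
    and "\<And>f a i. f \<in> combs \<Longrightarrow> i \<in> I \<Longrightarrow> P f \<Longrightarrow> P (fadd f (fsmult a (gen i)))"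
  shows "P f"
proof -
  have "P f" if "f \<in> comb n" for n f
    using that
  proof (induction n arbitrary: f)
    case (Suc n)
    then obtain g a i where "f = fadd g (fsmult a (gen i))" "g \<in> comb n" "i \<in> I" by auto
    then show ?case using Suc.IH[of g] assms(3)[of g i a] by (auto simp: combs_def)
  qed (use assms in simp)
  then show ?thesis using assms(1) by (auto simp: combs_def)
qed

lemma combs_tuples: "f \<in> combs \<Longrightarrow> f \<in> tuples"
  by (induction rule: combs_induct) (simp_all only: tuples_closed)

lemma tuples_mem: "f \<in> tuples \<Longrightarrow> c \<in> C \<Longrightarrow> f c \<in> carrier (X c)"
  by auto

lemma tuples_ext: "f \<in> tuples \<Longrightarrow> g \<in> tuples \<Longrightarrow> (\<And>c. c \<in> C \<Longrightarrow> f c = g c) \<Longrightarrow> f = g"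
  by (rule PiE_ext)

lemma combs_add:
  assumes "f \<in> combs" "g \<in> combs" shows "fadd f g \<in> combs"
  using assms(2,1)
proof (induction g rule: combs_induct)
  case zero
  then have "fadd f fzero = f"
    by (intro tuples_ext tuples_closed combs_tuples)
      (auto simp: fadd_def fzero_def cvs_r_zero vs tuples_mem dest!: combs_tuples)
  with zero show ?case by simp
next
  case (step g a i)
  have "fadd f (fadd g (fsmult a (gen i))) = fadd (fadd f g) (fsmult a (gen i))"
    using step.hyps step.prems
    by (intro tuples_ext tuples_closed combs_tuples)
      (auto simp: fadd_def fsmult_def gen_def cvs_assoc cvs_smult x vs tuples_mem dest!: combs_tuples)
  then show ?case using combs_step step by simp
qed

lemma combs_smult: "f \<in> combs \<Longrightarrow> fsmult a f \<in> combs"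
proof (induction f rule: combs_induct)
  case zero
  have "fsmult a fzero = fzero"
    by (intro tuples_ext tuples_closed) (auto simp: fsmult_def fzero_def cvs_smult_zero vs)
  then show ?case using combs_zero by simp
next
  case (step g b i)
  have "fsmult a (fadd g (fsmult b (gen i))) = fadd (fsmult a g) (fsmult (a * b) (gen i))"
    using step.hyps
    by (intro tuples_ext tuples_closed combs_tuples)
      (auto simp: fadd_def fsmult_def gen_def cvs_smult_add cvs_smult_smult cvs_smult x vs tuples_mem dest!: combs_tuples)
  then show ?case using combs_step step by simp
qed

lemma combs_gen:
  assumes "i \<in> I" shows "gen i \<in> combs"
proof -
  have "gen i = fadd fzero (fsmult 1 (gen i))"
    using assms
    by (intro tuples_ext tuples_closed) (auto simp: fadd_def fsmult_def fzero_def gen_def cvs_l_zero cvs_one x vs)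
  then show ?thesis using combs_step[OF combs_zero assms, of 1] by simp
qed

text \<open>The generators are bounded uniformly in \<open>c\<close>, hence so are their finite
  combinations. Ultimately this makes the suprema that define the norms finite.\<close>

lemma combs_bdd: "f \<in> combs \<Longrightarrow> \<exists>B. \<forall>c\<in>C. nrm (X c) (f c) \<le> B"
proof (induction f rule: combs_induct)
  case zero
  then show ?case by (intro exI[of _ 0]) (auto simp: fzero_def nrm_zero X)
next
  case (step f a i)
  then obtain B B' where B: "\<And>c. c \<in> C \<Longrightarrow> nrm (X c) (f c) \<le> B" "\<And>c. c \<in> C \<Longrightarrow> nrm (X c) (x c i) \<le> B'"
    using bdd by blast
  show ?case
  proof (intro exI ballI)
    fix c assume c: "c \<in> C"
    have f: "f c \<in> carrier (X c)" using combs_tuples[OF step(1)] c by auto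
    have xi: "x c i \<in> carrier (X c)" using x c step by auto
    have "nrm (X c) (f c \<oplus>\<^bsub>X c\<^esub> a \<odot>\<^bsub>X c\<^esub> x c i) \<le> nrm (X c) (f c) + nrm (X c) (a \<odot>\<^bsub>X c\<^esub> x c i)"
      using f xi c by (intro nrm_add X cvs_smult vs)
    also have "\<dots> \<le> B + cmod a * B'"
      using B c X xi by (simp add: nrm_smult add_mono mult_left_mono)
    finally show "nrm (X c) (fadd f (fsmult a (gen i)) c) \<le> B + cmod a * B'"
      using c by (simp add: fadd_def fsmult_def gen_def)
  qed
qed

lemma close_refl: "f \<in> tuples \<Longrightarrow> 0 \<le> \<epsilon> \<Longrightarrow> close \<epsilon> f f"
  using X vs by (auto simp: close_def cvs_minus_eq_zero[THEN iffD2] nrm_zero PiE_iff)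

lemma combs_subset: "combs \<subseteq> closed_span"
proof
  fix f assume f: "f \<in> combs"
  then have "close \<epsilon> f f" if "\<epsilon> > 0" for \<epsilon>
    using that by (intro close_refl combs_tuples) auto
  with f show "f \<in> closed_span"
    unfolding closed_span_def using combs_tuples by blast
qed

lemma closed_span_tuples: "f \<in> closed_span \<Longrightarrow> f \<in> tuples"
  by (simp add: closed_span_def)

lemma closed_spanE:
  assumes "f \<in> closed_span" "\<epsilon> > 0"
  obtains g where "g \<in> combs" "close \<epsilon> f g"
  using assms by (auto simp: closed_span_def)

lemma close_trans:
  assumes "close \<delta> f g" "close \<epsilon> g h" "f \<in> tuples" "g \<in> tuples" "h \<in> tuples"
  shows "close (\<delta> + \<epsilon>) f h"
  unfolding close_def
proof
  fix c assume c: "c \<in> C"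
  then have "f c \<in> carrier (X c)" "g c \<in> carrier (X c)" "h c \<in> carrier (X c)" using assms by auto
  from nrm_minus_triangle[OF X[OF c] this] show "nrm (X c) (f c \<ominus>\<^bsub>X c\<^esub> h c) \<le> \<delta> + \<epsilon>"
    using assms(1,2) c unfolding close_def by fastforce
qed

lemma close_sym: "close \<epsilon> f g \<Longrightarrow> f \<in> tuples \<Longrightarrow> g \<in> tuples \<Longrightarrow> close \<epsilon> g f"
  unfolding close_def using X nrm_minus_commute by (fastforce simp: PiE_iff)

text \<open>Taking the closure is idempotent, by halving \<open>\<epsilon>\<close>. Later membership
  proofs may therefore approximate by elements of \<open>closed_span\<close> instead of
  \<open>combs\<close>.\<close>

lemma closed_span_closed:
  assumes "f \<in> tuples" "\<And>\<epsilon>. \<epsilon> > 0 \<Longrightarrow> \<exists>g\<in>closed_span. close \<epsilon> f g"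
  shows "f \<in> closed_span"
  unfolding closed_span_def
proof (intro CollectI conjI allI impI assms(1))
  fix \<epsilon> :: real assume "\<epsilon> > 0"
  then have e: "\<epsilon> / 2 > 0" by simp
  from assms(2)[OF this] obtain g where g: "g \<in> closed_span" "close (\<epsilon> / 2) f g" by blast
  from closed_spanE[OF g(1) e] obtain h where h: "h \<in> combs" "close (\<epsilon> / 2) g h" .
  from close_trans[OF g(2) h(2) assms(1) closed_span_tuples[OF g(1)] combs_tuples[OF h(1)]]
  show "\<exists>g\<in>combs. close \<epsilon> f g" using h(1) by auto
qed

lemma closed_span_add:
  assumes f: "f \<in> closed_span" and g: "g \<in> closed_span"
  shows "fadd f g \<in> closed_span"
proof (rule closed_span_closed)
  fix \<epsilon> :: real assume "\<epsilon> > 0"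
  then have e: "\<epsilon> / 2 > 0" by simp
  obtain f' g' where *: "f' \<in> combs" "close (\<epsilon> / 2) f f'" "g' \<in> combs" "close (\<epsilon> / 2) g g'"
    using closed_spanE[OF f e] closed_spanE[OF g e] by metis
  have "close \<epsilon> (fadd f g) (fadd f' g')"
    unfolding close_def
  proof
    fix c assume c: "c \<in> C"
    then have mem: "f c \<in> carrier (X c)" "g c \<in> carrier (X c)" "f' c \<in> carrier (X c)" "g' c \<in> carrier (X c)"
      using f g * by (auto dest!: closed_span_tuples combs_tuples)
    have "nrm (X c) ((f c \<oplus>\<^bsub>X c\<^esub> g c) \<ominus>\<^bsub>X c\<^esub> (f' c \<oplus>\<^bsub>X c\<^esub> g' c)) \<le>
        nrm (X c) (f c \<ominus>\<^bsub>X c\<^esub> f' c) + nrm (X c) (g c \<ominus>\<^bsub>X c\<^esub> g' c)"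
      using mem c by (simp add: cvs_add_minus_add vs cvs_minus nrm_add X)
    also have "\<dots> \<le> \<epsilon> / 2 + \<epsilon> / 2" using * c by (intro add_mono) (auto simp: close_def)
    finally show "nrm (X c) (fadd f g c \<ominus>\<^bsub>X c\<^esub> fadd f' g' c) \<le> \<epsilon>" using c by (simp add: fadd_def)
  qed
  then show "\<exists>h\<in>closed_span. close \<epsilon> (fadd f g) h"
    using combs_add[OF *(1,3)] combs_subset by blast
qed (use f g in \<open>intro tuples_closed closed_span_tuples\<close>)

lemma closed_span_smult:
  assumes f: "f \<in> closed_span"
  shows "fsmult a f \<in> closed_span"
proof (rule closed_span_closed)
  fix \<epsilon> :: real assume e: "\<epsilon> > 0"
  \<comment> \<open>The added 1 keeps the denominator positive when \<open>a\<close> is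
    zero.\<close>
  then have "\<epsilon> / (1 + cmod a) > 0" by (simp add: add_pos_nonneg)
  from closed_spanE[OF f this] obtain g where g: "g \<in> combs" "close (\<epsilon> / (1 + cmod a)) f g" .
  have "close \<epsilon> (fsmult a f) (fsmult a g)"
    unfolding close_def
  proof
    fix c assume c: "c \<in> C"
    then have mem: "f c \<in> carrier (X c)" "g c \<in> carrier (X c)"
      using f g by (auto dest!: closed_span_tuples combs_tuples)
    have "nrm (X c) (a \<odot>\<^bsub>X c\<^esub> f c \<ominus>\<^bsub>X c\<^esub> a \<odot>\<^bsub>X c\<^esub> g c) = cmod a * nrm (X c) (f c \<ominus>\<^bsub>X c\<^esub> g c)"
      using mem c by (simp add: cvs_minus_smult vs cvs_minus nrm_smult X)
    also have "\<dots> \<le> cmod a * (\<epsilon> / (1 + cmod a))"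
      using g c by (intro mult_left_mono) (auto simp: close_def)
    also have "\<dots> \<le> \<epsilon>" using e by (simp add: field_simps add_pos_nonneg)
    finally show "nrm (X c) (fsmult a f c \<ominus>\<^bsub>X c\<^esub> fsmult a g c) \<le> \<epsilon>" using c by (simp add: fsmult_def)
  qed
  then show "\<exists>h\<in>closed_span. close \<epsilon> (fsmult a f) h"
    using combs_smult[OF g(1)] combs_subset by blast
qed (use f in \<open>intro tuples_closed closed_span_tuples\<close>)

lemma closed_span_bdd:
  assumes "f \<in> closed_span"
  shows "\<exists>B. \<forall>c\<in>C. nrm (X c) (f c) \<le> B"
proof -
  from closed_spanE[OF assms, of 1] obtain g where g: "g \<in> combs" "close 1 f g" by auto
  then obtain B where B: "\<And>c. c \<in> C \<Longrightarrow> nrm (X c) (g c) \<le> B" using combs_bdd by blast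
  show ?thesis
  proof (intro exI ballI)
    fix c assume c: "c \<in> C"
    then have "f c \<in> carrier (X c)" "g c \<in> carrier (X c)"
      using assms g by (auto dest!: closed_span_tuples combs_tuples)
    from nrm_le_minus[OF X[OF c] this] show "nrm (X c) (f c) \<le> 1 + B"
      using g(2) B[OF c] c unfolding close_def by fastforce
  qed
qed

text \<open>A chosen sequence of combinations at distances at most 1/(n+1) determines the element,
  so \<open>closed_span\<close> injects into the sequences in \<open>combs\<close>. The closure of
  \<kappa> under countable powers enters through \<open>small_sequences\<close>.\<close>

lemma small_closed_span:
  fixes \<kappa> :: "'k rel"
  assumes U: "universe \<kappa>" and I: "|I| <o \<kappa>"
  shows "|closed_span| <o \<kappa>"
proof -
  have "|comb n| <o \<kappa>" for n
  proof (induction n)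
    case (Suc n)
    have "|comb n \<times> (UNIV :: complex set) \<times> I| <o \<kappa>"
      by (rule small_Sigma[OF U Suc.IH small_Sigma[OF U small_complex[OF U] I]])
    then show ?case
      unfolding comb.simps by (rule small_image[OF U])
  qed (simp add: small_finite[OF U])
  then have "|combs| <o \<kappa>"
    unfolding combs_def by (intro small_UN[OF U] small_nat[OF U])
  then have seqs: "|{s :: nat \<Rightarrow> _. range s \<subseteq> combs}| <o \<kappa>" by (rule small_sequences[OF U])
  have "\<exists>g. g \<in> combs \<and> close (1 / Suc n) f g" if "f \<in> closed_span" for f n
    using closed_spanE[OF that, of "1 / Suc n"] by auto
  note * = someI_ex[OF this]
  define s where "s f n = (SOME g. g \<in> combs \<and> close (1 / Suc n) f g)" for f n
  have s: "s f n \<in> combs" "close (1 / Suc n) f (s f n)" if "f \<in> closed_span" for f n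
    unfolding s_def using *[OF that, of n] by auto
  have "inj_on s closed_span"
  proof (rule inj_onI)
    fix f g assume fg: "f \<in> closed_span" "g \<in> closed_span" "s f = s g"
    note t = closed_span_tuples[OF fg(1)] closed_span_tuples[OF fg(2)]
    show "f = g"
    proof (rule tuples_ext[OF t])
      fix c assume c: "c \<in> C"
      then have mem: "f c \<in> carrier (X c)" "g c \<in> carrier (X c)" using t by auto
      have "nrm (X c) (f c \<ominus>\<^bsub>X c\<^esub> g c) \<le> 2 / Suc n" for n
      proof -
        \<comment> \<open>Both elements share the n-th approximation, so they differ by at most
          twice its error.\<close>
        have "close (1 / Suc n + 1 / Suc n) f g"
          using s[OF fg(1), of n] s[OF fg(2), of n] fg(3)
          by (intro close_trans[of _ _ "s f n"] close_sym[of _ g] t combs_tuples) simp_all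
        then show ?thesis using c by (simp add: close_def)
      qed
      moreover have "(\<lambda>n. 2 / Suc n) \<longlonglongrightarrow> 0"
        using tendsto_mult_right_zero[OF LIMSEQ_inverse_real_of_nat, of 2] by (simp add: divide_inverse)
      ultimately have "nrm (X c) (f c \<ominus>\<^bsub>X c\<^esub> g c) \<le> 0"
        by (intro LIMSEQ_le_const[of "\<lambda>n. 2 / Suc n"]) auto
      then show "f c = g c"
        using nrm_nonneg[OF X[OF c], of "f c \<ominus>\<^bsub>X c\<^esub> g c"] nrm_zero_iff[OF X[OF c], of "f c \<ominus>\<^bsub>X c\<^esub> g c"]
          mem c by (simp add: cvs_minus vs cvs_minus_eq_zero)
    qed
  qed
  then show ?thesis
    by (rule small_inj[OF U _ _ seqs]) (use s(1) in auto)
qed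

end

section \<open>The closed span as an operator space\<close>

locale encoded_family = bounded_family C X I x
  for C :: "'c set" and X :: "'c \<Rightarrow> 'u opspace" and I :: "'i set" and x :: "'c \<Rightarrow> 'i \<Rightarrow> 'u" +
  fixes enc :: "('c \<Rightarrow> 'u) \<Rightarrow> 'u"
  assumes inj_enc: "inj_on enc closed_span"
begin

text \<open>Carriers must consist of elements of \<open>'u\<close>, so the tuples in
  \<open>closed_span\<close> are represented by codes, and every operation decodes first.\<close>

definition dec :: "'u \<Rightarrow> 'c \<Rightarrow> 'u" where "dec = inv_into closed_span enc"

abbreviation proj :: "'c \<Rightarrow> 'u \<Rightarrow> 'u" where "proj c a \<equiv> dec a c"

text \<open>The \<open>0\<close> in the supremum only matters if \<open>C\<close> is empty.\<close>

definition free_space :: "'u opspace" where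
  "free_space = \<lparr>carrier = enc ` closed_span, mult = undefined, one = undefined,
     zero = enc fzero, add = (\<lambda>a b. enc (fadd (dec a) (dec b))), smult = (\<lambda>k a. enc (fsmult k (dec a))),
     mnorm = (\<lambda>n y. Sup (insert 0 ((\<lambda>c. mnorm (X c) n (map_mat (proj c) y)) ` C)))\<rparr>"

lemma dec_enc: "f \<in> closed_span \<Longrightarrow> dec (enc f) = f"
  unfolding dec_def by (rule inv_into_f_f[OF inj_enc])

lemma free_space_carrier: "a \<in> carrier free_space \<longleftrightarrow> (\<exists>f\<in>closed_span. a = enc f)"
  by (auto simp: free_space_def)

lemma dec_closed: "a \<in> carrier free_space \<Longrightarrow> dec a \<in> closed_span"
  by (auto simp: free_space_carrier dec_enc)

lemma proj_closed: "a \<in> carrier free_space \<Longrightarrow> c \<in> C \<Longrightarrow> proj c a \<in> carrier (X c)"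
  using dec_closed closed_span_tuples tuples_mem by blast

lemma fzero_closed_span: "fzero \<in> closed_span"
  using combs_zero combs_subset by blast

lemma dec_ops:
  "dec \<zero>\<^bsub>free_space\<^esub> = fzero"
  "a \<in> carrier free_space \<Longrightarrow> b \<in> carrier free_space \<Longrightarrow> dec (a \<oplus>\<^bsub>free_space\<^esub> b) = fadd (dec a) (dec b)"
  "a \<in> carrier free_space \<Longrightarrow> dec (k \<odot>\<^bsub>free_space\<^esub> a) = fsmult k (dec a)"
  using closed_span_add closed_span_smult dec_closed fzero_closed_span
  by (simp_all add: free_space_def dec_enc)

lemma free_space_eqI:
  assumes "a \<in> carrier free_space" "b \<in> carrier free_space" "\<And>c. c \<in> C \<Longrightarrow> proj c a = proj c b"
  shows "a = b"
proof -
  have "dec a = dec b"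
    using assms by (intro tuples_ext closed_span_tuples dec_closed)
  then show ?thesis using assms(1,2) by (auto simp: free_space_carrier dec_enc)
qed

lemma cvs_free_space: "cvs free_space"
proof (rule cvs_separated[where C = C and X = X and \<pi> = proj])
  show "\<zero>\<^bsub>free_space\<^esub> \<in> carrier free_space"
    using fzero_closed_span by (simp add: free_space_def)
  show "a \<oplus>\<^bsub>free_space\<^esub> b \<in> carrier free_space" if "a \<in> carrier free_space" "b \<in> carrier free_space" for a b
    using that[THEN dec_closed] closed_span_add by (simp add: free_space_def)
  show "k \<odot>\<^bsub>free_space\<^esub> a \<in> carrier free_space" if "a \<in> carrier free_space" for a k
    using that[THEN dec_closed] closed_span_smult by (simp add: free_space_def)
qed (auto simp: vs proj_closed dec_ops fzero_def fadd_def fsmult_def intro: free_space_eqI)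

lemma clinear_proj: "c \<in> C \<Longrightarrow> clinear free_space (X c) (proj c)"
  unfolding clinear_iff using cvs_free_space vs proj_closed
  by (auto simp: dec_ops fadd_def fsmult_def)

lemma mnorm_free_space:
  assumes n: "1 \<le> n" and y: "y \<in> Mats n free_space"
  shows mnorm_free_nonneg: "0 \<le> mnorm free_space n y"
    and mnorm_free_upper: "c \<in> C \<Longrightarrow> mnorm (X c) n (map_mat (proj c) y) \<le> mnorm free_space n y"
    and mnorm_free_least: "0 \<le> B \<Longrightarrow> (\<And>c. c \<in> C \<Longrightarrow> mnorm (X c) n (map_mat (proj c) y) \<le> B) \<Longrightarrow>
      mnorm free_space n y \<le> B"
proof -
  let ?S = "insert 0 ((\<lambda>c. mnorm (X c) n (map_mat (proj c) y)) ` C)"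
  have ent: "y $$ ij \<in> carrier free_space" if "ij \<in> {..<n} \<times> {..<n}" for ij
    using y that by (auto simp: Mats_iff)
  \<comment> \<open>Each entry is bounded over all coordinates; by \<open>mnorm_le_sum\<close> the
    matrix norms then have a bound independent of \<open>c\<close>, so their supremum is a genuine
    one.\<close>
  have "\<exists>B. \<forall>c\<in>C. nrm (X c) (proj c (y $$ ij)) \<le> B" if "ij \<in> {..<n} \<times> {..<n}" for ij
    using closed_span_bdd[OF dec_closed[OF ent[OF that]]] .
  then obtain B where B: "\<And>ij c. ij \<in> {..<n} \<times> {..<n} \<Longrightarrow> c \<in> C \<Longrightarrow> nrm (X c) (proj c (y $$ ij)) \<le> B ij"
    by metis
  have "mnorm (X c) n (map_mat (proj c) y) \<le> (\<Sum>ij\<in>{..<n} \<times> {..<n}. B ij)" if c: "c \<in> C" for c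
  proof -
    have "mnorm (X c) n (map_mat (proj c) y) \<le> (\<Sum>ij\<in>{..<n} \<times> {..<n}. nrm (X c) (map_mat (proj c) y $$ ij))"
      by (rule mnorm_le_sum[OF X[OF c] n Mats_map[OF clinear_proj[OF c] y]])
    also have "\<dots> \<le> (\<Sum>ij\<in>{..<n} \<times> {..<n}. B ij)"
    proof (rule sum_mono)
      fix ij assume ij: "ij \<in> {..<n} \<times> {..<n}"
      then have "map_mat (proj c) y $$ ij = proj c (y $$ ij)" using y by (auto simp: Mats_iff)
      then show "nrm (X c) (map_mat (proj c) y $$ ij) \<le> B ij" using B[OF ij c] by simp
    qed
    finally show ?thesis .
  qed
  then have bdd: "bdd_above ?S"
    by (intro bdd_above_insert[THEN iffD2] bdd_aboveI2)
  have eq: "mnorm free_space n y = Sup ?S" by (simp add: free_space_def)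
  show "0 \<le> mnorm free_space n y"
    unfolding eq by (rule cSup_upper[OF _ bdd]) simp
  show "mnorm (X c) n (map_mat (proj c) y) \<le> mnorm free_space n y" if "c \<in> C"
    unfolding eq by (rule cSup_upper[OF _ bdd]) (use that in simp)
  show "mnorm free_space n y \<le> B" if "0 \<le> B" "\<And>c. c \<in> C \<Longrightarrow> mnorm (X c) n (map_mat (proj c) y) \<le> B" for B
    unfolding eq by (rule cSup_least) (use that in auto)
qed

lemma nrm_free:
  assumes a: "a \<in> carrier free_space"
  shows nrm_free_upper: "c \<in> C \<Longrightarrow> nrm (X c) (proj c a) \<le> nrm free_space a"
    and nrm_free_least: "0 \<le> B \<Longrightarrow> (\<And>c. c \<in> C \<Longrightarrow> nrm (X c) (proj c a) \<le> B) \<Longrightarrow> nrm free_space a \<le> B"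
    and nrm_free_nonneg: "0 \<le> nrm free_space a"
  using mnorm_free_space[of 1 "mat 1 1 (\<lambda>_. a)"] a
  by (auto simp: nrm_def Mats_iff single_map simp del: One_nat_def)

lemma proj_minus: "a \<in> carrier free_space \<Longrightarrow> b \<in> carrier free_space \<Longrightarrow> c \<in> C \<Longrightarrow>
    proj c (a \<ominus>\<^bsub>free_space\<^esub> b) = proj c a \<ominus>\<^bsub>X c\<^esub> proj c b"
  by (rule clinear_minus[OF clinear_proj])

lemma nrm_free_le_close:
  assumes "a \<in> carrier free_space" "b \<in> carrier free_space" "close \<epsilon> (dec a) (dec b)" "0 \<le> \<epsilon>"
  shows "nrm free_space (a \<ominus>\<^bsub>free_space\<^esub> b) \<le> \<epsilon>"
  using assms cvs_free_space
  by (intro nrm_free_least cvs_minus) (auto simp: proj_minus close_def)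

text \<open>A Cauchy sequence converges in every coordinate with an error controlled uniformly in
  the coordinate; hence the tuple of the limits stays in the closed span and is the limit in
  norm.\<close>

lemma free_space_complete:
  assumes \<sigma>: "range \<sigma> \<subseteq> carrier free_space"
    and cauchy: "\<And>\<epsilon>. \<epsilon> > 0 \<Longrightarrow> \<exists>K. \<forall>p\<ge>K. \<forall>q\<ge>K. nrm free_space (\<sigma> p \<ominus>\<^bsub>free_space\<^esub> \<sigma> q) < \<epsilon>"
  shows "\<exists>a\<in>carrier free_space. (\<lambda>p. nrm free_space (\<sigma> p \<ominus>\<^bsub>free_space\<^esub> a)) \<longlonglongrightarrow> 0"
proof -
  have \<sigma>: "\<sigma> p \<in> carrier free_space" for p using \<sigma> by auto
  have le: "nrm (X c) (proj c (\<sigma> p) \<ominus>\<^bsub>X c\<^esub> proj c (\<sigma> q)) \<le> nrm free_space (\<sigma> p \<ominus>\<^bsub>free_space\<^esub> \<sigma> q)"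
    if "c \<in> C" for c p q
    using nrm_free_upper[of "\<sigma> p \<ominus>\<^bsub>free_space\<^esub> \<sigma> q" c] that \<sigma> cvs_free_space
    by (simp add: proj_minus cvs_minus)
  have "\<exists>l\<in>carrier (X c). (\<lambda>p. nrm (X c) (proj c (\<sigma> p) \<ominus>\<^bsub>X c\<^esub> l)) \<longlonglongrightarrow> 0" if c: "c \<in> C" for c
  proof (rule os_complete[OF X[OF c]])
    show "range (\<lambda>p. proj c (\<sigma> p)) \<subseteq> carrier (X c)" using \<sigma> c proj_closed by auto
    show "\<exists>K. \<forall>p\<ge>K. \<forall>q\<ge>K. nrm (X c) (proj c (\<sigma> p) \<ominus>\<^bsub>X c\<^esub> proj c (\<sigma> q)) < \<epsilon>" if "\<epsilon> > 0" for \<epsilon>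
      using cauchy[OF that] le[OF c] le_less_trans by meson
  qed blast
  then obtain l where l: "\<And>c. c \<in> C \<Longrightarrow> l c \<in> carrier (X c)"
      "\<And>c. c \<in> C \<Longrightarrow> (\<lambda>p. nrm (X c) (proj c (\<sigma> p) \<ominus>\<^bsub>X c\<^esub> l c)) \<longlonglongrightarrow> 0"
    by metis
  define f where "f = restrict l C"
  have f: "f \<in> tuples" using l by (auto simp: f_def)
  have close: "\<exists>K. \<forall>p\<ge>K. close \<epsilon> (dec (\<sigma> p)) f" if "\<epsilon> > 0" for \<epsilon>
  proof -
    obtain K where K: "\<And>p q. p \<ge> K \<Longrightarrow> q \<ge> K \<Longrightarrow> nrm free_space (\<sigma> p \<ominus>\<^bsub>free_space\<^esub> \<sigma> q) < \<epsilon>"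
      using cauchy[OF \<open>\<epsilon> > 0\<close>] by blast
    have "nrm (X c) (proj c (\<sigma> p) \<ominus>\<^bsub>X c\<^esub> l c) \<le> \<epsilon>" if c: "c \<in> C" and p: "p \<ge> K" for c p
    proof -
      \<comment> \<open>Letting \<open>q\<close> tend to infinity in the triangle inequality leaves
        the uniform bound \<open>\<epsilon>\<close>.\<close>
      have "(\<lambda>q. \<epsilon> + nrm (X c) (proj c (\<sigma> q) \<ominus>\<^bsub>X c\<^esub> l c)) \<longlonglongrightarrow> \<epsilon> + 0"
        by (intro tendsto_add tendsto_const l c)
      moreover have "nrm (X c) (proj c (\<sigma> p) \<ominus>\<^bsub>X c\<^esub> l c) \<le> \<epsilon> + nrm (X c) (proj c (\<sigma> q) \<ominus>\<^bsub>X c\<^esub> l c)"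
        if "q \<ge> K" for q
        using nrm_minus_triangle[OF X[OF c] proj_closed[OF \<sigma> c] proj_closed[OF \<sigma> c] l(1)[OF c], of p q]
          le[OF c, of p q] K[OF p that] by linarith
      ultimately show ?thesis
        using LIMSEQ_le_const[of _ "\<epsilon> + 0"] by (metis (no_types, lifting) add.right_neutral)
    qed
    then show ?thesis by (auto simp: close_def f_def)
  qed
  have "f \<in> closed_span"
  proof (rule closed_span_closed[OF f])
    fix \<epsilon> :: real assume "\<epsilon> > 0"
    then obtain K where "close \<epsilon> (dec (\<sigma> K)) f" using close by blast
    then show "\<exists>g\<in>closed_span. close \<epsilon> f g"
      using \<sigma> dec_closed closed_span_tuples f close_sym by blast
  qed
  then have ef: "enc f \<in> carrier free_space" "dec (enc f) = f"
    by (auto simp: free_space_carrier dec_enc)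
  show ?thesis
  proof (intro bexI[OF _ ef(1)] LIMSEQ_I)
    fix r :: real assume "r > 0"
    then obtain K where K: "\<And>p. p \<ge> K \<Longrightarrow> close (r / 2) (dec (\<sigma> p)) f" using close[of "r / 2"] by auto
    have "norm (nrm free_space (\<sigma> p \<ominus>\<^bsub>free_space\<^esub> enc f) - 0) < r" if "p \<ge> K" for p
      using nrm_free_le_close[OF \<sigma> ef(1), of "r / 2" p] nrm_free_nonneg[of "\<sigma> p \<ominus>\<^bsub>free_space\<^esub> enc f"]
        K[OF that] ef \<sigma> \<open>r > 0\<close> cvs_free_space
      by (simp add: cvs_minus)
    then show "\<exists>no. \<forall>p\<ge>no. norm (nrm free_space (\<sigma> p \<ominus>\<^bsub>free_space\<^esub> enc f) - 0) < r" by blast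
  qed
qed

lemma operator_space_free: "operator_space free_space"
proof (rule operator_space_sup[where C = C and X = X and \<pi> = proj, OF cvs_free_space X clinear_proj])
  fix y assume y: "y \<in> carrier free_space" "\<And>c. c \<in> C \<Longrightarrow> proj c y = \<zero>\<^bsub>X c\<^esub>"
  then show "y = \<zero>\<^bsub>free_space\<^esub>"
    by - (rule free_space_eqI, auto simp: dec_ops fzero_def cvs_free_space cvs_zero)
next
  fix \<sigma> :: "nat \<Rightarrow> 'u"
  assume "range \<sigma> \<subseteq> carrier free_space"
    "\<And>\<epsilon>. \<epsilon> > 0 \<Longrightarrow> \<exists>K. \<forall>p\<ge>K. \<forall>q\<ge>K. nrm free_space (\<sigma> p \<ominus>\<^bsub>free_space\<^esub> \<sigma> q) < \<epsilon>"
  then show "\<exists>a\<in>carrier free_space. (\<lambda>p. nrm free_space (\<sigma> p \<ominus>\<^bsub>free_space\<^esub> a)) \<longlonglongrightarrow> 0"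
    by (rule free_space_complete)
next
  fix c :: 'c and n :: nat and y and B :: real
  assume ny: "1 \<le> n" "y \<in> Mats n free_space"
  then show "0 \<le> mnorm free_space n y" by (rule mnorm_free_nonneg)
  show "mnorm (X c) n (map_mat (proj c) y) \<le> mnorm free_space n y" if "c \<in> C"
    using ny that by (rule mnorm_free_upper)
  show "mnorm free_space n y \<le> B"
    if "0 \<le> B" "\<And>c. c \<in> C \<Longrightarrow> mnorm (X c) n (map_mat (proj c) y) \<le> B"
    using ny that by (rule mnorm_free_least)
qed

lemma enc_gen: "i \<in> I \<Longrightarrow> enc (gen i) \<in> carrier free_space" "i \<in> I \<Longrightarrow> c \<in> C \<Longrightarrow> proj c (enc (gen i)) = x c i"
  using combs_gen combs_subset by (auto simp: free_space_carrier dec_enc gen_def subset_eq)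

text \<open>The maps agree on combinations by linearity, and combinations are dense, so two
  contractions that agree on them are equal.\<close>

lemma free_space_unique:
  fixes Y :: "'v opspace"
  assumes Y: "operator_space Y"
    and f: "clinear free_space Y f" "complete_contraction free_space Y f"
    and g: "clinear free_space Y g" "complete_contraction free_space Y g"
    and eq: "\<And>i. i \<in> I \<Longrightarrow> f (enc (gen i)) = g (enc (gen i))"
    and a: "a \<in> carrier free_space"
  shows "f a = g a"
proof -
  have enc: "enc h \<in> carrier free_space" if "h \<in> combs" for h
    using that combs_subset by (auto simp: free_space_carrier)
  have combs: "f (enc h) = g (enc h)" if "h \<in> combs" for h
    using that
  proof (induction h rule: combs_induct)
    case zero
    have "enc fzero = \<zero>\<^bsub>free_space\<^esub>" by (simp add: free_space_def)
    then show ?case using f g by (simp add: clinear_zero)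
  next
    case (step h k i)
    have "enc (fadd h (fsmult k (gen i))) = enc h \<oplus>\<^bsub>free_space\<^esub> k \<odot>\<^bsub>free_space\<^esub> enc (gen i)"
      using step.hyps combs_gen combs_subset combs_smult by (simp add: free_space_def dec_enc subset_eq)
    then show ?case
      using step enc f g eq enc_gen(1) cvs_free_space by (simp add: clinear_add clinear_smult cvs_smult)
  qed
  have fa: "f a \<in> carrier Y" and ga: "g a \<in> carrier Y" using f g a by (auto simp: clinear_closed)
  \<comment> \<open>Each of the two contractions contributes \<open>e / 2\<close> when
    \<open>a\<close> is replaced by a nearby combination.\<close>
  have "nrm Y (f a \<ominus>\<^bsub>Y\<^esub> g a) \<le> 0 + e" if "e > 0" for e
  proof -
    have "e / 2 > 0" using that by simp
    from closed_spanE[OF dec_closed[OF a] this] obtain h where h: "h \<in> combs" "close (e / 2) (dec a) h" .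
    have "nrm free_space (a \<ominus>\<^bsub>free_space\<^esub> enc h) \<le> e / 2"
      using h a that combs_subset by (intro nrm_free_le_close enc) (auto simp: dec_enc)
    then have "nrm Y (u a \<ominus>\<^bsub>Y\<^esub> u (enc h)) \<le> e / 2"
      if "clinear free_space Y u" "complete_contraction free_space Y u" for u
      using cc_nrm[OF that(2), of "a \<ominus>\<^bsub>free_space\<^esub> enc h"] that(1) a enc[OF h(1)] cvs_free_space
      by (simp add: cvs_minus clinear_minus)
    from this[OF f] this[OF g]
    have "nrm Y (f a \<ominus>\<^bsub>Y\<^esub> f (enc h)) \<le> e / 2" "nrm Y (f (enc h) \<ominus>\<^bsub>Y\<^esub> g a) \<le> e / 2"
      using combs[OF h(1)] nrm_minus_commute[OF Y ga, of "f (enc h)"] f(1) g(1) enc[OF h(1)]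
      by (auto simp: clinear_closed)
    then show ?thesis
      using nrm_minus_triangle[OF Y fa clinear_closed[OF f(1) enc[OF h(1)]] ga] by linarith
  qed
  then have "nrm Y (f a \<ominus>\<^bsub>Y\<^esub> g a) \<le> 0" by (rule field_le_epsilon)
  then show ?thesis
    using nrm_nonneg[OF Y, of "f a \<ominus>\<^bsub>Y\<^esub> g a"] nrm_zero_iff[OF Y, of "f a \<ominus>\<^bsub>Y\<^esub> g a"] fa ga os_cvs[OF Y]
    by (simp add: cvs_minus cvs_minus_eq_zero)
qed

end

text \<open>The properties of the construction that are used later, with the encoding hidden:
  \<open>u c\<close> extends the interpretation \<open>x c\<close>, the norms are the suprema of the
  norms seen through all \<open>u c\<close>, and the topological generation of \<open>L\<close> by
  the \<open>e i\<close> is expressed as uniqueness of complete contractions with given values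
  there.\<close>

definition free_on :: "'c set \<Rightarrow> ('c \<Rightarrow> 'u opspace) \<Rightarrow> 'i set \<Rightarrow> ('c \<Rightarrow> 'i \<Rightarrow> 'u) \<Rightarrow>
    'u opspace \<Rightarrow> ('i \<Rightarrow> 'u) \<Rightarrow> ('c \<Rightarrow> 'u \<Rightarrow> 'u) \<Rightarrow> bool" where
  "free_on C X I x L e u \<longleftrightarrow> operator_space L \<and> (\<forall>i\<in>I. e i \<in> carrier L) \<and>
     (\<forall>c\<in>C. clinear L (X c) (u c) \<and> complete_contraction L (X c) (u c) \<and> (\<forall>i\<in>I. u c (e i) = x c i)) \<and>
     (\<forall>n\<ge>1. \<forall>y\<in>Mats n L. \<forall>B\<ge>0. (\<forall>c\<in>C. mnorm (X c) n (map_mat (u c) y) \<le> B) \<longrightarrow> mnorm L n y \<le> B) \<and>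
     (\<forall>a\<in>carrier L. \<forall>b\<in>carrier L. (\<forall>c\<in>C. u c a = u c b) \<longrightarrow> a = b) \<and>
     (\<forall>(Y :: 'u opspace) f g. operator_space Y \<and> clinear L Y f \<and> complete_contraction L Y f \<and>
        clinear L Y g \<and> complete_contraction L Y g \<and> (\<forall>i\<in>I. f (e i) = g (e i)) \<longrightarrow>
        (\<forall>a\<in>carrier L. f a = g a))"

lemma free_onD:
  assumes "free_on C X I x L e u"
  shows "operator_space L" "\<And>i. i \<in> I \<Longrightarrow> e i \<in> carrier L"
    "\<And>c. c \<in> C \<Longrightarrow> clinear L (X c) (u c)" "\<And>c. c \<in> C \<Longrightarrow> complete_contraction L (X c) (u c)"
    "\<And>c i. c \<in> C \<Longrightarrow> i \<in> I \<Longrightarrow> u c (e i) = x c i"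
  using assms by (simp_all add: free_on_def)

lemma free_on_least:
  assumes "free_on C X I x L e u" "1 \<le> n" "y \<in> Mats n L" "0 \<le> B"
    "\<And>c. c \<in> C \<Longrightarrow> mnorm (X c) n (map_mat (u c) y) \<le> B"
  shows "mnorm L n y \<le> B"
  using assms by (simp add: free_on_def)

lemma free_on_separated:
  assumes "free_on C X I x L e u" "a \<in> carrier L" "b \<in> carrier L" "\<And>c. c \<in> C \<Longrightarrow> u c a = u c b"
  shows "a = b"
  using assms by (simp add: free_on_def)

lemma free_on_unique:
  fixes Y :: "'u opspace"
  assumes "free_on C X I x (L :: 'u opspace) e u" "operator_space Y"
    "clinear L Y f" "complete_contraction L Y f" "clinear L Y g" "complete_contraction L Y g"
    "\<And>i. i \<in> I \<Longrightarrow> f (e i) = g (e i)" "a \<in> carrier L"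
  shows "f a = g a"
  using assms unfolding free_on_def by blast

text \<open>Only the generators are counted; \<open>C\<close> will be the set of all cocones, or of
  all small spaces with a marked matrix.\<close>

lemma ex_free_on:
  fixes \<kappa> :: "'u rel" and C :: "'c set" and X :: "'c \<Rightarrow> 'u opspace" and I :: "'i set"
  assumes U: "universe \<kappa>" and I: "|I| <o \<kappa>"
    and X: "\<And>c. c \<in> C \<Longrightarrow> operator_space (X c)"
    and x: "\<And>c i. c \<in> C \<Longrightarrow> i \<in> I \<Longrightarrow> x c i \<in> carrier (X c)"
    and bdd: "\<And>i. i \<in> I \<Longrightarrow> \<exists>B. \<forall>c\<in>C. nrm (X c) (x c i) \<le> B"
  shows "\<exists>L e u. free_on C X I x L e u \<and> |carrier L| <o \<kappa>"
proof -
  interpret bounded_family C X I x by unfold_locales (fact X x bdd)+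
  obtain enc :: "('c \<Rightarrow> 'u) \<Rightarrow> 'u" where "inj_on enc closed_span"
    using universe_copy[OF U small_closed_span[OF U I]] .
  then interpret encoded_family C X I x enc by unfold_locales
  have "free_on C X I x free_space (\<lambda>i. enc (gen i)) proj"
    unfolding free_on_def
  proof (intro conjI ballI allI impI; (elim conjE)?)
    fix c assume "c \<in> C"
    then show "complete_contraction free_space (X c) (proj c)"
      unfolding complete_contraction_def using mnorm_free_upper by blast
  next
    fix n :: nat and y and B :: real
    assume "1 \<le> n" "y \<in> Mats n free_space" "0 \<le> B"
      "\<forall>c\<in>C. mnorm (X c) n (map_mat (proj c) y) \<le> B"
    then show "mnorm free_space n y \<le> B" by (intro mnorm_free_least) auto
  next
    fix a b assume "a \<in> carrier free_space" "b \<in> carrier free_space" "\<forall>c\<in>C. proj c a = proj c b"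
    then show "a = b" using free_space_eqI by blast
  next
    fix Y :: "'u opspace" and f g a
    assume "operator_space Y" "clinear free_space Y f" "complete_contraction free_space Y f"
      "clinear free_space Y g" "complete_contraction free_space Y g"
      "\<forall>i\<in>I. f (enc (gen i)) = g (enc (gen i))" "a \<in> carrier free_space"
    then show "f a = g a" using free_space_unique by blast
  qed (simp_all add: operator_space_free enc_gen clinear_proj)
  moreover have "|carrier free_space| <o \<kappa>"
    using small_image[OF U small_closed_span[OF U I]] by (simp add: free_space_def)
  ultimately show ?thesis by blast
qed


section \<open>The category of operator spaces\<close>

abbreviation app :: "'o \<times> ('a \<Rightarrow> 'b) \<times> 'p \<Rightarrow> 'a \<Rightarrow> 'b" where "app f \<equiv> fst (snd f)"

lemma Obj_OS: "X \<in> Obj (OS \<kappa>) \<longleftrightarrow> operator_space X \<and> |carrier X| <o \<kappa>"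
  by (simp add: OS_def)

lemma Hom_OS: "f \<in> Hom (OS \<kappa>) A B \<longleftrightarrow> A \<in> Obj (OS \<kappa>) \<and> B \<in> Obj (OS \<kappa>) \<and> fst f = A \<and> snd (snd f) = B \<and>
    app f \<in> extensional (carrier A) \<and> clinear A B (app f) \<and> complete_contraction A B (app f)"
  by (cases f) (auto simp: Hom_def OS_def)

lemma Arr_OS: "f \<in> Arr (OS \<kappa>) \<Longrightarrow> f \<in> Hom (OS \<kappa>) (fst f) (snd (snd f))"
  by (auto simp: Hom_def OS_def)

lemma Dom_OS: "Dom (OS \<kappa>) f = fst f" and Cod_OS: "Cod (OS \<kappa>) f = snd (snd f)"
  by (auto simp: OS_def split_beta)

lemma Hom_OS_D:
  assumes "f \<in> Hom (OS \<kappa>) A B"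
  shows Hom_OS_Obj1: "A \<in> Obj (OS \<kappa>)" and Hom_OS_Obj2: "B \<in> Obj (OS \<kappa>)"
    and Hom_OS_clinear: "clinear A B (app f)" and Hom_OS_cc: "complete_contraction A B (app f)"
    and Hom_OS_os1: "operator_space A" and Hom_OS_os2: "operator_space B"
    and Hom_OS_closed: "a \<in> carrier A \<Longrightarrow> app f a \<in> carrier B"
  using assms by (auto simp: Hom_OS Obj_OS clinear_closed)

lemma Hom_OS_I:
  assumes "A \<in> Obj (OS \<kappa>)" "B \<in> Obj (OS \<kappa>)" "clinear A B u" "complete_contraction A B u"
  shows "(A, restrict u (carrier A), B) \<in> Hom (OS \<kappa>) A B"
  using assms clinear_cong[of A "restrict u (carrier A)" u B] cc_cong[of A "restrict u (carrier A)" u B]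
  by (simp add: Hom_OS)

lemma Hom_OS_eqI:
  assumes "f \<in> Hom (OS \<kappa>) A B" "g \<in> Hom (OS \<kappa>) A B" "\<And>a. a \<in> carrier A \<Longrightarrow> app f a = app g a"
  shows "f = g"
proof -
  have "app f = app g" using assms by (intro extensionalityI[of _ "carrier A"]) (auto simp: Hom_OS)
  then show ?thesis using assms by (simp add: Hom_OS prod_eq_iff)
qed

lemma Cmp_OS: "Cmp (OS \<kappa>) g f = (fst f, compose (carrier (fst f)) (app g) (app f), snd (snd g))"
  by (simp add: OS_def split_beta)

lemma app_Cmp: "f \<in> Hom (OS \<kappa>) A B \<Longrightarrow> a \<in> carrier A \<Longrightarrow> app (Cmp (OS \<kappa>) g f) a = app g (app f a)"
  by (simp add: Cmp_OS Hom_OS compose_def)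

lemma Idn_OS: "Idn (OS \<kappa>) A = (A, restrict (\<lambda>a. a) (carrier A), A)"
  by (simp add: OS_def)

lemma id_Hom_OS:
  assumes "A \<in> Obj (OS \<kappa>)" shows "Idn (OS \<kappa>) A \<in> Hom (OS \<kappa>) A A"
  unfolding Idn_OS using assms
proof (intro Hom_OS_I)
  show "clinear A A (\<lambda>a. a)" using assms by (auto simp: clinear_iff Obj_OS os_cvs)
  have "map_mat (\<lambda>a. a) y = y" for y :: "'a mat" by auto
  then show "complete_contraction A A (\<lambda>a. a)" by (simp add: complete_contraction_def)
qed

lemma comp_Hom_OS:
  assumes f: "f \<in> Hom (OS \<kappa>) A B" and g: "g \<in> Hom (OS \<kappa>) B D"
  shows "Cmp (OS \<kappa>) g f \<in> Hom (OS \<kappa>) A D"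
proof -
  have "(A, restrict (\<lambda>a. app g (app f a)) (carrier A), D) \<in> Hom (OS \<kappa>) A D"
    using f g by (intro Hom_OS_I clinear_comp[of A B _ D] cc_comp[of A B _ D]) (auto dest: Hom_OS_D)
  then show ?thesis using f g by (simp add: Cmp_OS compose_def Hom_OS)
qed

lemma category_OS: "category (OS \<kappa>)"
proof
  fix f assume f: "f \<in> Arr (OS \<kappa>)"
  from Hom_OS_Obj1[OF Arr_OS[OF f]] show "Dom (OS \<kappa>) f \<in> Obj (OS \<kappa>)" by (simp add: Dom_OS)
  from Hom_OS_Obj2[OF Arr_OS[OF f]] show "Cod (OS \<kappa>) f \<in> Obj (OS \<kappa>)" by (simp add: Cod_OS)
next
  fix f A B assume f: "f \<in> Hom (OS \<kappa>) A B"
  note A = Hom_OS_Obj1[OF f] and B = Hom_OS_Obj2[OF f]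
  show "Cmp (OS \<kappa>) (Idn (OS \<kappa>) B) f = f"
    by (rule Hom_OS_eqI[OF comp_Hom_OS[OF f id_Hom_OS[OF B]] f])
      (simp add: app_Cmp[OF f] Idn_OS Hom_OS_closed[OF f])
  show "Cmp (OS \<kappa>) f (Idn (OS \<kappa>) A) = f"
    by (rule Hom_OS_eqI[OF comp_Hom_OS[OF id_Hom_OS[OF A] f] f])
      (subst app_Cmp[OF id_Hom_OS[OF A]], assumption, simp add: Idn_OS)
  fix g D assume g: "g \<in> Hom (OS \<kappa>) B D"
  fix h E assume h: "h \<in> Hom (OS \<kappa>) D E"
  show "Cmp (OS \<kappa>) h (Cmp (OS \<kappa>) g f) = Cmp (OS \<kappa>) (Cmp (OS \<kappa>) h g) f"
    by (rule Hom_OS_eqI[OF comp_Hom_OS[OF comp_Hom_OS[OF f g] h] comp_Hom_OS[OF f comp_Hom_OS[OF g h]]])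
      (simp add: app_Cmp[OF comp_Hom_OS[OF f g]] app_Cmp[OF f] app_Cmp[OF g] Hom_OS_closed[OF f])
qed (fact id_Hom_OS comp_Hom_OS)+

text \<open>The equations are tested after the separating maps \<open>u c\<close>, where both sides
  become values of linear maps.\<close>

lemma clinear_separated:
  assumes A: "cvs A" and L: "cvs L"
    and e: "\<And>a. a \<in> carrier A \<Longrightarrow> e a \<in> carrier L"
    and u: "\<And>c. c \<in> C \<Longrightarrow> clinear L (X c) (u c)" "\<And>c. c \<in> C \<Longrightarrow> clinear A (X c) (\<lambda>a. u c (e a))"
    and sep: "\<And>a b. a \<in> carrier L \<Longrightarrow> b \<in> carrier L \<Longrightarrow> (\<And>c. c \<in> C \<Longrightarrow> u c a = u c b) \<Longrightarrow> a = b"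
  shows "clinear A L e"
  unfolding clinear_iff
proof (intro conjI allI ballI A L e)
  fix a b assume ab: "a \<in> carrier A" "b \<in> carrier A"
  show "e (a \<oplus>\<^bsub>A\<^esub> b) = e a \<oplus>\<^bsub>L\<^esub> e b"
  proof (rule sep)
    fix c assume "c \<in> C"
    from clinear_add[OF u(2)[OF this] ab] clinear_add[OF u(1)[OF this] e[OF ab(1)] e[OF ab(2)]]
    show "u c (e (a \<oplus>\<^bsub>A\<^esub> b)) = u c (e a \<oplus>\<^bsub>L\<^esub> e b)" by simp
  qed (use ab A L e in \<open>auto simp: cvs_add\<close>)
next
  fix k a assume a: "a \<in> carrier A"
  show "e (k \<odot>\<^bsub>A\<^esub> a) = k \<odot>\<^bsub>L\<^esub> e a"
  proof (rule sep)
    fix c assume "c \<in> C"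
    from clinear_smult[OF u(2)[OF this] a] clinear_smult[OF u(1)[OF this] e[OF a]]
    show "u c (e (k \<odot>\<^bsub>A\<^esub> a)) = u c (k \<odot>\<^bsub>L\<^esub> e a)" by simp
  qed (use a A L e in \<open>auto simp: cvs_smult\<close>)
qed

section \<open>Colimits of small diagrams\<close>

lemma cocone_OS_D:
  assumes "cocone J (OS \<kappa>) F Fm M \<phi>"
  shows "M \<in> Obj (OS \<kappa>)" "j \<in> Obj J \<Longrightarrow> \<phi> j \<in> Hom (OS \<kappa>) (F j) M"
    "f \<in> Arr J \<Longrightarrow> Cmp (OS \<kappa>) (\<phi> (Cod J f)) (Fm f) = \<phi> (Dom J f)"
  using assms by (auto simp: cocone_def)

text \<open>The generators are the pairs of an index and an element at that index, interpreted in
  each cocone by its legs. Relations between them are automatic: what holds in every cocone holds in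
  the separated object, in particular linearity of the new legs and their compatibility with the
  diagram.\<close>

lemma cocomplete_OS:
  fixes \<kappa> :: "'u rel"
  assumes U: "universe \<kappa>"
  shows "cocomplete \<kappa> (OS \<kappa>)"
  unfolding cocomplete_def
proof (intro allI impI, elim conjE)
  fix J :: "('u, 'u) cat" and F Fm
  assume J: "|Obj J| <o \<kappa>" and func: "is_functor J (OS \<kappa>) F Fm"
  have F: "F j \<in> Obj (OS \<kappa>)" if "j \<in> Obj J" for j
    using func that by (simp add: is_functor_def)
  have Fm: "Fm f \<in> Hom (OS \<kappa>) (F (Dom J f)) (F (Cod J f))" if "f \<in> Arr J" for f
    using func that by (simp add: is_functor_def)
  have JC: "Dom J f \<in> Obj J" "Cod J f \<in> Obj J" if "f \<in> Arr J" for f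
    using func that category.dom_obj category.cod_obj by (fastforce simp: is_functor_def)+
  define C where "C = {c. cocone J (OS \<kappa>) F Fm (fst c) (snd c)}"
  define x where "x c ja = app (snd c (fst ja)) (snd ja)"
    for c :: "'u opspace \<times> ('u \<Rightarrow> 'u opspace \<times> ('u \<Rightarrow> 'u) \<times> 'u opspace)" and ja
  let ?I = "SIGMA j:Obj J. carrier (F j)"
  have C: "c \<in> C \<Longrightarrow> j \<in> Obj J \<Longrightarrow> snd c j \<in> Hom (OS \<kappa>) (F j) (fst c)" for c j
    using cocone_OS_D(2) by (simp add: C_def)
  have smI: "|?I| <o \<kappa>"
    by (rule small_Sigma[OF U J]) (use F in \<open>simp add: Obj_OS\<close>)
  have osC: "operator_space (fst c)" if "c \<in> C" for c
    using that cocone_OS_D(1)[of J \<kappa> F Fm "fst c" "snd c"] by (simp add: C_def Obj_OS)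
  have xC: "x c i \<in> carrier (fst c)" if "c \<in> C" "i \<in> ?I" for c i
    using that(2) Hom_OS_closed[OF C[OF that(1)]] by (auto simp: x_def)
  have bddC: "\<exists>B. \<forall>c\<in>C. nrm (fst c) (x c i) \<le> B" if i: "i \<in> ?I" for i
  proof (intro exI ballI)
    fix c assume c: "c \<in> C"
    \<comment> \<open>The legs are contractions, so the norm in the diagram is a bound valid for all
      cocones.\<close>
    show "nrm (fst c) (x c i) \<le> nrm (F (fst i)) (snd i)"
      using i cc_nrm[OF Hom_OS_cc[OF C[OF c]]] by (auto simp: x_def)
  qed
  obtain L e u where G: "free_on C fst ?I x L e u" and small: "|carrier L| <o \<kappa>"
    using ex_free_on[where C = C and X = fst and x = x and I = ?I, OF U smI osC xC bddC] by blast
  note e = free_onD(2)[OF G] and u = free_onD(3,4)[OF G] and ue = free_onD(5)[OF G]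
    and least = free_on_least[OF G] and sep = free_on_separated[OF G] and unique = free_on_unique[OF G]
  have L: "operator_space L" and LO: "L \<in> Obj (OS \<kappa>)"
    using free_onD(1)[OF G] small by (simp_all add: Obj_OS)
  define \<psi> where "\<psi> j = (F j, restrict (\<lambda>a. e (j, a)) (carrier (F j)), L)" for j
  have uej: "u c (e (j, a)) = app (snd c j) a" if "c \<in> C" "j \<in> Obj J" "a \<in> carrier (F j)" for c j a
    using ue[OF that(1), of "(j, a)"] that by (simp add: x_def)
  have \<psi>: "\<psi> j \<in> Hom (OS \<kappa>) (F j) L" if j: "j \<in> Obj J" for j
    unfolding \<psi>_def
  proof (rule Hom_OS_I[OF F[OF j] LO])
    have uj: "clinear (F j) (fst c) (\<lambda>a. u c (e (j, a)))" if "c \<in> C" for c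
      using Hom_OS_clinear[OF C[OF that j]] clinear_cong[of "F j" "\<lambda>a. u c (e (j, a))" "app (snd c j)"]
        uej[OF that j] by blast
    show lin: "clinear (F j) L (\<lambda>a. e (j, a))"
      by (rule clinear_separated[where u = u and C = C and X = fst])
        (use F[OF j] L j e u uj sep in \<open>simp_all add: Obj_OS os_cvs\<close>)
    show "complete_contraction (F j) L (\<lambda>a. e (j, a))"
      unfolding complete_contraction_def
    proof (intro allI impI ballI)
      fix n :: nat and y assume n: "1 \<le> n" and y: "y \<in> Mats n (F j)"
      show "mnorm L n (map_mat (\<lambda>a. e (j, a)) y) \<le> mnorm (F j) n y"
      proof (rule least[OF n Mats_map[OF lin y]])
        show "0 \<le> mnorm (F j) n y" using F[OF j] by (intro os_nonneg n y) (simp add: Obj_OS)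
        fix c assume c: "c \<in> C"
        have "map_mat (u c) (map_mat (\<lambda>a. e (j, a)) y) = map_mat (app (snd c j)) y"
          using y uej[OF c j] by (auto simp: Mats_iff mat_eq_iff)
        then show "mnorm (fst c) n (map_mat (u c) (map_mat (\<lambda>a. e (j, a)) y)) \<le> mnorm (F j) n y"
          using cc_D[OF Hom_OS_cc[OF C[OF c j]] n y] by simp
      qed
    qed
  qed
  have app\<psi>: "app (\<psi> j) a = e (j, a)" if "a \<in> carrier (F j)" for j a using that by (simp add: \<psi>_def)
  have "cocone J (OS \<kappa>) F Fm L \<psi>"
    unfolding cocone_def
  proof (intro conjI ballI LO \<psi>)
    fix f assume f: "f \<in> Arr J"
    note d = JC[OF f] and Ff = Fm[OF f]
    show "Cmp (OS \<kappa>) (\<psi> (Cod J f)) (Fm f) = \<psi> (Dom J f)"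
    proof (rule Hom_OS_eqI[OF comp_Hom_OS[OF Ff \<psi>[OF d(2)]] \<psi>[OF d(1)]])
      fix a assume a: "a \<in> carrier (F (Dom J f))"
      note fa = Hom_OS_closed[OF Ff a]
      \<comment> \<open>The two generators coincide because every cocone identifies them.\<close>
      have "e (Cod J f, app (Fm f) a) = e (Dom J f, a)"
      proof (rule sep)
        fix c assume c: "c \<in> C"
        then have "Cmp (OS \<kappa>) (snd c (Cod J f)) (Fm f) = snd c (Dom J f)"
          using f cocone_OS_D(3) by (simp add: C_def)
        then show "u c (e (Cod J f, app (Fm f) a)) = u c (e (Dom J f, a))"
          using uej[OF c] d a fa app_Cmp[OF Ff a, of "snd c (Cod J f)"] by simp
      qed (use e d a fa in auto)
      then show "app (Cmp (OS \<kappa>) (\<psi> (Cod J f)) (Fm f)) a = app (\<psi> (Dom J f)) a"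
        by (simp add: app_Cmp[OF Ff a] app\<psi> a fa)
    qed
  qed
  moreover have "\<exists>!h. h \<in> Hom (OS \<kappa>) L M \<and> (\<forall>j\<in>Obj J. Cmp (OS \<kappa>) h (\<psi> j) = \<phi> j)"
    if \<phi>: "cocone J (OS \<kappa>) F Fm M \<phi>" for M \<phi>
  proof (rule ex1I, intro conjI ballI)
    \<comment> \<open>A cocone is itself one of the coordinates, and the morphism that it induces is
      the projection to this coordinate.\<close>
    let ?c = "(M, \<phi>)" and ?h = "(L, restrict (u (M, \<phi>)) (carrier L), M)"
    have c: "?c \<in> C" using \<phi> by (simp add: C_def)
    show h: "?h \<in> Hom (OS \<kappa>) L M"
      using u[OF c] LO cocone_OS_D(1)[OF \<phi>] by (intro Hom_OS_I) auto
    show "Cmp (OS \<kappa>) ?h (\<psi> j) = \<phi> j" if j: "j \<in> Obj J" for j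
      by (rule Hom_OS_eqI[OF comp_Hom_OS[OF \<psi>[OF j] h] cocone_OS_D(2)[OF \<phi> j]])
        (use e j uej[OF c j] in \<open>simp add: app_Cmp[OF \<psi>[OF j]] app\<psi>\<close>)
    fix h' assume "h' \<in> Hom (OS \<kappa>) L M \<and> (\<forall>j\<in>Obj J. Cmp (OS \<kappa>) h' (\<psi> j) = \<phi> j)"
    then have h': "h' \<in> Hom (OS \<kappa>) L M" "\<And>j. j \<in> Obj J \<Longrightarrow> Cmp (OS \<kappa>) h' (\<psi> j) = \<phi> j" by auto
    have "app h' (e i) = app ?h (e i)" if i: "i \<in> ?I" for i
    proof -
      obtain j a where ja: "i = (j, a)" "j \<in> Obj J" "a \<in> carrier (F j)" using i by auto
      have "app h' (e i) = app (Cmp (OS \<kappa>) h' (\<psi> j)) a"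
        using ja by (simp add: app_Cmp[OF \<psi>] app\<psi>)
      also have "\<dots> = app ?h (e i)" using h'(2) ja uej[OF c] e i by simp
      finally show ?thesis .
    qed
    then show "h' = ?h"
      by - (rule Hom_OS_eqI[OF h'(1) h], rule unique[OF Hom_OS_os2[OF h] Hom_OS_clinear[OF h'(1)] Hom_OS_cc[OF h'(1)]
        Hom_OS_clinear[OF h] Hom_OS_cc[OF h]], blast+)
  qed
  ultimately show "\<exists>L \<psi>. colimit J (OS \<kappa>) F Fm L \<psi>"
    unfolding colimit_def by blast
qed

text \<open>The functor taking \<open>X\<close> to the unit ball of the \<open>n \<times> n\<close> matrices over \<open>X\<close> is
  representable (by the predual of the \<open>n \<times> n\<close> matrices).\<close>

definition represents_ball ::
    "'u rel \<Rightarrow> nat \<Rightarrow> 'u opspace \<Rightarrow> 'u mat \<Rightarrow> bool" where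
  "represents_ball \<kappa> n T E \<longleftrightarrow> T \<in> Obj (OS \<kappa>) \<and> E \<in> Mats n T \<and> mnorm T n E \<le> 1 \<and>
     (\<forall>X\<in>Obj (OS \<kappa>). \<forall>m\<in>Mats n X. mnorm X n m \<le> 1 \<longrightarrow> (\<exists>f\<in>Hom (OS \<kappa>) T X. map_mat (app f) E = m)) \<and>
     (\<forall>X. \<forall>f\<in>Hom (OS \<kappa>) T X. \<forall>g\<in>Hom (OS \<kappa>) T X. map_mat (app f) E = map_mat (app g) E \<longrightarrow> f = g)"

text \<open>The coordinates are all pairs of a small space and a matrix in its unit ball, and the
  generators are interpreted as the entries of that matrix. The matrix \<open>E\<close> of the
  generators is thus sent to the marked matrix by every projection.\<close>

lemma ex_represents_ball:
  fixes \<kappa> :: "'u rel"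
  assumes U: "universe \<kappa>" and n: "1 \<le> n"
  shows "\<exists>T E. represents_ball \<kappa> n T E"
proof -
  define C where "C = {(X, m). X \<in> Obj (OS \<kappa>) \<and> m \<in> Mats n X \<and> mnorm X n m \<le> 1}"
  let ?I = "{..<n} \<times> {..<n}"
  define x where "x c ij = snd c $$ ij" for c :: "'u opspace \<times> 'u mat" and ij
  have C: "operator_space (fst c)" "fst c \<in> Obj (OS \<kappa>)" "snd c \<in> Mats n (fst c)" "mnorm (fst c) n (snd c) \<le> 1"
    if "c \<in> C" for c
    using that by (auto simp: C_def Obj_OS)
  have smI: "|?I| <o \<kappa>" by (rule small_finite[OF U]) simp
  have xC: "x c ij \<in> carrier (fst c)" if "c \<in> C" "ij \<in> ?I" for c ij
    using C(3)[OF that(1)] that(2) by (auto simp: x_def Mats_iff)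
  have bddC: "\<exists>B. \<forall>c\<in>C. nrm (fst c) (x c ij) \<le> B" if "ij \<in> ?I" for ij
  proof (intro exI ballI)
    fix c assume c: "c \<in> C"
    \<comment> \<open>The norm of an entry is bounded by that of the matrix, hence by 1.\<close>
    show "nrm (fst c) (x c ij) \<le> 1"
      using nrm_entry_le[OF C(1,3)[OF c], of "fst ij" "snd ij"] C(4)[OF c] that by (auto simp: x_def)
  qed
  obtain T e u where G: "free_on C fst ?I x T e u" and small: "|carrier T| <o \<kappa>"
    using ex_free_on[where C = C and X = fst and x = x and I = ?I, OF U smI C(1) xC bddC] by blast
  note e = free_onD(2)[OF G] and u = free_onD(3,4)[OF G] and ue = free_onD(5)[OF G]
    and least = free_on_least[OF G] and unique = free_on_unique[OF G]
  define E where "E = mat n n e"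
  have E: "E \<in> Mats n T" using e by (auto simp: E_def Mats_iff)
  have TO: "T \<in> Obj (OS \<kappa>)" using free_onD(1)[OF G] small by (simp add: Obj_OS)
  have uE: "map_mat (u c) E = snd c" if c: "c \<in> C" for c
    using ue[OF c] C(3)[OF c] by (auto simp: E_def Mats_iff mat_eq_iff x_def)
  have "represents_ball \<kappa> n T E"
    unfolding represents_ball_def
  proof (intro conjI allI ballI impI TO E)
    \<comment> \<open>All images of \<open>E\<close> are marked matrices of norm at most 1, and the
      norm of \<open>E\<close> is bounded by any nonnegative common bound for theirs.\<close>
    show "mnorm T n E \<le> 1"
      by (rule least[OF n E]) (use uE C(4) in auto)
    show "\<exists>f\<in>Hom (OS \<kappa>) T X. map_mat (app f) E = m"
      if X: "X \<in> Obj (OS \<kappa>)" and m: "m \<in> Mats n X" "mnorm X n m \<le> 1" for X m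
    proof
      have c: "(X, m) \<in> C" using X m by (simp add: C_def)
      show "(T, restrict (u (X, m)) (carrier T), X) \<in> Hom (OS \<kappa>) T X"
        using u[OF c] TO X by (intro Hom_OS_I) auto
      have "map_mat (restrict (u (X, m)) (carrier T)) E = map_mat (u (X, m)) E"
        using E by (auto simp: Mats_iff mat_eq_iff)
      then show "map_mat (app (T, restrict (u (X, m)) (carrier T), X)) E = m"
        using uE[OF c] by simp
    qed
    show "f = g" if f: "f \<in> Hom (OS \<kappa>) T X" and g: "g \<in> Hom (OS \<kappa>) T X"
      and eq: "map_mat (app f) E = map_mat (app g) E" for X f g
    proof (rule Hom_OS_eqI[OF f g])
      fix a assume "a \<in> carrier T"
      moreover have "app f (e i) = app g (e i)" if "i \<in> ?I" for i
      proof -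
        have "map_mat (app f) E $$ i = map_mat (app g) E $$ i" using eq by simp
        then show ?thesis using that by (auto simp: E_def)
      qed
      ultimately show "app f a = app g a"
        by - (rule unique[OF Hom_OS_os2[OF f] Hom_OS_clinear[OF f] Hom_OS_cc[OF f] Hom_OS_clinear[OF g]
            Hom_OS_cc[OF g]], blast+)
    qed
  qed
  then show ?thesis by blast
qed


section \<open>Countably directed colimits\<close>

lemma countable_ordLess_cardSuc: "countable S \<Longrightarrow> |S| <o cardSuc natLeq"
proof -
  assume "countable S"
  then obtain f :: "_ \<Rightarrow> nat" where "inj_on f S" by (rule countableE)
  then have "|S| \<le>o |UNIV :: nat set|" by (rule card_of_ordLeqI) simp
  then have "|S| \<le>o natLeq" using card_of_nat by (rule ordLeq_ordIso_trans)
  then show ?thesis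
    by (rule iffD2[OF cardSuc_ordLeq_ordLess[OF natLeq_Card_order card_of_Card_order]])
qed

lemma directed_countable:
  assumes "directed (cardSuc natLeq) P r" "countable S" "S \<subseteq> P"
  shows "\<exists>b\<in>P. \<forall>s\<in>S. (s, b) \<in> r"
  using assms(1,3) countable_ordLess_cardSuc[OF assms(2)] unfolding directed_def by simp

lemma directed_pair:
  assumes "directed (cardSuc natLeq) P r" "p \<in> P" "q \<in> P"
  shows "\<exists>b\<in>P. (p, b) \<in> r \<and> (q, b) \<in> r"
  using directed_countable[OF assms(1), of "{p, q}"] assms(2,3) by simp

lemma directed_order:
  assumes "directed \<alpha> P r"
  shows "(p, q) \<in> r \<Longrightarrow> p \<in> P" "(p, q) \<in> r \<Longrightarrow> q \<in> P" "p \<in> P \<Longrightarrow> (p, p) \<in> r"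
    "(p, q) \<in> r \<Longrightarrow> (q, s) \<in> r \<Longrightarrow> (p, s) \<in> r"
  using assms by (auto simp: directed_def partial_order_on_def preorder_on_def refl_on_def dest: transD)

lemma poset_cat_simps [simp]:
  "Obj (poset_cat P r) = P" "Arr (poset_cat P r) = r" "Dom (poset_cat P r) = fst" "Cod (poset_cat P r) = snd"
  "Idn (poset_cat P r) p = (p, p)" "Cmp (poset_cat P r) g f = (fst f, snd g)"
  by (simp_all add: poset_cat_def)

section \<open>The category of sets and a criterion for countable presentability\<close>

lemma Hom_set_cat: "f \<in> Hom set_cat X Y \<longleftrightarrow> fst f = X \<and> snd (snd f) = Y \<and> app f \<in> X \<rightarrow>\<^sub>E Y"
  by (cases f) (auto simp: Hom_def set_cat_def)

lemma Cmp_set_cat: "Cmp set_cat g f = (fst f, compose (fst f) (app g) (app f), snd (snd g))"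
  by (simp add: set_cat_def split_beta)

lemma Hom_set_cat_eqI:
  assumes "f \<in> Hom set_cat X Y" "g \<in> Hom set_cat X Y" "\<And>a. a \<in> X \<Longrightarrow> app f a = app g a"
  shows "f = g"
proof -
  have "app f = app g" using assms by (intro PiE_ext[of _ X "\<lambda>_. Y"]) (auto simp: Hom_set_cat)
  then show ?thesis using assms by (simp add: Hom_set_cat prod_eq_iff)
qed

lemma comp_Hom_set_cat: "f \<in> Hom set_cat X Y \<Longrightarrow> g \<in> Hom set_cat Y Z \<Longrightarrow> Cmp set_cat g f \<in> Hom set_cat X Z"
  by (auto simp: Hom_set_cat Cmp_set_cat compose_def)

lemma app_Cmp_set_cat: "f \<in> Hom set_cat X Y \<Longrightarrow> a \<in> X \<Longrightarrow> app (Cmp set_cat g f) a = app g (app f a)"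
  by (simp add: Cmp_set_cat Hom_set_cat compose_def)

lemma hom_map_Hom:
  assumes "category C" "f \<in> Hom C X Y"
  shows "hom_map C A f \<in> Hom set_cat (Hom C A X) (Hom C A Y)"
    and "g \<in> Hom C A X \<Longrightarrow> app (hom_map C A f) g = f \<cdot>\<^bsub>C\<^esub> g"
proof -
  have d: "Dom C f = X" "Cod C f = Y" using assms(2) by (auto simp: Hom_def)
  show "hom_map C A f \<in> Hom set_cat (Hom C A X) (Hom C A Y)"
    using category.comp_hom[OF assms(1) _ assms(2), of _ A] by (auto simp: Hom_set_cat hom_map_def d)
  show "g \<in> Hom C A X \<Longrightarrow> app (hom_map C A f) g = f \<cdot>\<^bsub>C\<^esub> g" by (simp add: hom_map_def d)
qed

text \<open>By \<open>surj\<close>, a map out of \<open>Hom C A L\<close> is determined by its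
  values on factorisations through stages, and \<open>inj\<close> makes such values independent of
  the factorisation: the usual description of a directed colimit of sets.\<close>

lemma presentableI:
  fixes \<kappa> :: "'u rel" and C :: "('o, 'm) cat"
  assumes C: "category C" and A: "A \<in> Obj C"
    and surj: "\<And>(P :: 'u set) r F Fm L \<psi> g. directed (cardSuc natLeq) P r \<Longrightarrow> |P| <o \<kappa> \<Longrightarrow>
      is_functor (poset_cat P r) C F Fm \<Longrightarrow> colimit (poset_cat P r) C F Fm L \<psi> \<Longrightarrow> g \<in> Hom C A L \<Longrightarrow>
      \<exists>p\<in>P. \<exists>f\<in>Hom C A (F p). \<psi> p \<cdot>\<^bsub>C\<^esub> f = g"
    and inj: "\<And>(P :: 'u set) r F Fm L \<psi> p f f'. directed (cardSuc natLeq) P r \<Longrightarrow> |P| <o \<kappa> \<Longrightarrow>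
      is_functor (poset_cat P r) C F Fm \<Longrightarrow> colimit (poset_cat P r) C F Fm L \<psi> \<Longrightarrow> p \<in> P \<Longrightarrow>
      f \<in> Hom C A (F p) \<Longrightarrow> f' \<in> Hom C A (F p) \<Longrightarrow> \<psi> p \<cdot>\<^bsub>C\<^esub> f = \<psi> p \<cdot>\<^bsub>C\<^esub> f' \<Longrightarrow>
      \<exists>q. (p, q) \<in> r \<and> Fm (p, q) \<cdot>\<^bsub>C\<^esub> f = Fm (p, q) \<cdot>\<^bsub>C\<^esub> f'"
  shows "presentable \<kappa> (cardSuc natLeq) C A"
  unfolding presentable_def
proof (intro conjI allI impI A, elim conjE)
  fix P :: "'u set" and r F Fm L \<psi>
  assume P: "|P| <o \<kappa>" and dir: "directed (cardSuc natLeq) P r"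
    and func: "is_functor (poset_cat P r) C F Fm" and col: "colimit (poset_cat P r) C F Fm L \<psi>"
  let ?J = "poset_cat P r"
  note ord = directed_order[OF dir]
  note assoc = category.comp_assoc[OF C] and comp = category.comp_hom[OF C]
  have Fm: "Fm (p, q) \<in> Hom C (F p) (F q)" if "(p, q) \<in> r" for p q
    using func that by (force simp: is_functor_def)
  have coc: "cocone ?J C F Fm L \<psi>" using col by (simp add: colimit_def)
  have \<psi>: "\<psi> p \<in> Hom C (F p) L" if "p \<in> P" for p
    using coc that by (simp add: cocone_def)
  have \<psi>_Fm: "\<psi> q \<cdot>\<^bsub>C\<^esub> Fm (p, q) = \<psi> p" if "(p, q) \<in> r" for p q
    using coc that by (fastforce simp: cocone_def)
  let ?F = "\<lambda>p. Hom C A (F p)" and ?Fm = "\<lambda>f. hom_map C A (Fm f)" and ?\<psi> = "\<lambda>p. hom_map C A (\<psi> p)"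
  show "colimit ?J set_cat ?F ?Fm (Hom C A L) ?\<psi>"
    unfolding colimit_def
  proof (intro conjI allI impI)
    show "cocone ?J set_cat ?F ?Fm (Hom C A L) ?\<psi>"
      unfolding cocone_def poset_cat_simps
    proof (intro conjI ballI)
      show "Hom C A L \<in> Obj set_cat" by (simp add: set_cat_def)
      show "?\<psi> p \<in> Hom set_cat (?F p) (Hom C A L)" if "p \<in> P" for p
        by (rule hom_map_Hom(1)[OF C \<psi>[OF that]])
      fix f assume "f \<in> r"
      then obtain p q where pq: "f = (p, q)" "(p, q) \<in> r" by (cases f) auto
      note p = ord(1)[OF pq(2)] and q = ord(2)[OF pq(2)]
      have "Cmp set_cat (?\<psi> q) (?Fm (p, q)) = ?\<psi> p"
      proof (rule Hom_set_cat_eqI)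
        show "Cmp set_cat (?\<psi> q) (?Fm (p, q)) \<in> Hom set_cat (?F p) (Hom C A L)"
          by (rule comp_Hom_set_cat[OF hom_map_Hom(1)[OF C Fm[OF pq(2)]] hom_map_Hom(1)[OF C \<psi>[OF q]]])
        show "?\<psi> p \<in> Hom set_cat (?F p) (Hom C A L)" by (rule hom_map_Hom(1)[OF C \<psi>[OF p]])
        fix g assume g: "g \<in> ?F p"
        have "app (Cmp set_cat (?\<psi> q) (?Fm (p, q))) g = app (?\<psi> q) (Fm (p, q) \<cdot>\<^bsub>C\<^esub> g)"
          by (simp add: app_Cmp_set_cat[OF hom_map_Hom(1)[OF C Fm[OF pq(2)]] g] hom_map_Hom(2)[OF C Fm[OF pq(2)] g])
        also have "\<dots> = \<psi> q \<cdot>\<^bsub>C\<^esub> (Fm (p, q) \<cdot>\<^bsub>C\<^esub> g)"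
          by (rule hom_map_Hom(2)[OF C \<psi>[OF q] comp[OF g Fm[OF pq(2)]]])
        also have "\<dots> = \<psi> p \<cdot>\<^bsub>C\<^esub> g" by (simp add: assoc[OF g Fm[OF pq(2)] \<psi>[OF q]] \<psi>_Fm[OF pq(2)])
        also have "\<dots> = app (?\<psi> p) g" by (rule hom_map_Hom(2)[OF C \<psi>[OF p] g, symmetric])
        finally show "app (Cmp set_cat (?\<psi> q) (?Fm (p, q))) g = app (?\<psi> p) g" .
      qed
      then show "Cmp set_cat (?\<psi> (snd f)) (?Fm f) = ?\<psi> (fst f)" by (simp add: pq(1))
    qed
  next
    fix M \<phi> assume \<phi>: "cocone ?J set_cat ?F ?Fm M \<phi>"
    have \<phi>_Hom: "\<phi> p \<in> Hom set_cat (?F p) M" if "p \<in> P" for p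
      using \<phi> that by (simp add: cocone_def)
    have \<phi>_Fm: "app (\<phi> q) (Fm (p, q) \<cdot>\<^bsub>C\<^esub> f) = app (\<phi> p) f" if pq: "(p, q) \<in> r" and f: "f \<in> ?F p" for p q f
    proof -
      have "Cmp set_cat (\<phi> q) (?Fm (p, q)) = \<phi> p"
        using \<phi> pq by (fastforce simp: cocone_def)
      then have "app (\<phi> p) f = app (\<phi> q) (app (?Fm (p, q)) f)"
        using app_Cmp_set_cat[OF hom_map_Hom(1)[OF C Fm[OF pq]] f, of "\<phi> q"] by simp
      then show ?thesis by (simp add: hom_map_Hom(2)[OF C Fm[OF pq] f])
    qed
    \<comment> \<open>Both factorisations are pushed to a common stage \<open>b\<close>, beyond
      which \<open>inj\<close> identifies them.\<close>
    have well: "app (\<phi> p) f = app (\<phi> p') f'"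
      if p: "p \<in> P" "p' \<in> P" and f: "f \<in> ?F p" "f' \<in> ?F p'" and eq: "\<psi> p \<cdot>\<^bsub>C\<^esub> f = \<psi> p' \<cdot>\<^bsub>C\<^esub> f'" for p p' f f'
    proof -
      obtain b where b: "b \<in> P" "(p, b) \<in> r" "(p', b) \<in> r"
        using directed_pair[OF dir p] by blast
      let ?g = "Fm (p, b) \<cdot>\<^bsub>C\<^esub> f" and ?g' = "Fm (p', b) \<cdot>\<^bsub>C\<^esub> f'"
      have g: "?g \<in> ?F b" "?g' \<in> ?F b" using b f by (auto intro: comp Fm)
      have "\<psi> b \<cdot>\<^bsub>C\<^esub> ?g = \<psi> b \<cdot>\<^bsub>C\<^esub> ?g'"
        using assoc[OF f(1) Fm[OF b(2)] \<psi>[OF b(1)]] assoc[OF f(2) Fm[OF b(3)] \<psi>[OF b(1)]] b eq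
        by (simp add: \<psi>_Fm)
      from inj[OF dir P func col b(1) g this] obtain q
        where q: "(b, q) \<in> r" "Fm (b, q) \<cdot>\<^bsub>C\<^esub> ?g = Fm (b, q) \<cdot>\<^bsub>C\<^esub> ?g'" by blast
      then show ?thesis
        using \<phi>_Fm[OF b(2) f(1)] \<phi>_Fm[OF b(3) f(2)] \<phi>_Fm[OF q(1) g(1)] \<phi>_Fm[OF q(1) g(2)] by simp
    qed
    \<comment> \<open>The stage and the morphism are packed into a pair, so that one choice function
      picks a factorisation for every \<open>g\<close>.\<close>
    have "\<exists>pf. fst pf \<in> P \<and> snd pf \<in> ?F (fst pf) \<and> \<psi> (fst pf) \<cdot>\<^bsub>C\<^esub> snd pf = g" if "g \<in> Hom C A L" for g
      using surj[OF dir P func col that] by force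
    then obtain c where c: "\<And>g. g \<in> Hom C A L \<Longrightarrow> fst (c g) \<in> P"
        "\<And>g. g \<in> Hom C A L \<Longrightarrow> snd (c g) \<in> ?F (fst (c g))"
        "\<And>g. g \<in> Hom C A L \<Longrightarrow> \<psi> (fst (c g)) \<cdot>\<^bsub>C\<^esub> snd (c g) = g"
      by metis
    define h where "h = (Hom C A L, \<lambda>g\<in>Hom C A L. app (\<phi> (fst (c g))) (snd (c g)), M)"
    have h: "h \<in> Hom set_cat (Hom C A L) M"
      using c \<phi>_Hom by (fastforce simp: h_def Hom_set_cat)
    show "\<exists>!h. h \<in> Hom set_cat (Hom C A L) M \<and> (\<forall>p\<in>Obj ?J. Cmp set_cat h (?\<psi> p) = \<phi> p)"
      unfolding poset_cat_simps
    proof (rule ex1I[of _ h], intro conjI ballI h)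
      fix p assume p: "p \<in> P"
      note \<psi>p = hom_map_Hom(1)[OF C \<psi>[OF p], of A]
      show "Cmp set_cat h (?\<psi> p) = \<phi> p"
      proof (rule Hom_set_cat_eqI[OF comp_Hom_set_cat[OF \<psi>p h] \<phi>_Hom[OF p]])
        fix f assume f: "f \<in> ?F p"
        have g: "\<psi> p \<cdot>\<^bsub>C\<^esub> f \<in> Hom C A L" by (rule comp[OF f \<psi>[OF p]])
        show "app (Cmp set_cat h (?\<psi> p)) f = app (\<phi> p) f"
          using well[OF c(1)[OF g] p c(2)[OF g] f c(3)[OF g]] g
          by (simp add: app_Cmp_set_cat[OF \<psi>p f] hom_map_Hom(2)[OF C \<psi>[OF p] f] h_def)
      qed
    next
      fix k assume k: "k \<in> Hom set_cat (Hom C A L) M \<and> (\<forall>p\<in>P. Cmp set_cat k (?\<psi> p) = \<phi> p)"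
      show "k = h"
      proof (rule Hom_set_cat_eqI[OF _ h])
        show "k \<in> Hom set_cat (Hom C A L) M" using k by simp
        fix g assume g: "g \<in> Hom C A L"
        have "Cmp set_cat k (?\<psi> (fst (c g))) = \<phi> (fst (c g))" using k c(1)[OF g] by blast
        then have "app (\<phi> (fst (c g))) (snd (c g)) = app k g"
          using app_Cmp_set_cat[OF hom_map_Hom(1)[OF C \<psi>[OF c(1)[OF g]]] c(2)[OF g], of k]
          by (simp add: hom_map_Hom(2)[OF C \<psi>[OF c(1)[OF g]] c(2)[OF g]] c(3)[OF g])
        then show "app k g = app h g" using g by (simp add: h_def)
      qed
    qed
  qed
qed

section \<open>The algebraic colimit of a countably directed system\<close>

locale directed_system =
  fixes \<kappa> :: "'u rel" and P :: "'u set" and r :: "'u rel" and F :: "'u \<Rightarrow> 'u opspace"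
    and Fm :: "'u \<times> 'u \<Rightarrow> 'u opspace \<times> ('u \<Rightarrow> 'u) \<times> 'u opspace"
  assumes U: "universe \<kappa>" and small_P: "|P| <o \<kappa>" and dir: "directed (cardSuc natLeq) P r"
    and func: "is_functor (poset_cat P r) (OS \<kappa>) F Fm"
begin

abbreviation tr :: "'u \<Rightarrow> 'u \<Rightarrow> 'u \<Rightarrow> 'u" where "tr p q \<equiv> app (Fm (p, q))"

lemmas ord = directed_order[OF dir]

lemma F_Obj: "p \<in> P \<Longrightarrow> F p \<in> Obj (OS \<kappa>)"
  using func by (simp add: is_functor_def)

lemma F_os: "p \<in> P \<Longrightarrow> operator_space (F p)"
  using F_Obj by (simp add: Obj_OS)

lemma F_cvs: "p \<in> P \<Longrightarrow> cvs (F p)"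
  by (rule os_cvs[OF F_os])

lemma Fm_Hom: "(p, q) \<in> r \<Longrightarrow> Fm (p, q) \<in> Hom (OS \<kappa>) (F p) (F q)"
  using func by (force simp: is_functor_def)

lemmas tr_lin = Hom_OS_clinear[OF Fm_Hom] and tr_cc = Hom_OS_cc[OF Fm_Hom] and tr_closed = Hom_OS_closed[OF Fm_Hom]

lemma tr_refl: "p \<in> P \<Longrightarrow> x \<in> carrier (F p) \<Longrightarrow> tr p p x = x"
  using func by (simp add: is_functor_def Idn_OS)

lemma tr_trans:
  assumes "(p, q) \<in> r" "(q, s) \<in> r" "x \<in> carrier (F p)"
  shows "tr q s (tr p q x) = tr p s x"
proof -
  have "Fm (p, s) = Cmp (OS \<kappa>) (Fm (q, s)) (Fm (p, q))"
    using func assms(1,2) unfolding is_functor_def poset_cat_simps by fastforce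
  then show ?thesis using app_Cmp[OF Fm_Hom[OF assms(1)] assms(3), of "Fm (q, s)"] by simp
qed

text \<open>Equality at some later stage, the relation whose classes form the colimit of the
  underlying sets.\<close>

definition eqv :: "'u \<times> 'u \<Rightarrow> 'u \<times> 'u \<Rightarrow> bool" where
  "eqv i j \<longleftrightarrow> (\<exists>s. (fst i, s) \<in> r \<and> (fst j, s) \<in> r \<and> tr (fst i) s (snd i) = tr (fst j) s (snd j))"

abbreviation total :: "('u \<times> 'u) set" where "total \<equiv> SIGMA p:P. carrier (F p)"

lemma tr_eq_mono:
  assumes "(p, s) \<in> r" "(q, s) \<in> r" "tr p s x = tr q s y" "(s, t) \<in> r" "x \<in> carrier (F p)" "y \<in> carrier (F q)"
  shows "tr p t x = tr q t y"
  using tr_trans[OF assms(1,4,5)] tr_trans[OF assms(2,4,6)] assms(3) by simp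

lemma eqv_refl: "i \<in> total \<Longrightarrow> eqv i i"
  unfolding eqv_def by (rule exI[of _ "fst i"]) (auto intro: ord(3))

lemma eqv_sym: "eqv i j \<Longrightarrow> eqv j i"
  by (auto simp: eqv_def dest: sym)

lemma eqv_trans:
  assumes "i \<in> total" "j \<in> total" "k \<in> total" "eqv i j" "eqv j k"
  shows "eqv i k"
proof -
  from assms(4) obtain s where s: "(fst i, s) \<in> r" "(fst j, s) \<in> r" "tr (fst i) s (snd i) = tr (fst j) s (snd j)"
    by (auto simp: eqv_def)
  from assms(5) obtain t where t: "(fst j, t) \<in> r" "(fst k, t) \<in> r" "tr (fst j) t (snd j) = tr (fst k) t (snd k)"
    by (auto simp: eqv_def)
  from directed_pair[OF dir ord(2)[OF s(1)] ord(2)[OF t(1)]] obtain b where b: "(s, b) \<in> r" "(t, b) \<in> r"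
    by blast
  have "tr (fst i) b (snd i) = tr (fst j) b (snd j)" "tr (fst j) b (snd j) = tr (fst k) b (snd k)"
    by (rule tr_eq_mono[OF s b(1)] tr_eq_mono[OF t b(2)]; use assms(1-3) in auto)+
  then show ?thesis
    unfolding eqv_def using ord(4)[OF s(1) b(1)] ord(4)[OF t(2) b(2)] by (intro exI[of _ b]) simp
qed

text \<open>The equivalence classes form a small set of sets, so they have codes in
  \<open>'u\<close>. Only the criterion for equality of codes is recorded; it determines the colimit
  of sets up to renaming.\<close>

lemma ex_inclusions:
  "\<exists>\<iota> :: 'u \<Rightarrow> 'u \<Rightarrow> 'u. \<forall>p\<in>P. \<forall>q\<in>P. \<forall>x\<in>carrier (F p). \<forall>y\<in>carrier (F q).
     \<iota> p x = \<iota> q y \<longleftrightarrow> (\<exists>s. (p, s) \<in> r \<and> (q, s) \<in> r \<and> tr p s x = tr q s y)"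
proof -
  define cls where "cls i = {j \<in> total. eqv i j}" for i
  have cls: "cls i = cls j \<longleftrightarrow> eqv i j" if ij: "i \<in> total" "j \<in> total" for i j
  proof
    assume "cls i = cls j"
    then have "j \<in> cls i" using eqv_refl[OF ij(2)] ij by (simp add: cls_def)
    then show "eqv i j" by (simp add: cls_def)
  next
    assume e: "eqv i j"
    show "cls i = cls j"
      unfolding cls_def using eqv_trans[OF ij(1) ij(2) _ e] eqv_trans[OF ij(2) ij(1) _ eqv_sym[OF e]] by blast
  qed
  have "|total| <o \<kappa>"
    by (rule small_Sigma[OF U small_P]) (use F_Obj in \<open>simp add: Obj_OS\<close>)
  then have "|cls ` total| <o \<kappa>" by (rule small_image[OF U])
  then obtain enc :: "('u \<times> 'u) set \<Rightarrow> 'u" where enc: "inj_on enc (cls ` total)"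
    by (rule universe_copy[OF U])
  have *: "enc (cls (p, x)) = enc (cls (q, y)) \<longleftrightarrow> (\<exists>s. (p, s) \<in> r \<and> (q, s) \<in> r \<and> tr p s x = tr q s y)"
    if "p \<in> P" "q \<in> P" "x \<in> carrier (F p)" "y \<in> carrier (F q)" for p q x y
  proof -
    have t: "(p, x) \<in> total" "(q, y) \<in> total" using that by auto
    then have "enc (cls (p, x)) = enc (cls (q, y)) \<longleftrightarrow> cls (p, x) = cls (q, y)"
      by (intro inj_on_eq_iff[OF enc] imageI)
    then show ?thesis using cls[OF t] by (simp add: eqv_def)
  qed
  show ?thesis by (intro exI[of _ "\<lambda>p x. enc (cls (p, x))"] ballI *)
qed

end

locale algebraic_colimit = directed_system \<kappa> P r F Fm
  for \<kappa> :: "'u rel" and P :: "'u set" and r :: "'u rel" and F :: "'u \<Rightarrow> 'u opspace"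
    and Fm :: "'u \<times> 'u \<Rightarrow> 'u opspace \<times> ('u \<Rightarrow> 'u) \<times> 'u opspace" +
  fixes \<iota> :: "'u \<Rightarrow> 'u \<Rightarrow> 'u"
  assumes \<iota>_eq: "p \<in> P \<Longrightarrow> q \<in> P \<Longrightarrow> x \<in> carrier (F p) \<Longrightarrow> y \<in> carrier (F q) \<Longrightarrow>
    \<iota> p x = \<iota> q y \<longleftrightarrow> (\<exists>s. (p, s) \<in> r \<and> (q, s) \<in> r \<and> tr p s x = tr q s y)"
begin

text \<open>Results are chosen among those computed at any stage where the arguments have
  representatives; \<open>\<iota>_zero\<close>, \<open>\<iota>_add\<close> and
  \<open>\<iota>_smult\<close> show that the choice is immaterial.\<close>

definition colim :: "'u opspace" where
  "colim = \<lparr>carrier = (\<Union>p\<in>P. \<iota> p ` carrier (F p)), mult = undefined, one = undefined,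
     zero = (SOME d. \<exists>p\<in>P. d = \<iota> p \<zero>\<^bsub>F p\<^esub>),
     add = (\<lambda>a b. SOME d. \<exists>p\<in>P. \<exists>x\<in>carrier (F p). \<exists>y\<in>carrier (F p).
       a = \<iota> p x \<and> b = \<iota> p y \<and> d = \<iota> p (x \<oplus>\<^bsub>F p\<^esub> y)),
     smult = (\<lambda>k a. SOME d. \<exists>p\<in>P. \<exists>x\<in>carrier (F p). a = \<iota> p x \<and> d = \<iota> p (k \<odot>\<^bsub>F p\<^esub> x)),
     mnorm = (\<lambda>n y. Inf {mnorm (F p) n x |p x. p \<in> P \<and> x \<in> Mats n (F p) \<and> map_mat (\<iota> p) x = y})\<rparr>"

lemma colim_carrier: "a \<in> carrier colim \<longleftrightarrow> (\<exists>p\<in>P. \<exists>x\<in>carrier (F p). a = \<iota> p x)"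
  by (auto simp: colim_def)

lemma \<iota>_closed: "p \<in> P \<Longrightarrow> x \<in> carrier (F p) \<Longrightarrow> \<iota> p x \<in> carrier colim"
  by (auto simp: colim_carrier)

text \<open>The empty set is countable and therefore has an upper bound in \<open>P\<close>.\<close>

lemma P_nonempty: "\<exists>p. p \<in> P"
  using directed_countable[OF dir, of "{}"] by auto

lemma \<iota>_tr:
  assumes pq: "(p, q) \<in> r" and x: "x \<in> carrier (F p)"
  shows "\<iota> q (tr p q x) = \<iota> p x"
proof -
  note q = ord(2)[OF pq] and y = tr_closed[OF pq x]
  have "tr q q (tr p q x) = tr p q x" by (rule tr_refl[OF q y])
  then show ?thesis using \<iota>_eq[OF q ord(1)[OF pq] y x] ord(3)[OF q] pq by blast
qed

lemma \<iota>_zero: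
  assumes "p \<in> P" shows "\<iota> p \<zero>\<^bsub>F p\<^esub> = \<zero>\<^bsub>colim\<^esub>"
proof -
  have "\<exists>d. \<exists>p\<in>P. d = \<iota> p \<zero>\<^bsub>F p\<^esub>" using assms by blast
  from someI_ex[OF this] obtain q where q: "q \<in> P" "\<zero>\<^bsub>colim\<^esub> = \<iota> q \<zero>\<^bsub>F q\<^esub>" by (auto simp: colim_def)
  obtain b where b: "(p, b) \<in> r" "(q, b) \<in> r" using directed_pair[OF dir assms q(1)] by blast
  have "\<iota> p \<zero>\<^bsub>F p\<^esub> = \<iota> q \<zero>\<^bsub>F q\<^esub>"
    using b assms q by (subst \<iota>_eq) (auto simp: F_cvs cvs_zero clinear_zero[OF tr_lin])
  then show ?thesis using q by simp
qed

lemma \<iota>_add: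
  assumes p: "p \<in> P" and xy: "x \<in> carrier (F p)" "y \<in> carrier (F p)"
  shows "\<iota> p (x \<oplus>\<^bsub>F p\<^esub> y) = \<iota> p x \<oplus>\<^bsub>colim\<^esub> \<iota> p y"
proof -
  have "\<exists>d. \<exists>q\<in>P. \<exists>x'\<in>carrier (F q). \<exists>y'\<in>carrier (F q).
      \<iota> p x = \<iota> q x' \<and> \<iota> p y = \<iota> q y' \<and> d = \<iota> q (x' \<oplus>\<^bsub>F q\<^esub> y')"
    using assms by blast
  from someI_ex[OF this] obtain q x' y' where q: "q \<in> P" "x' \<in> carrier (F q)" "y' \<in> carrier (F q)"
      "\<iota> p x = \<iota> q x'" "\<iota> p y = \<iota> q y'" "\<iota> p x \<oplus>\<^bsub>colim\<^esub> \<iota> p y = \<iota> q (x' \<oplus>\<^bsub>F q\<^esub> y')"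
    by (auto simp: colim_def)
  obtain s where s: "(p, s) \<in> r" "(q, s) \<in> r" "tr p s x = tr q s x'"
    using q(4) \<iota>_eq[OF p q(1) xy(1) q(2)] by blast
  obtain t where t: "(p, t) \<in> r" "(q, t) \<in> r" "tr p t y = tr q t y'"
    using q(5) \<iota>_eq[OF p q(1) xy(2) q(3)] by blast
  \<comment> \<open>The two equalities hold at the stages \<open>s\<close> and \<open>t\<close>,
    hence both at a common later stage, where the sums can be compared.\<close>
  obtain b where b: "(s, b) \<in> r" "(t, b) \<in> r"
    using directed_pair[OF dir ord(2)[OF s(1)] ord(2)[OF t(1)]] by blast
  have pb: "(p, b) \<in> r" and qb: "(q, b) \<in> r" using s b ord(4) by blast+
  have "tr p b (x \<oplus>\<^bsub>F p\<^esub> y) = tr q b (x' \<oplus>\<^bsub>F q\<^esub> y')"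
    using tr_eq_mono[OF s b(1) xy(1) q(2)] tr_eq_mono[OF t b(2) xy(2) q(3)]
    by (simp add: clinear_add[OF tr_lin[OF pb] xy] clinear_add[OF tr_lin[OF qb] q(2,3)])
  then have "\<iota> p (x \<oplus>\<^bsub>F p\<^esub> y) = \<iota> q (x' \<oplus>\<^bsub>F q\<^esub> y')"
    using pb qb p q xy by (subst \<iota>_eq) (auto simp: F_cvs cvs_add)
  then show ?thesis using q by simp
qed

lemma \<iota>_smult:
  assumes p: "p \<in> P" and x: "x \<in> carrier (F p)"
  shows "\<iota> p (k \<odot>\<^bsub>F p\<^esub> x) = k \<odot>\<^bsub>colim\<^esub> \<iota> p x"
proof -
  have "\<exists>d. \<exists>q\<in>P. \<exists>x'\<in>carrier (F q). \<iota> p x = \<iota> q x' \<and> d = \<iota> q (k \<odot>\<^bsub>F q\<^esub> x')"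
    using assms by blast
  from someI_ex[OF this] obtain q x' where q: "q \<in> P" "x' \<in> carrier (F q)"
      "\<iota> p x = \<iota> q x'" "k \<odot>\<^bsub>colim\<^esub> \<iota> p x = \<iota> q (k \<odot>\<^bsub>F q\<^esub> x')"
    by (auto simp: colim_def)
  obtain s where s: "(p, s) \<in> r" "(q, s) \<in> r" "tr p s x = tr q s x'"
    using q(3) \<iota>_eq[OF p q(1) x q(2)] by blast
  then have "tr p s (k \<odot>\<^bsub>F p\<^esub> x) = tr q s (k \<odot>\<^bsub>F q\<^esub> x')"
    by (simp add: clinear_smult[OF tr_lin[OF s(1)] x] clinear_smult[OF tr_lin[OF s(2)] q(2)])
  then have "\<iota> p (k \<odot>\<^bsub>F p\<^esub> x) = \<iota> q (k \<odot>\<^bsub>F q\<^esub> x')"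
    using s p q x by (subst \<iota>_eq) (auto simp: F_cvs cvs_smult)
  then show ?thesis using q by simp
qed

text \<open>Each term comes from some stage, and countable directedness gives a stage above all of
  these. Triples and matrices will be treated as sequences too.\<close>

lemma lift_sequence:
  fixes a :: "nat \<Rightarrow> 'u"
  assumes "\<And>k. a k \<in> carrier colim"
  shows "\<exists>p\<in>P. \<exists>x. \<forall>k. x k \<in> carrier (F p) \<and> \<iota> p (x k) = a k"
proof -
  have "\<exists>q. \<exists>y. q \<in> P \<and> y \<in> carrier (F q) \<and> a k = \<iota> q y" for k
    using assms[of k] by (auto simp: colim_carrier)
  then obtain q y where q: "\<And>k. q k \<in> P" "\<And>k. y k \<in> carrier (F (q k))" "\<And>k. a k = \<iota> (q k) (y k)"
    by metis
  obtain b where b: "b \<in> P" "\<And>k. (q k, b) \<in> r"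
    using directed_countable[OF dir, of "range q"] q(1) by auto
  show ?thesis
  proof (intro bexI[OF _ b(1)] exI allI conjI)
    fix k
    show "tr (q k) b (y k) \<in> carrier (F b)" by (rule tr_closed[OF b(2) q(2)])
    show "\<iota> b (tr (q k) b (y k)) = a k" using \<iota>_tr[OF b(2) q(2)] q(3) by simp
  qed
qed

lemma cvs_colim: "cvs colim"
proof (rule cvs_lift)
  obtain p where p: "p \<in> P" using P_nonempty by blast
  from \<iota>_closed[OF p, of "\<zero>\<^bsub>F p\<^esub>"] show "\<zero>\<^bsub>colim\<^esub> \<in> carrier colim"
    using p by (simp add: \<iota>_zero F_cvs cvs_zero)
  fix a b c assume abc: "a \<in> carrier colim" "b \<in> carrier colim" "c \<in> carrier colim"
  \<comment> \<open>Three elements are written as a sequence that is constant from index 2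
    on.\<close>
  let ?s = "\<lambda>k :: nat. if k = 0 then a else if k = 1 then b else c"
  have "?s k \<in> carrier colim" for k using abc by simp
  from lift_sequence[of ?s, OF this] obtain p x where p: "p \<in> P"
    and x: "\<And>k. x k \<in> carrier (F p) \<and> \<iota> p (x k) = ?s k" by blast
  have "{a, b, c} \<subseteq> \<iota> p ` carrier (F p)"
    using x[of 0] x[of 1] x[of 2] by auto
  then show "\<exists>(X :: 'u opspace) \<psi>. cvs X \<and>
      (\<forall>x\<in>carrier X. \<psi> x \<in> carrier colim) \<and> \<psi> \<zero>\<^bsub>X\<^esub> = \<zero>\<^bsub>colim\<^esub> \<and>
      (\<forall>x\<in>carrier X. \<forall>y\<in>carrier X. \<psi> (x \<oplus>\<^bsub>X\<^esub> y) = \<psi> x \<oplus>\<^bsub>colim\<^esub> \<psi> y) \<and>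
      (\<forall>k. \<forall>x\<in>carrier X. \<psi> (k \<odot>\<^bsub>X\<^esub> x) = k \<odot>\<^bsub>colim\<^esub> \<psi> x) \<and> {a, b, c} \<subseteq> \<psi> ` carrier X"
    using p by (intro exI[of _ "F p"] exI[of _ "\<iota> p"]) (simp add: F_cvs \<iota>_closed \<iota>_zero \<iota>_add \<iota>_smult)
qed

lemma clinear_\<iota>: "p \<in> P \<Longrightarrow> clinear (F p) colim (\<iota> p)"
  by (simp add: clinear_iff cvs_colim F_cvs \<iota>_closed \<iota>_add \<iota>_smult)

lemma lift_mat:
  assumes y: "y \<in> Mats n colim"
  shows "\<exists>p\<in>P. \<exists>x\<in>Mats n (F p). map_mat (\<iota> p) x = y"
proof -
  \<comment> \<open>The entries are enumerated by the pairing function; codes of positions outside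
    the matrix get zero, so that every term lies in the carrier.\<close>
  let ?a = "\<lambda>k. case prod_decode k of (i, j) \<Rightarrow> if i < n \<and> j < n then y $$ (i, j) else \<zero>\<^bsub>colim\<^esub>"
  have "?a k \<in> carrier colim" for k
    using y cvs_colim by (auto simp: Mats_iff cvs_zero split: prod.split)
  from lift_sequence[of ?a, OF this] obtain p x where p: "p \<in> P"
    and x: "\<And>k. x k \<in> carrier (F p) \<and> \<iota> p (x k) = ?a k" by blast
  show ?thesis
  proof (intro bexI[OF _ p] bexI)
    let ?x = "mat n n (\<lambda>ij. x (prod_encode ij))"
    show "?x \<in> Mats n (F p)" using x by (simp add: Mats_iff)
    show "map_mat (\<iota> p) ?x = y" using x y by (auto simp: Mats_iff mat_eq_iff)
  qed
qed

lemma map_tr_trans: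
  "(p, q) \<in> r \<Longrightarrow> (q, s) \<in> r \<Longrightarrow> x \<in> Mats n (F p) \<Longrightarrow> map_mat (tr q s) (map_mat (tr p q) x) = map_mat (tr p s) x"
  by (auto simp: Mats_iff mat_eq_iff tr_trans)

lemma map_\<iota>_tr: "(p, q) \<in> r \<Longrightarrow> x \<in> Mats n (F p) \<Longrightarrow> map_mat (\<iota> q) (map_mat (tr p q) x) = map_mat (\<iota> p) x"
  by (auto simp: Mats_iff mat_eq_iff \<iota>_tr)

lemma Mats_tr: "(p, q) \<in> r \<Longrightarrow> x \<in> Mats n (F p) \<Longrightarrow> map_mat (tr p q) x \<in> Mats n (F q)"
  by (rule Mats_map[OF tr_lin])

text \<open>Every pair of corresponding entries is identified at some stage, and these finitely many
  stages have an upper bound.\<close>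

lemma map_\<iota>_eq:
  assumes p: "p \<in> P" "p' \<in> P" and x: "x \<in> Mats n (F p)" "x' \<in> Mats n (F p')"
    and eq: "map_mat (\<iota> p) x = map_mat (\<iota> p') x'"
  shows "\<exists>s. (p, s) \<in> r \<and> (p', s) \<in> r \<and> map_mat (tr p s) x = map_mat (tr p' s) x'"
proof -
  have xc: "x $$ ij \<in> carrier (F p)" "x' $$ ij \<in> carrier (F p')" if "ij \<in> {..<n} \<times> {..<n}" for ij
    using that x by (auto simp: Mats_iff)
  have "\<exists>s. (p, s) \<in> r \<and> (p', s) \<in> r \<and> tr p s (x $$ ij) = tr p' s (x' $$ ij)" if ij: "ij \<in> {..<n} \<times> {..<n}" for ij
  proof -
    have "map_mat (\<iota> p) x $$ ij = map_mat (\<iota> p') x' $$ ij" using eq by simp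
    then have "\<iota> p (x $$ ij) = \<iota> p' (x' $$ ij)" using x ij by (auto simp: Mats_iff)
    then show ?thesis using \<iota>_eq[OF p xc(1)[OF ij] xc(2)[OF ij]] by simp
  qed
  then obtain s where s: "\<And>ij. ij \<in> {..<n} \<times> {..<n} \<Longrightarrow>
      (p, s ij) \<in> r \<and> (p', s ij) \<in> r \<and> tr p (s ij) (x $$ ij) = tr p' (s ij) (x' $$ ij)"
    by metis
  \<comment> \<open>\<open>p\<close> and \<open>p'\<close> are inserted so that the bound lies above
    them also when \<open>n\<close> is zero.\<close>
  have "insert p (insert p' (s ` ({..<n} \<times> {..<n}))) \<subseteq> P" using s p ord(2) by blast
  then obtain b where b: "(p, b) \<in> r" "(p', b) \<in> r" "\<And>ij. ij \<in> {..<n} \<times> {..<n} \<Longrightarrow> (s ij, b) \<in> r"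
    using directed_countable[OF dir, of "insert p (insert p' (s ` ({..<n} \<times> {..<n})))"]
    by (auto simp: countable_finite)
  have "tr p b (x $$ ij) = tr p' b (x' $$ ij)" if ij: "ij \<in> {..<n} \<times> {..<n}" for ij
    using s[OF ij] tr_eq_mono[OF _ _ _ b(3)[OF ij] xc(1)[OF ij] xc(2)[OF ij]] by blast
  then have "map_mat (tr p b) x = map_mat (tr p' b) x'"
    using x by (auto simp: Mats_iff mat_eq_iff)
  then show ?thesis using b by blast
qed

lemma mnorm_colim: "mnorm colim n y = Inf {mnorm (F p) n x |p x. p \<in> P \<and> x \<in> Mats n (F p) \<and> map_mat (\<iota> p) x = y}"
  by (simp add: colim_def)

lemma mnorm_colim_le:
  assumes n: "1 \<le> n" and "p \<in> P" "x \<in> Mats n (F p)"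
  shows "mnorm colim n (map_mat (\<iota> p) x) \<le> mnorm (F p) n x"
  unfolding mnorm_colim
proof (rule cInf_lower)
  show "bdd_below {mnorm (F q) n z |q z. q \<in> P \<and> z \<in> Mats n (F q) \<and> map_mat (\<iota> q) z = map_mat (\<iota> p) x}"
    using os_nonneg[OF F_os n] by (intro bdd_belowI[of _ 0]) auto
qed (use assms in blast)

lemma cc_\<iota>: "p \<in> P \<Longrightarrow> complete_contraction (F p) colim (\<iota> p)"
  by (simp add: complete_contraction_def mnorm_colim_le)

text \<open>Since the index set is countably directed, the infimum in the definition of the norm is attained.\<close>

lemma mnorm_colim_attained:
  assumes n: "1 \<le> n" and p: "p \<in> P" and x: "x \<in> Mats n (F p)"
  shows "\<exists>q. (p, q) \<in> r \<and> (\<forall>s. (q, s) \<in> r \<longrightarrow> mnorm (F s) n (map_mat (tr p s) x) = mnorm colim n (map_mat (\<iota> p) x))"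
proof -
  let ?N = "mnorm colim n (map_mat (\<iota> p) x)"
  have ge: "?N \<le> mnorm (F s) n (map_mat (tr p s) x)" if "(p, s) \<in> r" for s
    using mnorm_colim_le[OF n ord(2)[OF that] Mats_tr[OF that x]] map_\<iota>_tr[OF that x] by simp
  \<comment> \<open>A representative of almost minimal norm becomes equal to the image of
    \<open>x\<close> at a later stage, and its norm has not grown on the way.\<close>
  have "\<exists>s. (p, s) \<in> r \<and> mnorm (F s) n (map_mat (tr p s) x) < ?N + inverse (Suc k)" for k
  proof -
    have "Inf {mnorm (F q) n z |q z. q \<in> P \<and> z \<in> Mats n (F q) \<and> map_mat (\<iota> q) z = map_mat (\<iota> p) x} < ?N + inverse (Suc k)"
      unfolding mnorm_colim[symmetric] by simp
    from cInf_lessD[OF _ this] p x obtain q z where q: "q \<in> P" "z \<in> Mats n (F q)"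
        "map_mat (\<iota> q) z = map_mat (\<iota> p) x" "mnorm (F q) n z < ?N + inverse (Suc k)" by blast
    obtain s where s: "(p, s) \<in> r" "(q, s) \<in> r" "map_mat (tr p s) x = map_mat (tr q s) z"
      using map_\<iota>_eq[OF p q(1) x q(2) q(3)[symmetric]] by blast
    have "mnorm (F s) n (map_mat (tr q s) z) \<le> mnorm (F q) n z"
      by (rule cc_D[OF tr_cc[OF s(2)] n q(2)])
    then show ?thesis using s q(4) by (intro exI[of _ s]) simp
  qed
  then obtain s where s: "\<And>k. (p, s k) \<in> r" "\<And>k. mnorm (F (s k)) n (map_mat (tr p (s k)) x) < ?N + inverse (Suc k)"
    by metis
  have "range s \<subseteq> P" using s(1) ord(2) by blast
  \<comment> \<open>Beyond all the \<open>s k\<close> the norm is at most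
    \<open>?N + inverse (Suc k)\<close> for every \<open>k\<close>, and it is never below
    \<open>?N\<close>. That this persists at all later stages lets several norms be attained at
    once.\<close>
  then obtain q where q: "q \<in> P" "\<And>k. (s k, q) \<in> r"
    using directed_countable[OF dir, of "range s"] by auto
  have pq: "(p, q) \<in> r" using ord(4)[OF s(1) q(2)] .
  show ?thesis
  proof (intro exI[of _ q] conjI pq allI impI)
    fix t assume t: "(q, t) \<in> r"
    have pt: "(p, t) \<in> r" using ord(4)[OF pq t] .
    have "mnorm (F t) n (map_mat (tr p t) x) \<le> ?N + inverse (Suc k)" for k
    proof -
      have "(s k, t) \<in> r" using ord(4)[OF q(2) t] .
      from cc_D[OF tr_cc[OF this] n Mats_tr[OF s(1) x]] map_tr_trans[OF s(1) this x] s(2)[of k]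
      show ?thesis by simp
    qed
    moreover have "(\<lambda>k. ?N + inverse (real (Suc k))) \<longlonglongrightarrow> ?N + 0"
      by (intro tendsto_add tendsto_const LIMSEQ_inverse_real_of_nat)
    ultimately have "mnorm (F t) n (map_mat (tr p t) x) \<le> ?N + 0"
      by (intro LIMSEQ_le_const[of _ "?N + 0"]) auto
    then show "mnorm (F t) n (map_mat (tr p t) x) = ?N" using ge[OF pt] by simp
  qed
qed

text \<open>\<open>operator_space_lift\<close> is fed with a stage at which all norms in question
  are attained: three of them for two matrices and their direct sum, and those of all differences of
  terms for a sequence.\<close>

lemma operator_space_colim: "operator_space colim"
proof (rule operator_space_lift[OF cvs_colim])
  fix m n :: nat and x y
  assume mn: "1 \<le> m" "1 \<le> n" and x: "x \<in> Mats m colim" and y: "y \<in> Mats n colim"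
  obtain p a where p: "p \<in> P" "a \<in> Mats m (F p)" "map_mat (\<iota> p) a = x" using lift_mat[OF x] by blast
  obtain q b where q: "q \<in> P" "b \<in> Mats n (F q)" "map_mat (\<iota> q) b = y" using lift_mat[OF y] by blast
  obtain s where s: "s \<in> P" "(p, s) \<in> r" "(q, s) \<in> r" using directed_pair[OF dir p(1) q(1)] by blast
  let ?a = "map_mat (tr p s) a" and ?b = "map_mat (tr q s) b"
  let ?c = "direct_sum_mat (F s) m n ?a ?b"
  have a: "?a \<in> Mats m (F s)" "map_mat (\<iota> s) ?a = x" and b: "?b \<in> Mats n (F s)" "map_mat (\<iota> s) ?b = y"
    using p q s by (auto simp: Mats_tr map_\<iota>_tr)
  have c: "?c \<in> Mats (m + n) (F s)" by (rule Mats_direct_sum[OF F_cvs[OF s(1)] a(1) b(1)])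
  have cc: "map_mat (\<iota> s) ?c = direct_sum_mat colim m n x y"
    using map_direct_sum[OF clinear_\<iota>[OF s(1)] a(1) b(1)] a(2) b(2) by simp
  obtain t1 where t1: "(s, t1) \<in> r" "\<And>t. (t1, t) \<in> r \<Longrightarrow> mnorm (F t) m (map_mat (tr s t) ?a) = mnorm colim m x"
    using mnorm_colim_attained[OF mn(1) s(1) a(1)] a(2) by auto
  obtain t2 where t2: "(s, t2) \<in> r" "\<And>t. (t2, t) \<in> r \<Longrightarrow> mnorm (F t) n (map_mat (tr s t) ?b) = mnorm colim n y"
    using mnorm_colim_attained[OF mn(2) s(1) b(1)] b(2) by auto
  obtain t3 where t3: "(s, t3) \<in> r" "\<And>t. (t3, t) \<in> r \<Longrightarrow>
      mnorm (F t) (m + n) (map_mat (tr s t) ?c) = mnorm colim (m + n) (direct_sum_mat colim m n x y)"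
    using mnorm_colim_attained[OF _ s(1) c] mn(1) cc by auto
  \<comment> \<open>Attainment persists at later stages, so the three stages can be merged into
    one.\<close>
  obtain t where t: "t \<in> P" "(t1, t) \<in> r" "(t2, t) \<in> r" "(t3, t) \<in> r"
    using directed_countable[OF dir, of "{t1, t2, t3}"] t1(1) t2(1) t3(1) ord(2) by auto
  have st: "(s, t) \<in> r" using ord(4)[OF t1(1) t(2)] .
  show "\<exists>(X :: 'u opspace) \<psi> a b. operator_space X \<and> clinear X colim \<psi> \<and> complete_contraction X colim \<psi> \<and>
      a \<in> Mats m X \<and> b \<in> Mats n X \<and> map_mat \<psi> a = x \<and> map_mat \<psi> b = y \<and>
      mnorm X m a = mnorm colim m x \<and> mnorm X n b = mnorm colim n y \<and>
      mnorm X (m + n) (direct_sum_mat X m n a b) = mnorm colim (m + n) (direct_sum_mat colim m n x y)"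
    using t t1(2)[OF t(2)] t2(2)[OF t(3)] t3(2)[OF t(4)] a b
    by (intro exI[of _ "F t"] exI[of _ "\<iota> t"] exI[of _ "map_mat (tr s t) ?a"] exI[of _ "map_mat (tr s t) ?b"])
      (simp add: F_os clinear_\<iota> cc_\<iota> Mats_tr[OF st] map_\<iota>_tr[OF st] map_direct_sum[OF tr_lin[OF st]])
next
  fix \<sigma> :: "nat \<Rightarrow> 'u"
  assume "range \<sigma> \<subseteq> carrier colim"
  then have "\<And>k. \<sigma> k \<in> carrier colim" by blast
  from lift_sequence[of \<sigma>, OF this] obtain p x where p: "p \<in> P" and x: "\<And>k. x k \<in> carrier (F p)" "\<And>k. \<iota> p (x k) = \<sigma> k"
    by blast
  \<comment> \<open>Distances between terms are treated as norms of 1 by 1 matrices; there are only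
    countably many pairs of indices, so one stage serves them all.\<close>
  let ?d = "\<lambda>k l. mat 1 1 (\<lambda>_. x k \<ominus>\<^bsub>F p\<^esub> x l)"
  have d: "?d k l \<in> Mats 1 (F p)" for k l using x(1) p by (simp add: Mats_iff F_cvs cvs_minus)
  have "\<exists>q. (p, q) \<in> r \<and> (\<forall>s. (q, s) \<in> r \<longrightarrow>
      mnorm (F s) 1 (map_mat (tr p s) (?d k l)) = mnorm colim 1 (map_mat (\<iota> p) (?d k l)))" for k l
    by (rule mnorm_colim_attained[OF order_refl p d])
  then obtain q where q: "\<And>k l. (p, q k l) \<in> r" "\<And>k l s. (q k l, s) \<in> r \<Longrightarrow>
      mnorm (F s) 1 (map_mat (tr p s) (?d k l)) = mnorm colim 1 (map_mat (\<iota> p) (?d k l))"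
    by metis
  have "range (case_prod q) \<subseteq> P" using ord(2)[OF q(1)] by auto
  then obtain s where s: "s \<in> P" "\<And>k l. (q k l, s) \<in> r"
    using directed_countable[OF dir, of "range (case_prod q)"] by auto
  have ps: "(p, s) \<in> r" using ord(4)[OF q(1) s(2)] .
  have "nrm (F s) (tr p s (x k) \<ominus>\<^bsub>F s\<^esub> tr p s (x l)) = nrm colim (\<sigma> k \<ominus>\<^bsub>colim\<^esub> \<sigma> l)" for k l
    using q(2)[OF s(2), of k l] x
    by (simp add: nrm_def single_map clinear_minus[OF tr_lin[OF ps]] clinear_minus[OF clinear_\<iota>[OF p]] del: One_nat_def)
  then show "\<exists>(X :: 'u opspace) \<psi> \<tau>. operator_space X \<and> clinear X colim \<psi> \<and> complete_contraction X colim \<psi> \<and>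
      range \<tau> \<subseteq> carrier X \<and> (\<forall>p. \<psi> (\<tau> p) = \<sigma> p) \<and>
      (\<forall>p q. nrm X (\<tau> p \<ominus>\<^bsub>X\<^esub> \<tau> q) = nrm colim (\<sigma> p \<ominus>\<^bsub>colim\<^esub> \<sigma> q))"
    using s(1) x tr_closed[OF ps]
    by (intro exI[of _ "F s"] exI[of _ "\<iota> s"] exI[of _ "\<lambda>k. tr p s (x k)"])
      (auto simp: F_os clinear_\<iota> cc_\<iota> \<iota>_tr[OF ps])
qed

lemma colim_Obj: "colim \<in> Obj (OS \<kappa>)"
proof -
  have "|carrier (F p)| <o \<kappa>" if "p \<in> P" for p using F_Obj[OF that] by (simp add: Obj_OS)
  then have "|carrier colim| <o \<kappa>"
    unfolding colim_def by (simp add: small_UN[OF U small_P] small_image[OF U])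
  then show ?thesis by (simp add: Obj_OS operator_space_colim)
qed

definition inc :: "'u \<Rightarrow> 'u opspace \<times> ('u \<Rightarrow> 'u) \<times> 'u opspace" where
  "inc p = (F p, restrict (\<iota> p) (carrier (F p)), colim)"

lemma inc_Hom: "p \<in> P \<Longrightarrow> inc p \<in> Hom (OS \<kappa>) (F p) colim"
  unfolding inc_def by (intro Hom_OS_I F_Obj colim_Obj clinear_\<iota> cc_\<iota>)

lemma cocone_colim: "cocone (poset_cat P r) (OS \<kappa>) F Fm colim inc"
  unfolding cocone_def poset_cat_simps
proof (intro conjI ballI colim_Obj inc_Hom)
  fix f assume "f \<in> r"
  then obtain p q where f: "f = (p, q)" and pq: "(p, q) \<in> r" by (cases f) auto
  have "Cmp (OS \<kappa>) (inc q) (Fm (p, q)) = inc p"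
    by (rule Hom_OS_eqI[OF comp_Hom_OS[OF Fm_Hom[OF pq] inc_Hom[OF ord(2)[OF pq]]] inc_Hom[OF ord(1)[OF pq]]])
      (simp add: app_Cmp[OF Fm_Hom[OF pq]] inc_def \<iota>_tr[OF pq] tr_closed[OF pq])
  then show "Cmp (OS \<kappa>) (inc (snd f)) (Fm f) = inc (fst f)" by (simp add: f)
qed

text \<open>Values are computed from any representative. The map is contractive because every matrix
  over the colimit has a representative of the same norm.\<close>

lemma colim_map:
  assumes coc: "cocone (poset_cat P r) (OS \<kappa>) F Fm L \<psi>"
  shows "\<exists>k\<in>Hom (OS \<kappa>) colim L. \<forall>p\<in>P. \<forall>x\<in>carrier (F p). app k (\<iota> p x) = app (\<psi> p) x"
proof -
  have \<psi>: "\<psi> p \<in> Hom (OS \<kappa>) (F p) L" if "p \<in> P" for p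
    using cocone_OS_D(2)[OF coc] that by simp
  have L: "L \<in> Obj (OS \<kappa>)" by (rule cocone_OS_D(1)[OF coc])
  have \<psi>_tr: "app (\<psi> q) (tr p q x) = app (\<psi> p) x" if pq: "(p, q) \<in> r" and x: "x \<in> carrier (F p)" for p q x
    using cocone_OS_D(3)[OF coc, of "(p, q)"] pq app_Cmp[OF Fm_Hom[OF pq] x, of "\<psi> q"] by simp
  define k where "k a = (SOME l. \<exists>p\<in>P. \<exists>x\<in>carrier (F p). a = \<iota> p x \<and> l = app (\<psi> p) x)" for a
  have k: "k (\<iota> p x) = app (\<psi> p) x" if p: "p \<in> P" and x: "x \<in> carrier (F p)" for p x
  proof -
    have "\<exists>l. \<exists>q\<in>P. \<exists>y\<in>carrier (F q). \<iota> p x = \<iota> q y \<and> l = app (\<psi> q) y" using p x by blast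
    from someI_ex[OF this] obtain q y where q: "q \<in> P" "y \<in> carrier (F q)" "\<iota> p x = \<iota> q y" "k (\<iota> p x) = app (\<psi> q) y"
      by (auto simp: k_def)
    obtain s where s: "(p, s) \<in> r" "(q, s) \<in> r" "tr p s x = tr q s y"
      using q(3) \<iota>_eq[OF p q(1) x q(2)] by blast
    then show ?thesis using \<psi>_tr[OF s(1) x] \<psi>_tr[OF s(2) q(2)] q(4) by simp
  qed
  have lin: "clinear colim L k"
    unfolding clinear_iff
  proof (intro conjI allI ballI cvs_colim)
    show "cvs L" using L by (simp add: Obj_OS os_cvs)
    fix a assume a: "a \<in> carrier colim"
    then obtain p x where p: "p \<in> P" "x \<in> carrier (F p)" "a = \<iota> p x" by (auto simp: colim_carrier)
    note l = Hom_OS_clinear[OF \<psi>[OF p(1)]]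
    show "k a \<in> carrier L" using p l by (simp add: k clinear_closed)
    show "k (c \<odot>\<^bsub>colim\<^esub> a) = c \<odot>\<^bsub>L\<^esub> k a" for c
      using p by (simp add: k F_cvs cvs_smult clinear_smult[OF l] flip: \<iota>_smult)
    fix b assume "b \<in> carrier colim"
    then obtain q y where q: "q \<in> P" "y \<in> carrier (F q)" "b = \<iota> q y" by (auto simp: colim_carrier)
    obtain s where s: "s \<in> P" "(p, s) \<in> r" "(q, s) \<in> r" using directed_pair[OF dir p(1) q(1)] by blast
    have ab: "a = \<iota> s (tr p s x)" "b = \<iota> s (tr q s y)" using p q s by (simp_all add: \<iota>_tr)
    have mem: "tr p s x \<in> carrier (F s)" "tr q s y \<in> carrier (F s)" using p q s by (simp_all add: tr_closed)
    show "k (a \<oplus>\<^bsub>colim\<^esub> b) = k a \<oplus>\<^bsub>L\<^esub> k b"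
      unfolding ab using mem s(1) Hom_OS_clinear[OF \<psi>[OF s(1)]]
      by (simp add: k F_cvs cvs_add clinear_add flip: \<iota>_add)
  qed
  have "complete_contraction colim L k"
    unfolding complete_contraction_def
  proof (intro allI impI ballI)
    fix n :: nat and y assume n: "1 \<le> n" and y: "y \<in> Mats n colim"
    obtain p x where p: "p \<in> P" "x \<in> Mats n (F p)" "map_mat (\<iota> p) x = y" using lift_mat[OF y] by blast
    obtain q where q: "(p, q) \<in> r" "\<forall>s. (q, s) \<in> r \<longrightarrow> mnorm (F s) n (map_mat (tr p s) x) = mnorm colim n y"
      using mnorm_colim_attained[OF n p(1,2)] p(3) by auto
    note Q = ord(2)[OF q(1)]
    have x': "map_mat (tr p q) x \<in> Mats n (F q)" by (rule Mats_tr[OF q(1) p(2)])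
    have "map_mat k y = map_mat (app (\<psi> q)) (map_mat (tr p q) x)"
      using p(2) by (auto simp: mat_eq_iff Mats_iff k[OF p(1)] \<psi>_tr[OF q(1)] simp flip: p(3))
    then have "mnorm L n (map_mat k y) \<le> mnorm (F q) n (map_mat (tr p q) x)"
      using cc_D[OF Hom_OS_cc[OF \<psi>[OF Q]] n x'] by simp
    then show "mnorm L n (map_mat k y) \<le> mnorm colim n y" using q(2) ord(3)[OF Q] by simp
  qed
  then have "(colim, restrict k (carrier colim), L) \<in> Hom (OS \<kappa>) colim L"
    by (intro Hom_OS_I colim_Obj L lin)
  then show ?thesis by (rule bexI[rotated]) (simp add: k \<iota>_closed)
qed

end

section \<open>Matrices over an arbitrary colimit of the system\<close>

context directed_system
begin

text \<open>An arbitrary colimit \<open>L\<close> is compared with the algebraic one by morphisms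
  \<open>h\<close> to it and \<open>k\<close> back with \<open>k h = id\<close>. A matrix over
  \<open>L\<close> is lifted by lifting its image under \<open>h\<close>, and equality is likewise
  tested after \<open>h\<close>.\<close>

lemma colimit_lifts:
  assumes col: "colimit (poset_cat P r) (OS \<kappa>) F Fm L \<psi>"
  shows colimit_lift_mat: "1 \<le> n \<Longrightarrow> y \<in> Mats n L \<Longrightarrow>
      \<exists>p\<in>P. \<exists>x\<in>Mats n (F p). map_mat (app (\<psi> p)) x = y \<and> mnorm (F p) n x \<le> mnorm L n y"
    and colimit_eq_mat: "p \<in> P \<Longrightarrow> x \<in> Mats n (F p) \<Longrightarrow> x' \<in> Mats n (F p) \<Longrightarrow>
      map_mat (app (\<psi> p)) x = map_mat (app (\<psi> p)) x' \<Longrightarrow>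
      \<exists>q. (p, q) \<in> r \<and> map_mat (tr p q) x = map_mat (tr p q) x'"
proof -
  obtain \<iota> :: "'u \<Rightarrow> 'u \<Rightarrow> 'u" where "\<And>p q x y. p \<in> P \<Longrightarrow> q \<in> P \<Longrightarrow> x \<in> carrier (F p) \<Longrightarrow> y \<in> carrier (F q) \<Longrightarrow>
     \<iota> p x = \<iota> q y \<longleftrightarrow> (\<exists>s. (p, s) \<in> r \<and> (q, s) \<in> r \<and> tr p s x = tr q s y)"
    using ex_inclusions by blast
  then interpret algebraic_colimit \<kappa> P r F Fm \<iota> by unfold_locales
  have coc: "cocone (poset_cat P r) (OS \<kappa>) F Fm L \<psi>" using col by (simp add: colimit_def)
  have \<psi>: "\<psi> p \<in> Hom (OS \<kappa>) (F p) L" if "p \<in> P" for p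
    using cocone_OS_D(2)[OF coc] that by simp
  obtain h where h: "h \<in> Hom (OS \<kappa>) L colim" "\<And>p. p \<in> P \<Longrightarrow> Cmp (OS \<kappa>) h (\<psi> p) = inc p"
    using col cocone_colim unfolding colimit_def poset_cat_simps by blast
  obtain k where k: "k \<in> Hom (OS \<kappa>) colim L" "\<And>p x. p \<in> P \<Longrightarrow> x \<in> carrier (F p) \<Longrightarrow> app k (\<iota> p x) = app (\<psi> p) x"
    using colim_map[OF coc] by blast
  have h\<psi>: "app h (app (\<psi> p) x) = \<iota> p x" if "p \<in> P" "x \<in> carrier (F p)" for p x
    using app_Cmp[OF \<psi>[OF that(1)] that(2), of h] h(2)[OF that(1)] that by (simp add: inc_def)
  \<comment> \<open>Both sides are endomorphisms of \<open>L\<close> compatible with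
    \<open>\<psi>\<close>, so the uniqueness in the universal property of \<open>L\<close>
    applies.\<close>
  have kh: "Cmp (OS \<kappa>) k h = Idn (OS \<kappa>) L"
  proof -
    have "\<exists>!g. g \<in> Hom (OS \<kappa>) L L \<and> (\<forall>p\<in>P. Cmp (OS \<kappa>) g (\<psi> p) = \<psi> p)"
      using col coc unfolding colimit_def poset_cat_simps by blast
    moreover have "Cmp (OS \<kappa>) k h \<in> Hom (OS \<kappa>) L L" by (rule comp_Hom_OS[OF h(1) k(1)])
    moreover have "Cmp (OS \<kappa>) (Cmp (OS \<kappa>) k h) (\<psi> p) = \<psi> p" if p: "p \<in> P" for p
      by (rule Hom_OS_eqI[OF comp_Hom_OS[OF \<psi>[OF p] comp_Hom_OS[OF h(1) k(1)]] \<psi>[OF p]])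
        (simp add: app_Cmp[OF \<psi>[OF p]] app_Cmp[OF h(1)] Hom_OS_closed[OF \<psi>[OF p]] h\<psi>[OF p] k(2)[OF p])
    moreover have "Idn (OS \<kappa>) L \<in> Hom (OS \<kappa>) L L" by (rule id_Hom_OS[OF Hom_OS_Obj1[OF h(1)]])
    moreover have "Cmp (OS \<kappa>) (Idn (OS \<kappa>) L) (\<psi> p) = \<psi> p" if "p \<in> P" for p
      using category.comp_id_left[OF category_OS \<psi>[OF that]] .
    ultimately show ?thesis by blast
  qed
  have kh: "app k (app h a) = a" if "a \<in> carrier L" for a
    using app_Cmp[OF h(1) that, of k] that by (simp add: kh Idn_OS)
  show "\<exists>p\<in>P. \<exists>x\<in>Mats n (F p). map_mat (app (\<psi> p)) x = y \<and> mnorm (F p) n x \<le> mnorm L n y"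
    if n: "1 \<le> n" and y: "y \<in> Mats n L"
  proof -
    have hy: "map_mat (app h) y \<in> Mats n colim" by (rule Mats_map[OF Hom_OS_clinear[OF h(1)] y])
    obtain p x where p: "p \<in> P" "x \<in> Mats n (F p)" "map_mat (\<iota> p) x = map_mat (app h) y"
      using lift_mat[OF hy] by blast
    obtain q where q: "(p, q) \<in> r" "\<forall>s. (q, s) \<in> r \<longrightarrow> mnorm (F s) n (map_mat (tr p s) x) = mnorm colim n (map_mat (app h) y)"
      using mnorm_colim_attained[OF n p(1,2)] p(3) by auto
    note Q = ord(2)[OF q(1)]
    let ?x = "map_mat (tr p q) x"
    have x: "?x \<in> Mats n (F q)" by (rule Mats_tr[OF q(1) p(2)])
    have "map_mat (app (\<psi> q)) ?x = map_mat (app k) (map_mat (\<iota> q) ?x)"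
      using x by (auto simp: mat_eq_iff Mats_iff k(2)[OF Q])
    also have "\<dots> = map_mat (app k) (map_mat (app h) y)" using map_\<iota>_tr[OF q(1) p(2)] p(3) by simp
    also have "\<dots> = y" using y by (auto simp: mat_eq_iff Mats_iff kh)
    finally have "map_mat (app (\<psi> q)) ?x = y" .
    moreover have "mnorm (F q) n ?x \<le> mnorm L n y"
      using q(2)[rule_format, OF ord(3)[OF Q]] cc_D[OF Hom_OS_cc[OF h(1)] n y] by linarith
    ultimately show ?thesis by (intro bexI[OF _ Q] bexI[OF _ x] conjI)
  qed
  show "\<exists>q. (p, q) \<in> r \<and> map_mat (tr p q) x = map_mat (tr p q) x'"
    if p: "p \<in> P" and x: "x \<in> Mats n (F p)" "x' \<in> Mats n (F p)"
      and eq: "map_mat (app (\<psi> p)) x = map_mat (app (\<psi> p)) x'"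
  proof -
    have "map_mat (\<iota> p) z = map_mat (app h) (map_mat (app (\<psi> p)) z)" if "z \<in> Mats n (F p)" for z
      using that by (auto simp: mat_eq_iff Mats_iff h\<psi>[OF p])
    from this[OF x(1)] this[OF x(2)] eq have "map_mat (\<iota> p) x = map_mat (\<iota> p) x'" by simp
    from map_\<iota>_eq[OF p p x this] show ?thesis by blast
  qed
qed

end


section \<open>The strong generating set\<close>

lemma map_Cmp_OS:
  "f \<in> Hom (OS \<kappa>) A B \<Longrightarrow> x \<in> Mats n A \<Longrightarrow> map_mat (app (Cmp (OS \<kappa>) g f)) x = map_mat (app g) (map_mat (app f) x)"
  by (auto simp: Mats_iff mat_eq_iff app_Cmp)

context
  fixes \<kappa> :: "'u rel" and n :: nat and T :: "'u opspace" and E :: "'u mat"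
  assumes n: "1 \<le> n" and T: "represents_ball \<kappa> n T E"
begin

lemma ball_Obj: "T \<in> Obj (OS \<kappa>)" and ball_E: "E \<in> Mats n T"
  using T by (simp_all add: represents_ball_def)

lemma ball_ex: "X \<in> Obj (OS \<kappa>) \<Longrightarrow> m \<in> Mats n X \<Longrightarrow> mnorm X n m \<le> 1 \<Longrightarrow>
    \<exists>f\<in>Hom (OS \<kappa>) T X. map_mat (app f) E = m"
  using T by (simp add: represents_ball_def)

lemma ball_eqI: "f \<in> Hom (OS \<kappa>) T X \<Longrightarrow> g \<in> Hom (OS \<kappa>) T X \<Longrightarrow> map_mat (app f) E = map_mat (app g) E \<Longrightarrow> f = g"
  using T unfolding represents_ball_def by blast

lemma ball_mem:
  assumes "f \<in> Hom (OS \<kappa>) T X"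
  shows "map_mat (app f) E \<in> Mats n X" "mnorm X n (map_mat (app f) E) \<le> 1"
  using Mats_map[OF Hom_OS_clinear[OF assms] ball_E] cc_D[OF Hom_OS_cc[OF assms] n ball_E] T
  by (auto simp: represents_ball_def)

text \<open>Morphisms from \<open>T\<close> are matrices in the closed unit ball, and
  \<open>colimit_lift_mat\<close> lifts such a matrix without increasing its norm, so the lift is
  again a morphism from \<open>T\<close>. Equality at a later stage is \<open>colimit_eq_mat\<close>
  for the images of \<open>E\<close>.\<close>

lemma presentable_ball:
  assumes U: "universe \<kappa>"
  shows "presentable \<kappa> (cardSuc natLeq) (OS \<kappa>) T"
proof (rule presentableI[OF category_OS ball_Obj])
  fix P :: "'u set" and r F Fm L \<psi>
  assume sys: "directed (cardSuc natLeq) P r" "|P| <o \<kappa>" "is_functor (poset_cat P r) (OS \<kappa>) F Fm"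
    and col: "colimit (poset_cat P r) (OS \<kappa>) F Fm L \<psi>"
  interpret directed_system \<kappa> P r F Fm by unfold_locales (fact U sys)+
  have \<psi>: "\<psi> p \<in> Hom (OS \<kappa>) (F p) L" if "p \<in> P" for p
    using col cocone_OS_D(2)[of "poset_cat P r" \<kappa> F Fm L \<psi> p] that by (simp add: colimit_def)
  show "\<exists>p\<in>P. \<exists>f\<in>Hom (OS \<kappa>) T (F p). Cmp (OS \<kappa>) (\<psi> p) f = g" if g: "g \<in> Hom (OS \<kappa>) T L" for g
  proof -
    obtain p x where p: "p \<in> P" "x \<in> Mats n (F p)" "map_mat (app (\<psi> p)) x = map_mat (app g) E" "mnorm (F p) n x \<le> 1"
      using colimit_lift_mat[OF col n ball_mem(1)[OF g]] ball_mem(2)[OF g] order_trans by blast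
    obtain f where f: "f \<in> Hom (OS \<kappa>) T (F p)" "map_mat (app f) E = x"
      using ball_ex[OF F_Obj[OF p(1)] p(2,4)] by blast
    have "Cmp (OS \<kappa>) (\<psi> p) f = g"
      by (rule ball_eqI[OF comp_Hom_OS[OF f(1) \<psi>[OF p(1)]] g]) (simp add: map_Cmp_OS[OF f(1) ball_E] f(2) p(3))
    then show ?thesis using p(1) f(1) by blast
  qed
  show "\<exists>q. (p, q) \<in> r \<and> Cmp (OS \<kappa>) (Fm (p, q)) f = Cmp (OS \<kappa>) (Fm (p, q)) f'"
    if p: "p \<in> P" and f: "f \<in> Hom (OS \<kappa>) T (F p)" "f' \<in> Hom (OS \<kappa>) T (F p)"
      and eq: "Cmp (OS \<kappa>) (\<psi> p) f = Cmp (OS \<kappa>) (\<psi> p) f'" for p f f'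
  proof -
    have "map_mat (app (\<psi> p)) (map_mat (app f) E) = map_mat (app (\<psi> p)) (map_mat (app f') E)"
      using eq by (simp flip: map_Cmp_OS[OF f(1) ball_E] map_Cmp_OS[OF f(2) ball_E])
    from colimit_eq_mat[OF col p ball_mem(1)[OF f(1)] ball_mem(1)[OF f(2)] this] obtain q
      where q: "(p, q) \<in> r" "map_mat (tr p q) (map_mat (app f) E) = map_mat (tr p q) (map_mat (app f') E)"
      by blast
    have "Cmp (OS \<kappa>) (Fm (p, q)) f = Cmp (OS \<kappa>) (Fm (p, q)) f'"
      by (rule ball_eqI[OF comp_Hom_OS[OF f(1) Fm_Hom[OF q(1)]] comp_Hom_OS[OF f(2) Fm_Hom[OF q(1)]]])
        (simp add: map_Cmp_OS[OF f(1) ball_E] map_Cmp_OS[OF f(2) ball_E] q(2))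
    then show ?thesis using q(1) by blast
  qed
qed

end

section \<open>Detection of morphisms and isomorphisms by the representing spaces\<close>

lemma clinear_inv:
  assumes m: "clinear A B m" and inj: "inj_on m (carrier A)" and surj: "m ` carrier A = carrier B"
  shows "clinear B A (inv_into (carrier A) m)"
  unfolding clinear_iff
proof (intro conjI allI ballI)
  let ?v = "inv_into (carrier A) m"
  show A: "cvs A" and "cvs B" using m by (auto dest: clinear_cvs)
  have v: "?v b \<in> carrier A" "m (?v b) = b" if "b \<in> carrier B" for b
    using that surj by (auto intro: inv_into_into f_inv_into_f)
  have vm: "?v (m a) = a" if "a \<in> carrier A" for a using inj that by simp
  fix b assume b: "b \<in> carrier B"
  show "?v b \<in> carrier A" using v b by simp
  show "?v (c \<odot>\<^bsub>B\<^esub> b) = c \<odot>\<^bsub>A\<^esub> ?v b" for c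
    using vm[OF cvs_smult[OF A v(1)[OF b]], of c] by (simp add: clinear_smult[OF m v(1)[OF b]] v(2)[OF b])
  fix d assume d: "d \<in> carrier B"
  show "?v (b \<oplus>\<^bsub>B\<^esub> d) = ?v b \<oplus>\<^bsub>A\<^esub> ?v d"
    using vm[OF cvs_add[OF A v(1)[OF b] v(1)[OF d]]]
    by (simp add: clinear_add[OF m v(1)[OF b] v(1)[OF d]] v(2)[OF b] v(2)[OF d])
qed

lemma single_eq_iff: "mat 1 1 (\<lambda>_. a) = mat 1 1 (\<lambda>_. b) \<longleftrightarrow> a = b"
  by (auto simp: mat_eq_iff)

text \<open>A common nonzero scalar brings both vectors into the unit ball, where they are
  accessible to maps from \<open>T 1\<close>, and can be cancelled afterwards.\<close>

lemma scaled_unit_vectors: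
  assumes X: "operator_space X" and ab: "a \<in> carrier X" "b \<in> carrier X"
  obtains c :: complex where "c \<noteq> 0" "nrm X (c \<odot>\<^bsub>X\<^esub> a) \<le> 1" "nrm X (c \<odot>\<^bsub>X\<^esub> b) \<le> 1"
proof
  \<comment> \<open>The summand 1 keeps the denominator positive when both vectors are zero.\<close>
  let ?t = "1 + nrm X a + nrm X b"
  have t: "?t > 0" "nrm X a \<le> ?t" "nrm X b \<le> ?t"
    using nrm_nonneg[OF X ab(1)] nrm_nonneg[OF X ab(2)] by auto
  then show "complex_of_real (inverse ?t) \<noteq> 0" by (simp del: of_real_inverse of_real_add)
  show "nrm X (complex_of_real (inverse ?t) \<odot>\<^bsub>X\<^esub> a) \<le> 1" "nrm X (complex_of_real (inverse ?t) \<odot>\<^bsub>X\<^esub> b) \<le> 1"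
    unfolding nrm_smult[OF X ab(1)] nrm_smult[OF X ab(2)] norm_of_real
    using t by (simp_all add: divide_simps)
qed

lemma cvs_smult_cancel:
  assumes "cvs X" "a \<in> carrier X" "b \<in> carrier X" "c \<odot>\<^bsub>X\<^esub> a = c \<odot>\<^bsub>X\<^esub> b" "c \<noteq> 0"
  shows "a = b"
proof -
  have "x = inverse c \<odot>\<^bsub>X\<^esub> (c \<odot>\<^bsub>X\<^esub> x)" if "x \<in> carrier X" for x
    using cvs_smult_smult[OF assms(1) that, of "inverse c" c] cvs_one[OF assms(1) that] assms(5) by simp
  from this[OF assms(2)] this[OF assms(3)] show ?thesis by (simp only: assms(4))
qed

context
  fixes \<kappa> :: "'u rel" and T :: "nat \<Rightarrow> 'u opspace" and E :: "nat \<Rightarrow> 'u mat"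
  assumes T: "\<And>n. 1 \<le> n \<Longrightarrow> represents_ball \<kappa> n (T n) (E n)"
begin

lemma ball_unit_vector:
  assumes X: "X \<in> Obj (OS \<kappa>)" and a: "a \<in> carrier X" "nrm X a \<le> 1"
  obtains s where "s \<in> Hom (OS \<kappa>) (T 1) X" "map_mat (app s) (E 1) = mat 1 1 (\<lambda>_. a)"
  using ball_ex[OF order_refl T[OF order_refl] X, of "mat 1 1 (\<lambda>_. a)"] a
  by (auto simp: Mats_iff nrm_def simp del: One_nat_def)

text \<open>Vectors in the unit ball correspond to morphisms from \<open>T 1\<close>, and a linear
  map is determined by its values on them. The remaining \<open>T n\<close> serve strong
  generation.\<close>

lemma generating_balls: "generating (OS \<kappa>) (T ` {1..})"
  unfolding generating_def
proof (intro conjI allI ballI impI)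
  show "T ` {1..} \<subseteq> Obj (OS \<kappa>)" using ball_Obj[OF _ T] by auto
  fix A B f g assume f: "f \<in> Hom (OS \<kappa>) A B" and g: "g \<in> Hom (OS \<kappa>) A B" and ne: "f \<noteq> g"
  note A = Hom_OS_os1[OF f]
  obtain a where a: "a \<in> carrier A" "app f a \<noteq> app g a" using Hom_OS_eqI[OF f g] ne by blast
  obtain c where c: "c \<noteq> 0" "nrm A (c \<odot>\<^bsub>A\<^esub> a) \<le> 1" using scaled_unit_vectors[OF A a(1) a(1)] .
  have ca: "c \<odot>\<^bsub>A\<^esub> a \<in> carrier A" by (rule cvs_smult[OF os_cvs[OF A] a(1)])
  obtain s where s: "s \<in> Hom (OS \<kappa>) (T 1) A" "map_mat (app s) (E 1) = mat 1 1 (\<lambda>_. c \<odot>\<^bsub>A\<^esub> a)"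
    using ball_unit_vector[OF Hom_OS_Obj1[OF f] ca c(2)] .
  note E1 = ball_E[OF order_refl T[OF order_refl]]
  have "Cmp (OS \<kappa>) f s \<noteq> Cmp (OS \<kappa>) g s"
  proof
    assume "Cmp (OS \<kappa>) f s = Cmp (OS \<kappa>) g s"
    then have "map_mat (app f) (map_mat (app s) (E 1)) = map_mat (app g) (map_mat (app s) (E 1))"
      unfolding map_Cmp_OS[OF s(1) E1, symmetric] by simp
    then have "app f (c \<odot>\<^bsub>A\<^esub> a) = app g (c \<odot>\<^bsub>A\<^esub> a)"
      unfolding s(2) single_map single_eq_iff .
    then have "c \<odot>\<^bsub>B\<^esub> app f a = c \<odot>\<^bsub>B\<^esub> app g a"
      by (simp add: clinear_smult[OF Hom_OS_clinear[OF f] a(1)] clinear_smult[OF Hom_OS_clinear[OF g] a(1)])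
    then show False
      using cvs_smult_cancel[OF os_cvs[OF Hom_OS_os2[OF f]] Hom_OS_closed[OF f a(1)] Hom_OS_closed[OF g a(1)]] c(1) a(2)
      by blast
  qed
  then show "\<exists>G\<in>T ` {1..}. \<exists>s\<in>Hom (OS \<kappa>) G A. Cmp (OS \<kappa>) f s \<noteq> Cmp (OS \<kappa>) g s"
    using s(1) by (intro bexI[of _ "T 1"] bexI[of _ s]) auto
qed

text \<open>Maps from \<open>T 1\<close> give bijectivity: injectivity from \<open>mono\<close>,
  surjectivity from \<open>factor\<close>. Maps from \<open>T n\<close> show that matrices in the
  unit ball over the codomain lift to the unit ball, which is contractivity of the inverse on n by n
  matrices.\<close>

lemma isomorphism_if_balls_factor:
  assumes mono: "monomorphism (OS \<kappa>) m"
    and factor: "\<And>n f. 1 \<le> n \<Longrightarrow> f \<in> Hom (OS \<kappa>) (T n) (Cod (OS \<kappa>) m) \<Longrightarrow>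
      \<exists>h\<in>Hom (OS \<kappa>) (T n) (Dom (OS \<kappa>) m). Cmp (OS \<kappa>) m h = f"
  shows "isomorphism (OS \<kappa>) m"
proof -
  define A B where "A = Dom (OS \<kappa>) m" and "B = Cod (OS \<kappa>) m"
  have arr: "m \<in> Arr (OS \<kappa>)" using mono by (simp add: monomorphism_def)
  then have m: "m \<in> Hom (OS \<kappa>) A B" by (simp add: Hom_def A_def B_def)
  note lin = Hom_OS_clinear[OF m] and A = Hom_OS_os1[OF m] and B = Hom_OS_os2[OF m]
  have lift: "\<exists>x\<in>Mats n A. mnorm A n x \<le> 1 \<and> map_mat (app m) x = y"
    if n: "1 \<le> n" and y: "y \<in> Mats n B" "mnorm B n y \<le> 1" for n y
  proof -
    obtain f where f: "f \<in> Hom (OS \<kappa>) (T n) B" "map_mat (app f) (E n) = y"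
      using ball_ex[OF n T[OF n] Hom_OS_Obj2[OF m] y] by blast
    obtain h where h: "h \<in> Hom (OS \<kappa>) (T n) A" "Cmp (OS \<kappa>) m h = f"
      using factor[OF n, folded A_def B_def, OF f(1)] by blast
    show ?thesis
      using ball_mem[OF n T[OF n] h(1)] map_Cmp_OS[OF h(1) ball_E[OF n T[OF n]], of m] f(2) h(2) by auto
  qed
  have inj: "inj_on (app m) (carrier A)"
  proof (rule inj_onI)
    fix a b assume ab: "a \<in> carrier A" "b \<in> carrier A" and eq: "app m a = app m b"
    obtain c where c: "c \<noteq> 0" "nrm A (c \<odot>\<^bsub>A\<^esub> a) \<le> 1" "nrm A (c \<odot>\<^bsub>A\<^esub> b) \<le> 1"
      using scaled_unit_vectors[OF A ab] .
    note cab = cvs_smult[OF os_cvs[OF A] ab(1), of c] cvs_smult[OF os_cvs[OF A] ab(2), of c]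
    obtain s where s: "s \<in> Hom (OS \<kappa>) (T 1) A" "map_mat (app s) (E 1) = mat 1 1 (\<lambda>_. c \<odot>\<^bsub>A\<^esub> a)"
      using ball_unit_vector[OF Hom_OS_Obj1[OF m] cab(1) c(2)] .
    obtain t where t: "t \<in> Hom (OS \<kappa>) (T 1) A" "map_mat (app t) (E 1) = mat 1 1 (\<lambda>_. c \<odot>\<^bsub>A\<^esub> b)"
      using ball_unit_vector[OF Hom_OS_Obj1[OF m] cab(2) c(3)] .
    note E1 = ball_E[OF order_refl T[OF order_refl]]
    have "Cmp (OS \<kappa>) m s = Cmp (OS \<kappa>) m t"
    proof (rule ball_eqI[OF order_refl T[OF order_refl] comp_Hom_OS[OF s(1) m] comp_Hom_OS[OF t(1) m]])
      show "map_mat (app (Cmp (OS \<kappa>) m s)) (E 1) = map_mat (app (Cmp (OS \<kappa>) m t)) (E 1)"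
        unfolding map_Cmp_OS[OF s(1) E1] map_Cmp_OS[OF t(1) E1] s(2) t(2) single_map single_eq_iff
        by (simp add: clinear_smult[OF lin ab(1)] clinear_smult[OF lin ab(2)] eq)
    qed
    \<comment> \<open>Left cancellation in the category becomes injectivity on vectors, since
      \<open>s\<close> and \<open>t\<close> stand for the scaled vectors.\<close>
    then have "s = t"
      using mono s(1) t(1) by (simp add: monomorphism_def A_def)
    then have "c \<odot>\<^bsub>A\<^esub> a = c \<odot>\<^bsub>A\<^esub> b" using s(2) t(2) single_eq_iff by metis
    then show "a = b" using cvs_smult_cancel[OF os_cvs[OF A] ab] c(1) by blast
  qed
  have "b \<in> app m ` carrier A" if b: "b \<in> carrier B" for b
  proof -
    obtain c where c: "c \<noteq> 0" "nrm B (c \<odot>\<^bsub>B\<^esub> b) \<le> 1" using scaled_unit_vectors[OF B b b] .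
    have "mat 1 1 (\<lambda>_. c \<odot>\<^bsub>B\<^esub> b) \<in> Mats 1 B"
      using cvs_smult[OF os_cvs[OF B] b] by (simp add: Mats_iff)
    then obtain x where x: "x \<in> Mats 1 A" "map_mat (app m) x = mat 1 1 (\<lambda>_. c \<odot>\<^bsub>B\<^esub> b)"
      using lift[OF order_refl, of "mat 1 1 (\<lambda>_. c \<odot>\<^bsub>B\<^esub> b)"] c(2) unfolding nrm_def by blast
    then obtain a where a: "a \<in> carrier A" "x = mat 1 1 (\<lambda>_. a)" unfolding Mats1_iff by blast
    then have ma: "app m a = c \<odot>\<^bsub>B\<^esub> b" using x(2) unfolding a(2) single_map single_eq_iff by simp
    have "app m (inverse c \<odot>\<^bsub>A\<^esub> a) = b"
      using cvs_smult_smult[OF os_cvs[OF B] b, of "inverse c" c] cvs_one[OF os_cvs[OF B] b] c(1)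
      by (simp add: clinear_smult[OF lin a(1)] ma)
    then show ?thesis using cvs_smult[OF os_cvs[OF A] a(1)] by blast
  qed
  then have surj: "app m ` carrier A = carrier B" using Hom_OS_closed[OF m] by auto
  define v where "v = inv_into (carrier A) (app m)"
  have vlin: "clinear B A v" unfolding v_def by (rule clinear_inv[OF lin inj surj])
  have vm: "v (app m a) = a" if "a \<in> carrier A" for a using inj that by (simp add: v_def)
  have mv: "app m (v b) = b" if "b \<in> carrier B" for b using surj that by (simp add: v_def f_inv_into_f)
  have "complete_contraction B A v"
    unfolding complete_contraction_def
  \<comment> \<open>The matrix is divided by its norm plus \<open>\<epsilon>\<close>, which is
    positive even for the zero matrix.\<close>
  proof (intro allI impI ballI, rule field_le_epsilon)
    fix n :: nat and y and \<epsilon> :: real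
    assume n: "1 \<le> n" and y: "y \<in> Mats n B" and "\<epsilon> > 0"
    let ?t = "mnorm B n y + \<epsilon>" and ?B = "mat_space n B" and ?A = "mat_space n A"
    have t: "?t > 0" using os_nonneg[OF B n y] \<open>\<epsilon> > 0\<close> by simp
    let ?c = "complex_of_real (inverse ?t)"
    note cA = cvs_mat_space[OF os_cvs[OF A], of n] and cB = cvs_mat_space[OF os_cvs[OF B], of n]
    have "mnorm B n (?c \<odot>\<^bsub>?B\<^esub> y) \<le> 1"
      unfolding os_smult[OF B n y] norm_of_real using t \<open>\<epsilon> > 0\<close> by (simp add: divide_simps)
    from lift[OF n cvs_smult[OF cB y] this] obtain x
      where x: "x \<in> Mats n A" "mnorm A n x \<le> 1" "map_mat (app m) x = ?c \<odot>\<^bsub>?B\<^esub> y" by blast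
    have "map_mat v (map_mat (app m) x) = x" using x(1) by (auto simp: Mats_iff mat_eq_iff vm)
    then have eq: "?c \<odot>\<^bsub>?A\<^esub> map_mat v y = x"
      using x(3) clinear_smult[OF clinear_map_mat[OF vlin] y, of ?c] by simp
    have "inverse ?t * mnorm A n (map_mat v y) = mnorm A n (?c \<odot>\<^bsub>?A\<^esub> map_mat v y)"
      unfolding os_smult[OF A n Mats_map[OF vlin y]] norm_of_real using t by simp
    also have "\<dots> \<le> 1" unfolding eq by (rule x(2))
    finally show "mnorm A n (map_mat v y) \<le> ?t" using t by (simp add: divide_simps)
  qed
  then have g: "(B, restrict v (carrier B), A) \<in> Hom (OS \<kappa>) B A"
    by (intro Hom_OS_I Hom_OS_Obj1[OF m] Hom_OS_Obj2[OF m] vlin)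
  have "Cmp (OS \<kappa>) (B, restrict v (carrier B), A) m = Idn (OS \<kappa>) A"
    by (rule Hom_OS_eqI[OF comp_Hom_OS[OF m g] id_Hom_OS[OF Hom_OS_Obj1[OF m]]])
      (simp add: app_Cmp[OF m] Idn_OS vm Hom_OS_closed[OF m])
  moreover have "Cmp (OS \<kappa>) m (B, restrict v (carrier B), A) = Idn (OS \<kappa>) B"
    by (rule Hom_OS_eqI[OF comp_Hom_OS[OF g m] id_Hom_OS[OF Hom_OS_Obj2[OF m]]])
      (simp add: app_Cmp[OF g] Idn_OS mv)
  ultimately show ?thesis
    unfolding isomorphism_def using arr g by (auto simp: A_def B_def)
qed

lemma strongly_generating_balls: "strongly_generating (OS \<kappa>) (T ` {1..})"
  unfolding strongly_generating_def
proof (intro conjI allI impI generating_balls, elim conjE)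
  fix m assume m: "monomorphism (OS \<kappa>) m" "\<not> isomorphism (OS \<kappa>) m"
  then obtain n f where "1 \<le> n" "f \<in> Hom (OS \<kappa>) (T n) (Cod (OS \<kappa>) m)"
      "\<not> (\<exists>h\<in>Hom (OS \<kappa>) (T n) (Dom (OS \<kappa>) m). Cmp (OS \<kappa>) m h = f)"
    using isomorphism_if_balls_factor[OF m(1)] by blast
  then show "\<exists>G\<in>T ` {1..}. \<exists>f\<in>Hom (OS \<kappa>) G (Cod (OS \<kappa>) m).
      \<not> (\<exists>h\<in>Hom (OS \<kappa>) G (Dom (OS \<kappa>) m). Cmp (OS \<kappa>) m h = f)"
    by (intro bexI[of _ "T n"] bexI[of _ f]) auto
qed

end

theorem theorem3p27:
  fixes \<kappa> :: "'u rel"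
  assumes "universe \<kappa>"
  shows "locally_countably_presentable \<kappa> (OS \<kappa>)"
proof -
  have "\<exists>T E. represents_ball \<kappa> n T E" if "1 \<le> n" for n
    by (rule ex_represents_ball[OF assms that])
  then obtain T E where T: "\<And>n. 1 \<le> n \<Longrightarrow> represents_ball \<kappa> n (T n) (E n)"
    by metis
  have "|T ` {1..}| <o \<kappa>"
    by (rule small_countable[OF assms]) simp
  moreover have "\<forall>G\<in>T ` {1..}. presentable \<kappa> (cardSuc natLeq) (OS \<kappa>) G"
    using presentable_ball[OF _ T assms] by auto
  ultimately show ?thesis
    unfolding locally_countably_presentable_def locally_presentable_def
    using category_OS cocomplete_OS[OF assms] strongly_generating_balls[OF T] by blast
qed

end
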